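(* Let $n\ge 2$ and let $W:\mathbb{R}^n\to(0,+\infty)$ satisfy $\int_{\mathbb{R}^n} W^{1-n}<+\infty$. Then for any smooth function $g:\mathbb{R}^n\to(0,+\infty)$ such that $\int_{\mathbb{R}^n} W^*(\nabla g)\,g^{-n}<+\infty$, $\int_{\mathbb{R}^n} g^{1-n}<+\infty$ and $$\int_{\mathbb{R}^n} g^{-n}=\int_{\mathbb{R}^n} W^{-n}=1,$$ one has $$\int_{\mathbb{R}^n} W^*(\nabla g)\,g^{-n}\ \ge\ \frac{1}{n-1}\int_{\mathbb{R}^n} W^{1-n},$$ with equality if $g$ is equal to $W$ and is convex.
   Context: All integrals are with respect to Lebesgue measure. For a function $W:\mathbb{R}^n\to\mathbb{R}\cup\{+\infty\}$, $W^*$ denotes its Legendre transform, $W^*(y)=\sup_{x\in\mathbb{R}^n}\{x\cdot y-W(x)\}$, $y\in\mathbb{R}^n$. *)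

theory Defs
  imports "HOL-Analysis.Analysis"
begin

(* C^k regularity on the whole space.  In finite dimension, f is C^(k+1) iff it is everywhere
   Frechet differentiable and each directional derivative is C^k. *)
primrec Ck :: "nat \<Rightarrow> ('a::euclidean_space \<Rightarrow> 'b::euclidean_space) \<Rightarrow> bool" where
  "Ck 0 f \<longleftrightarrow> continuous_on UNIV f"
| "Ck (Suc k) f \<longleftrightarrow> (\<forall>x. f differentiable (at x)) \<and>
     (\<forall>v. Ck k (\<lambda>x. frechet_derivative f (at x) v))"

definition smooth :: "('a::euclidean_space \<Rightarrow> 'b::euclidean_space) \<Rightarrow> bool" where
  "smooth f \<longleftrightarrow> (\<forall>k. Ck k f)"

definition gradient :: "(real ^ 'n \<Rightarrow> real) \<Rightarrow> real ^ 'n \<Rightarrow> real ^ 'n" where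
  "gradient f x = (\<chi> i. frechet_derivative f (at x) (axis i 1))"

lemma gradient_GDERIV:
  assumes "f differentiable (at x)"
  shows "GDERIV f x :> gradient f x"
proof -
  let ?D = "frechet_derivative f (at x)"
  have d: "(f has_derivative ?D) (at x)"
    using assms frechet_derivative_works by blast
  then have lin: "linear ?D"
    by (rule has_derivative_linear)
  have "?D h = inner h (gradient f x)" for h
  proof -
    have "?D h = ?D (\<Sum>i\<in>UNIV. (h $ i) *\<^sub>R axis i 1)"
      by (simp add: basis_expansion flip: scalar_mult_eq_scaleR)
    also have "\<dots> = (\<Sum>i\<in>UNIV. h $ i * ?D (axis i 1))"
      by (simp add: linear_sum[OF lin] linear_scale[OF lin])
    also have "\<dots> = inner h (gradient f x)"
      by (simp add: inner_vec_def gradient_def)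
    finally show ?thesis .
  qed
  then have "?D = (\<lambda>h. inner h (gradient f x))"
    by (rule ext)
  with d show ?thesis
    by (simp add: gderiv_def)
qed

definition legendre :: "('a::real_inner \<Rightarrow> ereal) \<Rightarrow> 'a \<Rightarrow> ereal" where
  "legendre W y = (SUP x. ereal (inner x y) - W x)"

(* Integral of an extended-real function with values in [-\<infinity>, \<infinity>], positive part minus
   negative part.  For a measurable f it is the usual integral as soon as one of the two parts is
   finite; since \<infinity> - \<infinity> = \<infinity> in ereal, a value < \<infinity> is never due to an
   undefined integral. *)
definition ext_integral :: "'a measure \<Rightarrow> ('a \<Rightarrow> ereal) \<Rightarrow> ereal" where
  "ext_integral M f =
     enn2ereal (\<integral>\<^sup>+ x. e2ennreal (f x) \<partial>M) - enn2ereal (\<integral>\<^sup>+ x. e2ennreal (- f x) \<partial>M)"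

lemma ext_integral_eq_lebesgue_integral:
  assumes "integrable M f"
  shows "ext_integral M (\<lambda>x. ereal (f x)) = ereal (\<integral>x. f x \<partial>M)"
proof -
  from assms obtain r q where rq: "0 \<le> r" "0 \<le> q"
    "(\<integral>\<^sup>+x. ennreal (f x) \<partial>M) = ennreal r" "(\<integral>\<^sup>+x. ennreal (- f x) \<partial>M) = ennreal q"
    "f \<in> borel_measurable M" "integral\<^sup>L M f = r - q"
    by (rule integrableE)
  then show ?thesis
    by (simp add: ext_integral_def flip: ennreal.abs_eq)
qed

end

theory Submission
  imports Defs "HOL-Probability.Distribution_Functions"
begin

text \<open>
  Brunn--Minkowski for \<open>{g < t} + s{W < b}\<close>, differentiated at \<open>s = 0\<close>, shows for every cutoff
  \<open>\<psi> \<ge> 0\<close> and every level \<open>b\<close> that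
  \<open>\<integral> \<psi>(g) (W\<^sup>*(\<nabla>g) + b) \<ge> n |{W < b}|\<^bsup>1/n\<^esup> \<integral> \<psi>(t) |{g < t}|\<^bsup>1-1/n\<^esup> dt\<close>.
  A partition of unity lets \<open>b\<close> depend on \<open>t\<close>. Take \<open>b(t)\<close> to be the monotone map transporting
  \<open>n t\<^bsup>-n-1\<^esup> |{g < t}| dt\<close> to \<open>n b\<^bsup>-n-1\<^esup> |{W < b}| db\<close>; both have the masses \<open>\<integral> g\<^bsup>-n\<^esup> = \<integral> W\<^bsup>-n\<^esup> = 1\<close>.
  As \<open>\<psi>(t)\<close> increases to \<open>t\<^bsup>-n\<^esup>\<close>, an integration by parts and the scalar inequality
  \<open>n z + \<lambda>\<^bsup>n+1\<^esup> z\<^bsup>-n\<^esup> \<ge> (n + 1) \<lambda>\<close> leave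
  \<open>\<integral> W\<^sup>*(\<nabla>g) g\<^bsup>-n\<^esup> \<ge> \<integral> b\<^bsup>-n\<^esup> |{W < b}| db = (1/(n-1)) \<integral> W\<^bsup>1-n\<^esup>\<close>.
  If \<open>g = W\<close> is convex, then \<open>W\<^sup>*(\<nabla>g) = x \<bullet> \<nabla>g - g\<close>, and the reverse inequality follows by
  differentiating \<open>\<integral> g(\<lambda>x)\<^bsup>1-n\<^esup> dx = \<lambda>\<^bsup>-n\<^esup> \<integral> g\<^bsup>1-n\<^esup>\<close> at \<open>\<lambda> = 1\<close>.
\<close>

section \<open>The Brunn--Minkowski inequality\<close>

text \<open>Only positivity and integrability are known of \<open>W\<close>, so its sublevel sets
  carry no geometry; Brunn-Minkowski survives this, in the form open plus compact, because {g < t}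
  is open and {W < b} is exhausted from inside by compact sets. The sets {g < t} have finite volume
  but may be unbounded; hence \<open>g\<close> is perturbed by small multiples of a coercive
  function. The negative part of the weighted Legendre term is not known to be integrable in
  advance, so the limits combine dominated convergence for the positive part with Fatou's lemma for
  the negative part. In the scalar inequality, \<lambda> = b/t and z = (|{W < b}| / |{g <
  t}|)^(1/n). Mass balance of the transport reads b' = \<lambda>^(n+1) z^(-n), so the inequality
  says n z + b' \<ge> (n + 1) \<lambda>: n z is the Brunn-Minkowski term, and b' is the term left by
  the integration by parts. If g = W, then b is the identity above the infimum of \<open>g\<close>
  and z = \<lambda> = 1, a case of equality; this is why the constant 1/(n-1) comes out
  sharp.\<close>

lemma open_set_plus:
  fixes S T :: "'a::real_normed_vector set"
  assumes "open S"
  shows "open (S + T)"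
proof -
  have "S + T = (\<Union>x\<in>S. \<Union>y\<in>T. {x + y})" by (auto simp: set_plus_def)
  then show ?thesis using open_sums[of S T] assms by simp
qed

lemma emeasure_hyperplane:
  fixes i :: "'a::euclidean_space"
  assumes "i \<in> Basis"
  shows "emeasure lborel {x. x \<bullet> i = c} = 0"
proof -
  have "{x. x \<bullet> i = c} \<in> null_sets lebesgue"
    using negligible_standard_hyperplane[OF assms, of c] by (simp add: negligible_iff_null_sets)
  then have "{x. x \<bullet> i = c} \<in> null_sets lborel"
    by (subst (asm) null_sets_completion_iff) auto
  then show ?thesis by auto
qed

section \<open>Open boxes: half-space sections, Minkowski sums, volumes\<close>

lemma box_Int_halfspaces:
  fixes a b i :: "'a::euclidean_space"
  assumes "i \<in> Basis"
  shows "\<exists>a' b'. box a b \<inter> {x. x \<bullet> i < c} = box a' b'"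
    and "\<exists>a' b'. box a b \<inter> {x. c < x \<bullet> i} = box a' b'"
proof -
  let ?b = "\<Sum>j\<in>Basis. (if j = i then min (b \<bullet> j) c else b \<bullet> j) *\<^sub>R j"
  let ?a = "\<Sum>j\<in>Basis. (if j = i then max (a \<bullet> j) c else a \<bullet> j) *\<^sub>R j"
  have eqs: "box a b \<inter> {x. x \<bullet> i < c} = box a ?b" "box a b \<inter> {x. c < x \<bullet> i} = box ?a b"
    using assms by (auto simp: box_def split: if_splits)
  from eqs(1) show "\<exists>a' b'. box a b \<inter> {x. x \<bullet> i < c} = box a' b'" by (intro exI)
  from eqs(2) show "\<exists>a' b'. box a b \<inter> {x. c < x \<bullet> i} = box a' b'" by (intro exI)
qed

lemma box_set_plus:
  fixes a b c d :: "'a::euclidean_space"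
  assumes "box a b \<noteq> {}" "box c d \<noteq> {}"
  shows "box a b + box c d = box (a + c) (b + d)"
proof
  show "box a b + box c d \<subseteq> box (a + c) (b + d)"
    by (force simp: set_plus_def mem_box inner_simps intro: add_strict_mono)
  show "box (a + c) (b + d) \<subseteq> box a b + box c d"
  proof
    fix z assume z: "z \<in> box (a + c) (b + d)"
    have ab: "a \<bullet> i < b \<bullet> i" and cd: "c \<bullet> i < d \<bullet> i" if "i \<in> Basis" for i
      using assms that by (auto simp: box_ne_empty)
    \<comment> \<open>\<open>l i\<close> is the relative position of \<open>z\<close> along the
      \<open>i\<close>-th edge of the sum box; the points at the same relative positions in the two
      summands add up to \<open>z\<close>.\<close>
    define l where "l i = (z \<bullet> i - (a + c) \<bullet> i) / ((b + d) \<bullet> i - (a + c) \<bullet> i)" for i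
    have l: "0 < l i" "l i < 1" if "i \<in> Basis" for i
      using z that ab[OF that] cd[OF that] by (auto simp: l_def mem_box inner_simps divide_simps)
    define x where "x = (\<Sum>i\<in>Basis. (a \<bullet> i + l i * (b \<bullet> i - a \<bullet> i)) *\<^sub>R i)"
    define y where "y = (\<Sum>i\<in>Basis. (c \<bullet> i + l i * (d \<bullet> i - c \<bullet> i)) *\<^sub>R i)"
    have conv: "p < p + t * (q - p) \<and> p + t * (q - p) < q" if "p < q" "0 < t" "t < 1" for p q t :: real
    proof -
      have "0 < t * (q - p)" "t * (q - p) < 1 * (q - p)"
        using that by (simp, intro mult_strict_right_mono) auto
      then show ?thesis by auto
    qed
    have "x \<in> box a b" "y \<in> box c d"
      using conv ab cd l by (simp_all add: mem_box x_def y_def)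
    moreover have "z = x + y"
    proof (rule euclidean_eqI)
      fix i :: 'a assume i: "i \<in> Basis"
      have ne: "(b + d) \<bullet> i - (a + c) \<bullet> i > 0" using ab[OF i] cd[OF i] by (simp add: inner_simps)
      have "l i * ((b + d) \<bullet> i - (a + c) \<bullet> i) = z \<bullet> i - (a + c) \<bullet> i"
        using ne by (simp add: l_def)
      moreover have "x \<bullet> i = a \<bullet> i + l i * (b \<bullet> i - a \<bullet> i)" "y \<bullet> i = c \<bullet> i + l i * (d \<bullet> i - c \<bullet> i)"
        using i by (simp_all add: x_def y_def)
      ultimately show "z \<bullet> i = (x + y) \<bullet> i"
        by (simp add: inner_simps algebra_simps)
    qed
    ultimately show "z \<in> box a b + box c d" by (auto simp: set_plus_def)
  qed
qed

lemma measure_box_pos: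
  fixes a b :: "'a::euclidean_space"
  assumes "box a b \<noteq> {}"
  shows "measure lborel (box a b) = (\<Prod>i\<in>Basis. (b - a) \<bullet> i)" "\<And>i. i \<in> Basis \<Longrightarrow> (b - a) \<bullet> i > 0"
proof -
  show "\<And>i. i \<in> Basis \<Longrightarrow> (b - a) \<bullet> i > 0"
    using assms by (auto simp: box_ne_empty inner_simps)
  then show "measure lborel (box a b) = (\<Prod>i\<in>Basis. (b - a) \<bullet> i)"
    by (subst measure_lborel_box_eq) (auto simp: inner_simps less_imp_le)
qed

text \<open>Brunn-Minkowski for two boxes with edge lengths \<open>x\<close> and \<open>y\<close>.
  The arithmetic-geometric mean inequality is applied to the ratios x_i / (x_i + y_i) and y_i / (x_i
  + y_i), whose means add up to 1.\<close>

lemma root_prod_add_le: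
  fixes x y :: "'i \<Rightarrow> real"
  assumes I: "finite I" "I \<noteq> {}" and x: "\<And>i. i \<in> I \<Longrightarrow> x i > 0" and y: "\<And>i. i \<in> I \<Longrightarrow> y i > 0"
  shows "root (card I) (\<Prod>i\<in>I. x i) + root (card I) (\<Prod>i\<in>I. y i) \<le> root (card I) (\<Prod>i\<in>I. x i + y i)"
proof -
  define n where "n = card I"
  have n: "n > 0" using I by (simp add: n_def card_gt_0_iff)
  have AG: "root n (\<Prod>i\<in>I. t i) \<le> (\<Sum>i\<in>I. t i / n)" if "\<And>i. i \<in> I \<Longrightarrow> t i > 0" for t :: "'i \<Rightarrow> real"
    using arith_geom_mean[OF I, of t] that n
    by (simp add: n_def root_powr_inverse prod_pos less_imp_le inverse_eq_divide)
  define s where "s i = x i + y i" for i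
  have s: "s i > 0" if "i \<in> I" for i using x[OF that] y[OF that] by (simp add: s_def)
  have S: "root n (\<Prod>i\<in>I. s i) > 0" using n s by (simp add: prod_pos)
  have "root n (\<Prod>i\<in>I. x i) / root n (\<Prod>i\<in>I. s i) + root n (\<Prod>i\<in>I. y i) / root n (\<Prod>i\<in>I. s i)
      = root n (\<Prod>i\<in>I. x i / s i) + root n (\<Prod>i\<in>I. y i / s i)"
    by (simp add: prod_dividef real_root_divide)
  also have "\<dots> \<le> (\<Sum>i\<in>I. (x i / s i) / n) + (\<Sum>i\<in>I. (y i / s i) / n)"
    using x y s by (intro add_mono AG) auto
  also have "\<dots> = (\<Sum>i\<in>I. 1 / n)"
    unfolding sum.distrib[symmetric]
  proof (rule sum.cong)
    fix i assume "i \<in> I"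
    then have "s i \<noteq> 0" using s by force
    then show "x i / s i / real n + y i / s i / real n = 1 / real n"
      by (simp add: add_divide_distrib[symmetric]) (simp add: s_def add_divide_distrib[symmetric])
  qed simp
  also have "\<dots> = 1" using n by (simp add: n_def)
  finally have "(root n (\<Prod>i\<in>I. x i) + root n (\<Prod>i\<in>I. y i)) / root n (\<Prod>i\<in>I. s i) \<le> 1"
    by (simp add: add_divide_distrib)
  with S show ?thesis by (simp add: n_def s_def)
qed

text \<open>\<open>k\<close> is only an upper bound for the number of boxes, so it survives
  intersection with a half-space, where boxes can disappear; it also serves as the induction
  parameter. The boxes are open and nonempty, so that the union is open and distinct boxes are
  separated by a coordinate hyperplane.\<close>

definition box_union :: "nat \<Rightarrow> 'a::euclidean_space set \<Rightarrow> bool" where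
  "box_union k A \<longleftrightarrow> (\<exists>P. finite P \<and> card P \<le> k \<and> disjoint P \<and>
     (\<forall>S\<in>P. S \<noteq> {} \<and> (\<exists>a b. S = box a b)) \<and> A = \<Union>P)"

lemma box_union_open: "box_union k A \<Longrightarrow> open A"
  by (auto simp: box_union_def) (metis open_Union open_box)

lemma box_union_bounded: "box_union k A \<Longrightarrow> bounded A"
  by (auto simp: box_union_def) (metis bounded_Union bounded_box)

lemma box_union_Int:
  assumes P: "finite P" "disjoint P" "\<And>S. S \<in> P \<Longrightarrow> \<exists>a b. S = box a b"
    and H: "\<And>a b. \<exists>a' b'. box a b \<inter> H = box a' b'"
    and k: "card {S \<in> P. S \<inter> H \<noteq> {}} \<le> k"
  shows "box_union k (\<Union>P \<inter> H)"
proof -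
  let ?Q = "(\<lambda>S. S \<inter> H) ` {S \<in> P. S \<inter> H \<noteq> {}}"
  have "finite ?Q" using P by auto
  moreover have "card ?Q \<le> k"
    using k card_image_le[of "{S \<in> P. S \<inter> H \<noteq> {}}" "\<lambda>S. S \<inter> H"] P by auto
  moreover have "disjoint ?Q"
    using P(2) unfolding pairwise_def disjnt_def by blast
  moreover have "\<forall>S\<in>?Q. S \<noteq> {} \<and> (\<exists>a b. S = box a b)"
    using P(3) H by (auto; metis)
  moreover have "\<Union>P \<inter> H = \<Union>?Q" by auto
  ultimately show ?thesis unfolding box_union_def by blast
qed

lemma box_union_halfspaces:
  assumes "box_union k A" "i \<in> Basis"
  shows "box_union k (A \<inter> {x. x \<bullet> i < c})" "box_union k (A \<inter> {x. c < x \<bullet> i})"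
proof -
  obtain P where P: "finite P" "card P \<le> k" "disjoint P" "\<forall>S\<in>P. S \<noteq> {} \<and> (\<exists>a b. S = box a b)" "A = \<Union>P"
    using assms(1) by (auto simp: box_union_def)
  have c: "card {S \<in> P. S \<inter> H \<noteq> {}} \<le> k" for H
    using P(2) card_mono[OF P(1), of "{S \<in> P. S \<inter> H \<noteq> {}}"] by auto
  show "box_union k (A \<inter> {x. x \<bullet> i < c})"
    unfolding P(5) by (rule box_union_Int[OF P(1,3) _ box_Int_halfspaces(1)[OF assms(2)] c]) (use P(4) in blast)
  show "box_union k (A \<inter> {x. c < x \<bullet> i})"
    unfolding P(5) by (rule box_union_Int[OF P(1,3) _ box_Int_halfspaces(2)[OF assms(2)] c]) (use P(4) in blast)
qed

text \<open>The negated hypothesis forces exactly k + 2 boxes. Two disjoint boxes are separated by a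
  coordinate hyperplane, and each side of it loses at least the box lying on the other side.\<close>

lemma box_union_split:
  fixes A :: "'a::euclidean_space set"
  assumes "box_union (Suc (Suc k)) A" "\<not> box_union (Suc k) A"
  obtains i :: 'a and c where "i \<in> Basis" "box_union (Suc k) (A \<inter> {x. x \<bullet> i < c})" "box_union (Suc k) (A \<inter> {x. c < x \<bullet> i})"
    "A \<inter> {x. x \<bullet> i < c} \<noteq> {}" "A \<inter> {x. c < x \<bullet> i} \<noteq> {}"
proof -
  obtain P where P: "finite P" "card P \<le> Suc (Suc k)" "disjoint P" "\<forall>S\<in>P. S \<noteq> {} \<and> (\<exists>a b. S = box a b)" "A = \<Union>P"
    using assms(1) by (auto simp: box_union_def)
  have "\<not> card P \<le> Suc k" using assms(2) P unfolding box_union_def by blast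
  then have cP: "card P = Suc (Suc k)" using P by auto
  then obtain S T where ST: "S \<in> P" "T \<in> P" "S \<noteq> T"
    by (metis card_1_singleton_iff card_2_iff' card_le_Suc0_iff_eq P(1) not_less_eq_eq le_add2 plus_1_eq_Suc Suc_le_mono zero_le)
  then obtain a b c d where ab: "S = box a b" and cd: "T = box c d" using P(4) by metis
  have ne: "box a b \<noteq> {}" "box c d \<noteq> {}" using ST P(4) ab cd by auto
  have "box a b \<inter> box c d = {}"
    using P(3) ST ab cd by (auto simp: pairwise_def disjnt_def)
  then obtain i where i: "i \<in> Basis" and "b \<bullet> i \<le> a \<bullet> i \<or> d \<bullet> i \<le> c \<bullet> i \<or> b \<bullet> i \<le> c \<bullet> i \<or> d \<bullet> i \<le> a \<bullet> i"
    using disjoint_interval(4)[of a b c d] by auto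
  moreover have "a \<bullet> i < b \<bullet> i" "c \<bullet> i < d \<bullet> i" using ne i by (auto simp: box_ne_empty)
  ultimately consider "b \<bullet> i \<le> c \<bullet> i" | "d \<bullet> i \<le> a \<bullet> i" by linarith
  then obtain U V e where UV: "U \<in> P" "V \<in> P" "U \<subseteq> {x. x \<bullet> i < e}" "V \<subseteq> {x. e < x \<bullet> i}"
  proof cases
    case 1
    then have "S \<subseteq> {x. x \<bullet> i < b \<bullet> i}" "T \<subseteq> {x. b \<bullet> i < x \<bullet> i}" using i by (force simp: ab cd mem_box)+
    with ST that show ?thesis by blast
  next
    case 2
    then have "T \<subseteq> {x. x \<bullet> i < d \<bullet> i}" "S \<subseteq> {x. d \<bullet> i < x \<bullet> i}" using i by (force simp: ab cd mem_box)+
    with ST that show ?thesis by blast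
  qed
  have c: "card {S \<in> P. S \<inter> H \<noteq> {}} \<le> Suc k" if "Z \<in> P" "Z \<inter> H = {}" for Z H
  proof -
    have "{S \<in> P. S \<inter> H \<noteq> {}} \<subset> P" using that by auto
    from psubset_card_mono[OF P(1) this] cP show ?thesis by simp
  qed
  show thesis
  proof
    show "i \<in> Basis" by fact
    have U: "U \<inter> {x. e < x \<bullet> i} = {}" and V: "V \<inter> {x. x \<bullet> i < e} = {}" using UV by force+
    show "box_union (Suc k) (A \<inter> {x. x \<bullet> i < e})"
      unfolding P(5) by (rule box_union_Int[OF P(1,3) _ box_Int_halfspaces(1)[OF i] c[OF UV(2) V]]) (use P(4) in blast)
    show "box_union (Suc k) (A \<inter> {x. e < x \<bullet> i})"
      unfolding P(5) by (rule box_union_Int[OF P(1,3) _ box_Int_halfspaces(2)[OF i] c[OF UV(1) U]]) (use P(4) in blast)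
    show "A \<inter> {x. x \<bullet> i < e} \<noteq> {}" "A \<inter> {x. e < x \<bullet> i} \<noteq> {}"
    proof -
      have "U \<noteq> {}" "V \<noteq> {}" using bspec[OF P(4) UV(1)] bspec[OF P(4) UV(2)] by simp_all
      then obtain u v where uv: "u \<in> U" "v \<in> V" by fastforce
      then have "u \<in> A \<inter> {x. x \<bullet> i < e}" "v \<in> A \<inter> {x. e < x \<bullet> i}" using UV P(5) by auto
      then show "A \<inter> {x. x \<bullet> i < e} \<noteq> {}" "A \<inter> {x. e < x \<bullet> i} \<noteq> {}" by (metis empty_iff)+
    qed
  qed
qed

section \<open>Cutting a set by a hyperplane\<close>

lemma bounded_lborel_fmeasurable:
  "bounded (A :: 'a::euclidean_space set) \<Longrightarrow> A \<in> sets borel \<Longrightarrow> A \<in> fmeasurable lborel"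
  by (intro fmeasurableI emeasure_bounded_finite) simp_all

lemma measure_split_hyperplane:
  fixes A :: "'a::euclidean_space set"
  assumes A: "A \<in> fmeasurable lborel" and i: "i \<in> Basis"
  shows "measure lborel A = measure lborel (A \<inter> {x. x \<bullet> i < c}) + measure lborel (A \<inter> {x. c < x \<bullet> i})"
proof -
  let ?B = "(A \<inter> {x. x \<bullet> i < c}) \<union> (A \<inter> {x. c < x \<bullet> i})"
  have [measurable]: "A \<in> sets borel" using A by (auto dest: fmeasurableD)
  have N: "{x. x \<bullet> i = c} \<in> null_sets lborel"
    using emeasure_hyperplane[OF i, of c] by (auto intro!: null_setsI)
  have "A - ?B \<subseteq> {x. x \<bullet> i = c}" by auto
  then have "measure lborel A = measure lborel ?B"
    using N by (intro measure_eq_AE) (auto intro!: AE_I'[OF N])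
  also have "\<dots> = measure lborel (A \<inter> {x. x \<bullet> i < c}) + measure lborel (A \<inter> {x. c < x \<bullet> i})"
  proof -
    have "A \<inter> {x. x \<bullet> i < c} \<in> fmeasurable lborel" "A \<inter> {x. c < x \<bullet> i} \<in> fmeasurable lborel"
      using A by (auto intro!: fmeasurable_Int_fmeasurable)
    note measure_Un3[OF this]
    moreover have "(A \<inter> {x. x \<bullet> i < c}) \<inter> (A \<inter> {x. c < x \<bullet> i}) = {}" by auto
    ultimately show ?thesis by simp
  qed
  finally show ?thesis .
qed

lemma open_measure_pos:
  fixes A :: "'a::euclidean_space set"
  assumes "open A" "bounded A" "A \<noteq> {}"
  shows "measure lborel A > 0"
proof -
  have "A \<in> lmeasurable" "\<not> negligible A"
    using assms open_not_negligible by (auto simp: bounded_set_imp_lmeasurable)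
  then have "measure lebesgue A > 0" using negligible_iff_measure zero_less_measure_iff by blast
  then show "measure lborel A > 0" using assms by (simp add: measure_completion)
qed

text \<open>Intermediate value theorem for the distribution function of the \<open>i\<close>-th
  coordinate on \<open>B\<close>; it is continuous because hyperplanes are null sets.\<close>

lemma split_at_ratio:
  fixes B :: "'a::euclidean_space set"
  assumes B: "B \<in> fmeasurable lborel" and i: "i \<in> Basis" and t: "0 < t" "t < measure lborel B"
  obtains d where "measure lborel (B \<inter> {x. x \<bullet> i < d}) = t"
proof -
  have [measurable]: "B \<in> sets borel" using B by (auto dest: fmeasurableD)
  define M where "M = distr (restrict_space lborel B) borel (\<lambda>x. x \<bullet> i)"
  have meas: "(\<lambda>x. x \<bullet> i) \<in> restrict_space lborel B \<rightarrow>\<^sub>M borel"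
    by (intro measurable_restrict_space1) simp
  have sB: "space (restrict_space lborel B) = B" by (simp add: space_restrict_space)
  have mM: "measure M S = measure lborel (B \<inter> {x. x \<bullet> i \<in> S})" if "S \<in> sets borel" for S
  proof -
    have "measure M S = measure (restrict_space lborel B) ({x. x \<bullet> i \<in> S} \<inter> B)"
      unfolding M_def using that by (subst measure_distr[OF meas]) (auto simp: sB vimage_def)
    also have "\<dots> = measure lborel (B \<inter> {x. x \<bullet> i \<in> S})"
      by (subst measure_restrict_space) (auto simp: Int_commute)
    finally show ?thesis .
  qed
  have "finite_measure M"
  proof
    have "emeasure M (space M) = emeasure lborel B"
      unfolding M_def using emeasure_distr[OF meas, of UNIV]
      by (simp add: sB emeasure_restrict_space)
    then show "emeasure M (space M) \<noteq> \<infinity>" using B by (simp add: fmeasurable_def less_top[symmetric])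
  qed
  then interpret finite_borel_measure M
    by (simp add: finite_borel_measure_def finite_borel_measure_axioms_def M_def)
  have cdf: "cdf M d = measure lborel (B \<inter> {x. x \<bullet> i < d})" for d
    unfolding cdf_def mM[of "{..d}", simplified]
  proof (rule measure_eq_AE)
    have "{x. x \<bullet> i = d} \<in> null_sets lborel"
      using emeasure_hyperplane[OF i, of d] by (auto intro!: null_setsI)
    then show "AE x in lborel. (x \<in> B \<inter> {x. x \<bullet> i \<le> d}) = (x \<in> B \<inter> {x. x \<bullet> i < d})"
      by (rule AE_I') auto
  qed auto
  have cont: "isCont (cdf M) x" for x
  proof -
    have "measure M {x} \<le> measure lborel {y. y \<bullet> i = x}"
      unfolding mM[of "{x}", simplified] using emeasure_hyperplane[OF i, of x]
      by (intro measure_mono_fmeasurable) (auto simp: fmeasurable_def)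
    also have "\<dots> = 0" using emeasure_hyperplane[OF i, of x] by (simp add: measure_def)
    finally show ?thesis by (simp add: isCont_cdf order.antisym)
  qed
  have "measure M (space M) = measure lborel B"
    using mM[of UNIV] by (simp add: M_def)
  then have "\<forall>\<^sub>F x in at_top. t < cdf M x"
    using cdf_lim_at_top t(2) by (auto dest: order_tendstoD)
  moreover have "\<forall>\<^sub>F x in at_bot. cdf M x < t"
    using cdf_lim_at_bot t(1) by (auto dest: order_tendstoD)
  ultimately obtain p q where p: "\<And>x. x \<ge> p \<Longrightarrow> t < cdf M x" and q: "\<And>x. x \<le> q \<Longrightarrow> cdf M x < t"
    by (auto simp: eventually_at_top_linorder eventually_at_bot_linorder)
  have "\<exists>x\<ge>min p q. x \<le> max p q \<and> cdf M x = t"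
    using p[of "max p q"] q[of "min p q"] cont by (intro IVT) auto
  with cdf that show thesis by metis
qed

text \<open>When both volumes are cut in the same ratio, the Brunn-Minkowski lower bounds of the two
  halves add up exactly to the bound for the whole, by homogeneity of degree
  \<open>n\<close>.\<close>

lemma root_split:
  fixes a b t :: real
  assumes n: "n > 0" and "0 < t" "t < 1" "a \<ge> 0" "b \<ge> 0"
  shows "(root n (t * a) + root n (t * b)) ^ n + (root n ((1 - t) * a) + root n ((1 - t) * b)) ^ n
    = (root n a + root n b) ^ n"
proof -
  have "(root n (t * a) + root n (t * b)) ^ n = t * (root n a + root n b) ^ n"
    "(root n ((1 - t) * a) + root n ((1 - t) * b)) ^ n = (1 - t) * (root n a + root n b) ^ n"
    using assms by (simp_all add: real_root_mult distrib_left[symmetric] power_mult_distrib)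
  then show ?thesis by (simp add: algebra_simps)
qed

text \<open>The Hadwiger--Ohmann induction: split one set by a hyperplane separating two of its boxes,
  and the other one by a parallel hyperplane in the same volume ratio.\<close>

lemma Brunn_Minkowski_box_union:
  fixes A B :: "'a::euclidean_space set"
  defines "r \<equiv> \<lambda>S::'a set. root DIM('a) (measure lborel S)"
  assumes "box_union (Suc k) A" "box_union (Suc l) B" "A \<noteq> {}" "B \<noteq> {}"
  shows "(r A + r B) ^ DIM('a) \<le> measure lborel (A + B)"
  using assms(2-)
proof (induction "k + l" arbitrary: k l A B rule: less_induct)
  case (less k l A B)
  let ?m = "measure lborel :: 'a set \<Rightarrow> real"
  have step: "(r A + r B) ^ DIM('a) \<le> ?m (A + B)"
    if AB: "box_union (Suc (Suc k)) A" "\<not> box_union (Suc k) A" "box_union (Suc l) B" "A \<noteq> {}" "B \<noteq> {}"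
    and IH: "\<And>A B. box_union (Suc k) A \<Longrightarrow> box_union (Suc l) B \<Longrightarrow> A \<noteq> {} \<Longrightarrow> B \<noteq> {} \<Longrightarrow> (r A + r B) ^ DIM('a) \<le> ?m (A + B)"
    for k l A B
  proof -
    obtain i :: 'a and c where i: "i \<in> Basis" and
      Asp: "box_union (Suc k) (A \<inter> {x. x \<bullet> i < c})" "box_union (Suc k) (A \<inter> {x. c < x \<bullet> i})"
      "A \<inter> {x. x \<bullet> i < c} \<noteq> {}" "A \<inter> {x. c < x \<bullet> i} \<noteq> {}"
      using box_union_split AB(1,2) by blast
    let ?A1 = "A \<inter> {x. x \<bullet> i < c}" and ?A2 = "A \<inter> {x. c < x \<bullet> i}"
    have oA: "open A" "bounded A" "open B" "bounded B"
      using AB box_union_open box_union_bounded by blast+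
    have fm: "S \<in> fmeasurable lborel" if "open S" "bounded S" for S :: "'a set"
      using that by (intro bounded_lborel_fmeasurable) auto
    have pos: "?m S > 0" if "open S" "bounded S" "S \<noteq> {}" for S :: "'a set"
      using that by (intro open_measure_pos)
    have oA12: "open ?A1" "bounded ?A1" "open ?A2" "bounded ?A2"
      using Asp box_union_open box_union_bounded by blast+
    have mA: "?m A = ?m ?A1 + ?m ?A2" by (intro measure_split_hyperplane i fm oA)
    have pA: "?m ?A1 > 0" "?m ?A2 > 0" using pos oA12 Asp by blast+
    have pB: "?m B > 0" using pos oA AB by blast
    define t where "t = ?m ?A1 / ?m A"
    have t: "0 < t" "t < 1" using pA mA by (auto simp: t_def)
    obtain d where d: "?m (B \<inter> {x. x \<bullet> i < d}) = t * ?m B"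
      using split_at_ratio[OF fm[OF oA(3,4)] i, of "t * ?m B"] t pB by auto
    let ?B1 = "B \<inter> {x. x \<bullet> i < d}" and ?B2 = "B \<inter> {x. d < x \<bullet> i}"
    have mB: "?m B = ?m ?B1 + ?m ?B2" by (intro measure_split_hyperplane i fm oA)
    have B2: "?m ?B2 = (1 - t) * ?m B" using mB d by (simp add: algebra_simps)
    have A12: "?m ?A1 = t * ?m A" "?m ?A2 = (1 - t) * ?m A"
      using mA pA by (auto simp: t_def field_simps)
    have ne: "?B1 \<noteq> {}" "?B2 \<noteq> {}"
    proof -
      have "?m ?B1 > 0" "?m ?B2 > 0" using d B2 t pB by auto
      then show "?B1 \<noteq> {}" "?B2 \<noteq> {}" by auto
    qed
    have bu: "box_union (Suc l) ?B1" "box_union (Suc l) ?B2"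
      using box_union_halfspaces[OF AB(3) i] by auto
    note op = open_set_plus
    have bd: "bounded (S + T)" if "bounded S" "bounded T" for S T :: "'a set"
      using bounded_plus[OF that] by (rule bounded_subset) (auto simp: set_plus_def)
    have oAB: "open (A + B)" "bounded (A + B)" using op bd oA by auto
    have "(r A + r B) ^ DIM('a) = (r ?A1 + r ?B1) ^ DIM('a) + (r ?A2 + r ?B2) ^ DIM('a)"
      unfolding r_def d B2 A12 using root_split[of "DIM('a)" t "?m A" "?m B"] t by simp
    also have "\<dots> \<le> ?m (?A1 + ?B1) + ?m (?A2 + ?B2)"
      using IH Asp bu ne by (intro add_mono) auto
    \<comment> \<open>The sums of corresponding halves lie strictly on opposite sides of the
      hyperplane at height \<open>c + d\<close>, so their volumes may be added inside
      \<open>A + B\<close>.\<close>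
    also have "\<dots> \<le> ?m ((A + B) \<inter> {x. x \<bullet> i < c + d}) + ?m ((A + B) \<inter> {x. c + d < x \<bullet> i})"
    proof (intro add_mono measure_mono_fmeasurable)
      show "?A1 + ?B1 \<subseteq> (A + B) \<inter> {x. x \<bullet> i < c + d}"
        by (fastforce simp: set_plus_def inner_simps intro: add_strict_mono)
      show "?A2 + ?B2 \<subseteq> (A + B) \<inter> {x. c + d < x \<bullet> i}"
        by (fastforce simp: set_plus_def inner_simps intro: add_strict_mono)
      show "?A1 + ?B1 \<in> sets lborel" "?A2 + ?B2 \<in> sets lborel"
        using op[OF oA12(1)] op[OF oA12(3)] by auto
      show "(A + B) \<inter> {x. x \<bullet> i < c + d} \<in> fmeasurable lborel"
        "(A + B) \<inter> {x. c + d < x \<bullet> i} \<in> fmeasurable lborel"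
        using oAB by (auto intro!: fm open_Int open_halfspace_component_lt open_halfspace_component_gt bounded_Int)
    qed
    also have "\<dots> = ?m (A + B)"
      using measure_split_hyperplane[OF fm[OF oAB] i] by simp
    finally show ?thesis .
  qed
  \<comment> \<open>The indices are mere bounds and may be slack, in which case they are lowered
    (first and third case). Otherwise a set that really has several boxes is split, with the roles
    of \<open>A\<close> and \<open>B\<close> exchanged if necessary; two single boxes
    remain.\<close>
  consider "\<exists>k'. k = Suc k' \<and> box_union (Suc k') A" | k' where "k = Suc k'" "\<not> box_union (Suc k') A"
    | "\<exists>l'. l = Suc l' \<and> box_union (Suc l') B" | l' where "l = Suc l'" "\<not> box_union (Suc l') B"
    | "k = 0 \<and> l = 0"
    by (cases k; cases l; blast)
  then show ?case
  proof cases
    case 1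
    then show ?thesis using less by fastforce
  next
    case (2 k')
    then show ?thesis using less.hyps[of k' l] less.prems by (intro step[of k' A l B]) auto
  next
    case 3
    then show ?thesis using less by fastforce
  next
    case (4 l')
    have "(r B + r A) ^ DIM('a) \<le> ?m (B + A)"
    proof (rule step[of l' B k A])
      fix X Y :: "'a set" assume "box_union (Suc l') X" "box_union (Suc k) Y" "X \<noteq> {}" "Y \<noteq> {}"
      then have "(r Y + r X) ^ DIM('a) \<le> ?m (Y + X)" using less.hyps[of k l' Y X] 4 by auto
      then show "(r X + r Y) ^ DIM('a) \<le> ?m (X + Y)" by (simp add: add.commute)
    qed (use less.prems 4 in auto)
    then show ?thesis by (simp add: add.commute)
  next
    case 5
    obtain a b where A: "A = box a b"
      using less.prems 5 unfolding box_union_def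
      by (metis One_nat_def Sup_empty card_0_eq card_1_singletonE ccpo_Sup_singleton insertI1 le_SucE le_zero_eq)
    obtain c d where B: "B = box c d"
      using less.prems 5 unfolding box_union_def
      by (metis One_nat_def Sup_empty card_0_eq card_1_singletonE ccpo_Sup_singleton insertI1 le_SucE le_zero_eq)
    have ne: "box a b \<noteq> {}" "box c d \<noteq> {}" using less.prems A B by auto
    have AB: "A + B = box (a + c) (b + d)" unfolding A B by (rule box_set_plus[OF ne])
    have "box (a + c) (b + d) \<noteq> {}" using ne unfolding AB[symmetric] A B by (auto simp: set_plus_def)
    note m = measure_box_pos[OF ne(1)] measure_box_pos[OF ne(2)] measure_box_pos[OF this]
    have "r A + r B \<le> root DIM('a) (\<Prod>i\<in>Basis. (b - a) \<bullet> i + (d - c) \<bullet> i)"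
      unfolding r_def A B m(1) m(3) using m by (intro root_prod_add_le) auto
    also have "(\<Prod>i\<in>Basis. (b - a) \<bullet> i + (d - c) \<bullet> i) = ?m (A + B)"
      unfolding AB m(5) by (simp add: inner_simps algebra_simps)
    finally have "r A + r B \<le> root DIM('a) (?m (A + B))" .
    then have "(r A + r B) ^ DIM('a) \<le> root DIM('a) (?m (A + B)) ^ DIM('a)"
      by (intro power_mono) (auto simp: r_def)
    then show ?thesis by simp
  qed
qed

text \<open>A finite cover by small boxes is subdivided into nonoverlapping ones, whose interiors
  form \<open>U\<close>. Only faces are lost, a null set; so \<open>U\<close> need not contain
  \<open>C\<close> but has at least its volume, and it stays within distance \<open>e\<close> of
  \<open>C\<close>.\<close>

lemma compact_box_union_approx:
  fixes C :: "'a::euclidean_space set"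
  assumes C: "compact C" "C \<noteq> {}" and e: "e > 0"
  obtains k U where "box_union (Suc k) U" "U \<noteq> {}" "measure lborel C \<le> measure lborel U"
    "\<And>x. x \<in> U \<Longrightarrow> \<exists>y\<in>C. dist y x < e"
proof -
  have "\<forall>y::'a. \<exists>p. y \<in> box (fst p) (snd p) \<and> cbox (fst p) (snd p) \<subseteq> ball y e"
  proof
    fix y :: 'a
    obtain a b where "cbox a b \<subseteq> ball y e" "y \<in> box a b"
      using open_contains_cbox[of "ball y e" y] e by (metis centre_in_ball open_ball)
    then show "\<exists>p. y \<in> box (fst p) (snd p) \<and> cbox (fst p) (snd p) \<subseteq> ball y e"
      by (intro exI[of _ "(a, b)"]) auto
  qed
  from choice[OF this] obtain p where
    p: "\<forall>y::'a. y \<in> box (fst (p y)) (snd (p y)) \<and> cbox (fst (p y)) (snd (p y)) \<subseteq> ball y e" ..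
  define a b where "a y = fst (p y)" and "b y = snd (p y)" for y
  have ab: "\<And>y::'a. y \<in> box (a y) (b y)" "\<And>y. cbox (a y) (b y) \<subseteq> ball y e"
    using p by (auto simp: a_def b_def)
  obtain Y where Y: "Y \<subseteq> C" "finite Y" "C \<subseteq> (\<Union>y\<in>Y. box (a y) (b y))"
  proof (rule compactE_image[OF C(1), of C "\<lambda>y. box (a y) (b y)"])
    show "C \<subseteq> (\<Union>y\<in>C. box (a y) (b y))" using ab(1) by auto
  qed auto
  obtain p where p: "p division_of (\<Union>((\<lambda>y. cbox (a y) (b y)) ` Y))"
  proof (rule elementary_unions_intervals)
    show "finite ((\<lambda>y. cbox (a y) (b y)) ` Y)" using Y(2) by simp
    show "\<exists>c d. s = cbox c d" if "s \<in> (\<lambda>y. cbox (a y) (b y)) ` Y" for s using that by auto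
  qed
  note pd = division_ofD[OF p]
  define Q where "Q = {S \<in> interior ` p. S \<noteq> {}}"
  have inter: "\<exists>a b. interior K = box a b" if "K \<in> p" for K
  proof -
    obtain a b where "K = cbox a b" using pd(4)[OF \<open>K \<in> p\<close>] by blast
    then have "interior K = box a b" by simp
    then show ?thesis by blast
  qed
  have "disjoint Q"
    unfolding Q_def pairwise_def disjnt_def using pd(5) by (auto; metis disjoint_iff)
  moreover have "finite Q" using pd(1) by (simp add: Q_def)
  moreover have "\<forall>S\<in>Q. S \<noteq> {} \<and> (\<exists>a b. S = box a b)" using inter by (auto simp: Q_def)
  ultimately have bu: "box_union (card Q) (\<Union>Q)" unfolding box_union_def by blast
  have sub: "\<Union>Q \<subseteq> (\<Union>y\<in>Y. cbox (a y) (b y))"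
    using pd(6) interior_subset by (fastforce simp: Q_def)
  have "(\<Union>y\<in>Y. cbox (a y) (b y)) - \<Union>Q \<subseteq> (\<Union>K\<in>p. K - interior K)"
    using pd(6) by (fastforce simp: Q_def)
  moreover have "negligible (\<Union>K\<in>p. K - interior K)"
  proof (intro negligible_Union finite_imageI pd(1))
    fix t assume "t \<in> (\<lambda>K. K - interior K) ` p"
    then obtain K where K: "K \<in> p" "t = K - interior K" by auto
    then obtain a b where "K = cbox a b" using pd(4) by blast
    with K show "negligible t" using negligible_frontier_interval[of a b] by simp
  qed
  ultimately have neg: "negligible ((\<Union>y\<in>Y. cbox (a y) (b y)) - \<Union>Q)"
    by (rule negligible_subset[rotated])
  have "C - \<Union>Q \<in> null_sets lborel"
  proof -
    have "negligible (C - \<Union>Q)"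
      by (rule negligible_subset[OF neg]) (use Y(3) box_subset_cbox in blast)
    then show ?thesis
      using box_union_open[OF bu] C(1)
      by (auto simp: negligible_iff_null_sets null_sets_completion_iff compact_imp_closed borel_closed)
  qed
  have fm: "\<Union>Q \<in> fmeasurable lborel"
    using bu by (intro bounded_lborel_fmeasurable box_union_bounded) (auto intro: borel_open box_union_open)
  have "measure lborel C \<le> measure lborel (\<Union>Q \<union> (C - \<Union>Q))"
    using fm C \<open>C - \<Union>Q \<in> null_sets lborel\<close>
    by (intro measure_mono_fmeasurable fmeasurable.Un) (auto simp: compact_imp_closed borel_closed null_sets_def fmeasurable_def)
  also have "\<dots> = measure lborel (\<Union>Q)"
    using fm \<open>C - \<Union>Q \<in> null_sets lborel\<close> by (intro measure_Un_null_set) (auto dest: fmeasurableD)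
  finally have m: "measure lborel C \<le> measure lborel (\<Union>Q)" .
  have ne: "\<Union>Q \<noteq> {}"
  proof
    assume "\<Union>Q = {}"
    then have "negligible (\<Union>y\<in>Y. cbox (a y) (b y))" using neg by (metis Diff_empty)
    moreover obtain y where "y \<in> Y" using C(2) Y by blast
    moreover have "box (a y) (b y) \<subseteq> (\<Union>y\<in>Y. cbox (a y) (b y))"
      using \<open>y \<in> Y\<close> box_subset_cbox by blast
    ultimately have "negligible (box (a y) (b y))"
      using negligible_subset by blast
    then show False using open_not_negligible[of "box (a y) (b y)"] ab(1) by (metis empty_iff open_box)
  qed
  have "\<exists>y\<in>C. dist y x < e" if x: "x \<in> \<Union>Q" for x
  proof -
    obtain y where "y \<in> Y" "x \<in> cbox (a y) (b y)" using sub x by blast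
    then show ?thesis using ab(2)[of y] Y(1) by (auto simp: subset_eq)
  qed
  moreover have "box_union (Suc (card Q)) (\<Union>Q)" using bu unfolding box_union_def by (meson le_SucI)
  ultimately show thesis using that m ne by blast
qed

text \<open>A compact subset \<open>C\<close> of the open set \<open>A\<close> has positive distance
  from the complement, and this room absorbs the errors made when \<open>C\<close> and
  \<open>B\<close> are replaced by unions of boxes. Exhausting \<open>A\<close> by such
  \<open>C\<close> gives the bound. With \<open>A\<close> open, \<open>A + B\<close> is open and
  thus measurable.\<close>

theorem Brunn_Minkowski_open_compact:
  fixes A B :: "'a::euclidean_space set"
  defines "r \<equiv> \<lambda>S::'a set. root DIM('a) (measure lborel S)"
  assumes A: "open A" "bounded A" "A \<noteq> {}" and B: "compact B" "B \<noteq> {}"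
  shows "(r A + r B) ^ DIM('a) \<le> measure lborel (A + B)"
proof -
  let ?m = "measure lborel :: 'a set \<Rightarrow> real"
  let ?n = "DIM('a)"
  have oAB: "open (A + B)" "bounded (A + B)"
  proof -
    show "open (A + B)" by (rule open_set_plus[OF A(1)])
    show "bounded (A + B)"
      using bounded_plus[OF A(2) compact_imp_bounded[OF B(1)]] by (rule bounded_subset) (auto simp: set_plus_def)
  qed
  have key: "(r C + r B) ^ ?n \<le> ?m (A + B)" if C: "compact C" "C \<noteq> {}" "C \<subseteq> A" for C
  proof -
    obtain e where e: "e > 0" "{x. infdist x C \<le> e} \<subseteq> A"
      using compact_in_open_separated[OF C(2,1) A(1) C(3)] by auto
    obtain k U where U: "box_union (Suc k) U" "U \<noteq> {}" "?m C \<le> ?m U" "\<And>x. x \<in> U \<Longrightarrow> \<exists>y\<in>C. dist y x < e/2"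
      using compact_box_union_approx[OF C(1,2), of "e/2"] e by auto
    obtain l V where V: "box_union (Suc l) V" "V \<noteq> {}" "?m B \<le> ?m V" "\<And>x. x \<in> V \<Longrightarrow> \<exists>y\<in>B. dist y x < e/2"
      using compact_box_union_approx[OF B, of "e/2"] e by auto
    have sub: "U + V \<subseteq> A + B"
    proof
      fix z assume "z \<in> U + V"
      then obtain u v where uv: "u \<in> U" "v \<in> V" "z = u + v" by (auto simp: set_plus_def)
      obtain c where c: "c \<in> C" "dist c u < e/2" using U(4) uv by blast
      obtain b where b: "b \<in> B" "dist b v < e/2" using V(4) uv by blast
      have "infdist (u + (v - b)) C \<le> dist (u + (v - b)) c" using c by (intro infdist_le)
      also have "\<dots> \<le> dist c u + dist b v"
        using norm_triangle_ineq[of "u - c" "v - b"] by (simp add: dist_norm norm_minus_commute algebra_simps)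
      finally have "u + (v - b) \<in> A" using c b e by auto
      then have "(u + (v - b)) + b \<in> A + B" using b by (intro set_plus_intro) auto
      then show "z \<in> A + B" using uv by simp
    qed
    have "(r C + r B) ^ ?n \<le> (r U + r V) ^ ?n"
      using U(3) V(3) by (intro power_mono add_mono) (auto simp: r_def)
    also have "\<dots> \<le> ?m (U + V)"
      unfolding r_def by (rule Brunn_Minkowski_box_union[OF U(1) V(1) U(2) V(2)])
    also have "\<dots> \<le> ?m (A + B)"
    proof (rule measure_mono_fmeasurable[OF sub])
      have "open (U + V)" by (rule open_set_plus[OF box_union_open[OF U(1)]])
      then show "U + V \<in> sets lborel" by simp
      show "A + B \<in> fmeasurable lborel" using oAB by (intro bounded_lborel_fmeasurable) auto
    qed
    finally show ?thesis .
  qed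
  have "\<exists>C. compact C \<and> C \<noteq> {} \<and> C \<subseteq> A \<and> ?m A - 1 / Suc j \<le> ?m C" for j :: nat
  proof -
    have "A \<in> sets lebesgue" using A by auto
    then obtain T where T: "closed T" "T \<subseteq> A" "A - T \<in> lmeasurable" "emeasure lebesgue (A - T) < ennreal (1 / Suc j)"
      using sets_lebesgue_inner_closed[of A "1 / Suc j"] by auto
    \<comment> \<open>One point of \<open>A\<close> is added to keep the compact set
      nonempty.\<close>
    obtain a where a: "a \<in> A" using A by auto
    have cT: "compact (insert a T)"
      using T A by (intro compact_insert) (auto simp: compact_eq_bounded_closed intro: bounded_subset)
    have fmA: "A \<in> lmeasurable" using A by (simp add: bounded_set_imp_lmeasurable)
    have fmT: "T \<in> lmeasurable" using cT by (meson T A bounded_subset compact_eq_bounded_closed lmeasurable_compact)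
    have "measure lebesgue A - measure lebesgue T = measure lebesgue (A - T)"
      using T fmA fmT by (subst measurable_measure_Diff) auto
    also have "\<dots> \<le> 1 / Suc j"
      using T(4) by (metis T(3) emeasure_eq_measure2 ennreal_leI less_imp_le linorder_not_le)
    finally have "measure lebesgue A - 1 / Suc j \<le> measure lebesgue T" by simp
    also have "\<dots> \<le> measure lebesgue (insert a T)"
      using fmT cT by (intro measure_mono_fmeasurable) (auto simp: lmeasurable_compact)
    finally have "measure lebesgue A - 1 / Suc j \<le> measure lebesgue (insert a T)" by simp
    then have "?m A - 1 / Suc j \<le> ?m (insert a T)"
      using A cT by (simp add: measure_completion compact_imp_closed borel_closed borel_open)
    then show ?thesis using cT T a by (intro exI[of _ "insert a T"]) auto
  qed
  then obtain C where C: "\<And>j. compact (C j)" "\<And>j. C j \<noteq> {}" "\<And>j. C j \<subseteq> A" "\<And>j::nat. ?m A - 1 / Suc j \<le> ?m (C j)"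
    by metis
  have "(\<lambda>j. (root ?n (?m A - 1 / Suc j) + r B) ^ ?n) \<longlonglongrightarrow> (root ?n (?m A - 0) + r B) ^ ?n"
    by (intro tendsto_intros LIMSEQ_Suc[OF lim_1_over_n])
  \<comment> \<open>For small \<open>j\<close> the difference under the root may be negative, and
    powers are monotone only on nonnegative bases.\<close>
  moreover have "\<exists>N. \<forall>j\<ge>N. (root ?n (?m A - 1 / Suc j) + r B) ^ ?n \<le> ?m (A + B)"
  proof -
    have "?m A > 0" using A by (rule open_measure_pos)
    then obtain N where N: "1 / real (Suc N) < ?m A" by (meson nat_approx_posE)
    have "(root ?n (?m A - 1 / Suc j) + r B) ^ ?n \<le> ?m (A + B)" if "j \<ge> N" for j
    proof -
      have "1 / real (Suc j) \<le> 1 / real (Suc N)" using that by (simp add: frac_le)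
      then have "0 \<le> ?m A - 1 / Suc j" using N by linarith
      then have "(root ?n (?m A - 1 / Suc j) + r B) ^ ?n \<le> (r (C j) + r B) ^ ?n"
        using C(4)[of j] by (intro power_mono add_mono) (auto simp: r_def)
      then show ?thesis using key[OF C(1-3)[of j]] by linarith
    qed
    then show ?thesis by blast
  qed
  ultimately have "(root ?n (?m A - 0) + r B) ^ ?n \<le> ?m (A + B)" by (rule LIMSEQ_le_const2)
  then show ?thesis by (simp add: r_def)
qed

section \<open>An anisotropic coarea inequality\<close>

lemma nn_integral_lborel_scaleR:
  fixes f :: "'a::euclidean_space \<Rightarrow> ennreal"
  assumes [measurable]: "f \<in> borel_measurable borel" and c: "c > 0"
  shows "(\<integral>\<^sup>+x. f x \<partial>lborel) = ennreal (c ^ DIM('a)) * (\<integral>\<^sup>+x. f (c *\<^sub>R x) \<partial>lborel)"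
  by (subst lborel_affine[of c "0::'a"])
    (use c in \<open>simp_all add: nn_integral_density nn_integral_distr nn_integral_cmult\<close>)

lemma measure_lborel_scaleR:
  fixes B :: "'a::euclidean_space set"
  assumes [measurable]: "B \<in> sets borel" and c: "c > 0"
  shows "measure lborel ((\<lambda>x. c *\<^sub>R x) ` B) = c ^ DIM('a) * measure lborel B"
proof -
  have eq: "(\<lambda>x. c *\<^sub>R x) ` B = (\<lambda>x. (1/c) *\<^sub>R x) -` B"
  proof (intro set_eqI iffI)
    fix x assume "x \<in> (\<lambda>x. (1/c) *\<^sub>R x) -` B"
    then have "c *\<^sub>R ((1/c) *\<^sub>R x) \<in> (\<lambda>x. c *\<^sub>R x) ` B" by blast
    then show "x \<in> (\<lambda>x. c *\<^sub>R x) ` B" using c by simp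
  qed (use c in auto)
  have [measurable]: "(\<lambda>x. (1/c) *\<^sub>R x) -` B \<in> sets borel"
    using measurable_sets[of "\<lambda>x::'a. (1/c) *\<^sub>R x" borel borel B] by simp
  have "emeasure lborel ((\<lambda>x. (1/c) *\<^sub>R x) -` B) = (\<integral>\<^sup>+x. indicator ((\<lambda>x. (1/c) *\<^sub>R x) -` B) x \<partial>lborel)" by simp
  also have "\<dots> = ennreal (c ^ DIM('a)) * (\<integral>\<^sup>+x. indicator ((\<lambda>x. (1/c) *\<^sub>R x) -` B) (c *\<^sub>R x) \<partial>lborel)"
    by (rule nn_integral_lborel_scaleR[OF _ c]) simp
  also have "(\<lambda>x. indicator ((\<lambda>x. (1/c) *\<^sub>R x) -` B) (c *\<^sub>R x) :: ennreal) = indicator B"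
    using c by (auto simp: indicator_def fun_eq_iff)
  finally show ?thesis
    unfolding eq measure_def using c by (simp add: enn2real_mult)
qed

lemma layer_cake:
  fixes k :: "real \<Rightarrow> ennreal"
  assumes "sigma_finite_measure M" and [measurable]: "h \<in> borel_measurable M" "k \<in> borel_measurable borel"
  shows "(\<integral>\<^sup>+x. (\<integral>\<^sup>+t. k t * indicator {h x<..} t \<partial>lborel) \<partial>M) = (\<integral>\<^sup>+t. k t * emeasure M {x \<in> space M. h x < t} \<partial>lborel)"
proof -
  interpret sigma_finite_measure M by fact
  interpret pair_sigma_finite M lborel by standard
  have "(\<integral>\<^sup>+x. (\<integral>\<^sup>+t. k t * indicator {h x<..} t \<partial>lborel) \<partial>M) = (\<integral>\<^sup>+t. (\<integral>\<^sup>+x. k t * indicator {h x<..} t \<partial>M) \<partial>lborel)"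
    by (rule Fubini'[symmetric]) (simp add: indicator_def, measurable)
  also have "\<dots> = (\<integral>\<^sup>+t. k t * emeasure M {x \<in> space M. h x < t} \<partial>lborel)"
  proof (rule nn_integral_cong)
    fix t
    have "(\<integral>\<^sup>+x. k t * indicator {h x<..} t \<partial>M) = (\<integral>\<^sup>+x. k t * indicator {x \<in> space M. h x < t} x \<partial>M)"
      by (intro nn_integral_cong) (auto simp: indicator_def)
    then show "(\<integral>\<^sup>+x. k t * indicator {h x<..} t \<partial>M) = k t * emeasure M {x \<in> space M. h x < t}"
      by (simp add: nn_integral_cmult_indicator)
  qed
  finally show ?thesis .
qed

lemma borel_measurable_emeasure_less:
  assumes "sigma_finite_measure M" and [measurable]: "h \<in> borel_measurable M"
  shows "(\<lambda>t::real. emeasure M {x \<in> space M. h x < t}) \<in> borel_measurable borel"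
proof -
  interpret sigma_finite_measure M by fact
  have "(\<lambda>t. \<integral>\<^sup>+x. (if h x < t then 1 else 0) \<partial>M) \<in> borel_measurable borel"
    by measurable
  also have "(\<lambda>t. \<integral>\<^sup>+x. (if h x < t then 1 else 0) \<partial>M) = (\<lambda>t. emeasure M {x \<in> space M. h x < t})"
  proof
    fix t
    have "(\<integral>\<^sup>+x. (if h x < t then 1 else 0) \<partial>M) = (\<integral>\<^sup>+x. indicator {x \<in> space M. h x < t} x \<partial>M)"
      by (intro nn_integral_cong) (auto simp: indicator_def)
    then show "(\<integral>\<^sup>+x. (if h x < t then 1 else 0) \<partial>M) = emeasure M {x \<in> space M. h x < t}"
      by simp
  qed
  finally show ?thesis .
qed

lemma uniformly_continuous_bounded_support:
  fixes F :: "'a::euclidean_space \<Rightarrow> 'b::real_normed_vector"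
  assumes cont: "continuous_on UNIV F" and F: "\<And>x. r < norm x \<Longrightarrow> F x = 0" and e: "e > 0"
  obtains d where "d > 0" "\<And>x y. dist x y < d \<Longrightarrow> norm (F x - F y) < e"
proof -
  have "uniformly_continuous_on (cball 0 (r + 1)) F"
    using cont by (intro compact_uniformly_continuous) (auto intro: continuous_on_subset)
  then obtain d where d: "d > 0" "\<And>x y. x \<in> cball 0 (r + 1) \<Longrightarrow> y \<in> cball 0 (r + 1) \<Longrightarrow> dist x y < d \<Longrightarrow> dist (F x) (F y) < e"
    using e unfolding uniformly_continuous_on_def by (metis dist_commute)
  have "norm (F x - F y) < e" if "dist x y < min d 1" for x y
  proof (cases "norm x \<le> r \<or> norm y \<le> r")
    case True
    have "norm x \<le> norm y + dist x y" "norm y \<le> norm x + dist x y"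
      using norm_triangle_ineq[of y "x - y"] norm_triangle_ineq[of x "y - x"]
      by (auto simp: dist_norm norm_minus_commute)
    then have "x \<in> cball 0 (r + 1)" "y \<in> cball 0 (r + 1)" using True that by auto
    then show ?thesis using d(2) that by (auto simp: dist_norm)
  qed (use F e in auto)
  then show thesis using that[of "min d 1"] d(1) by auto
qed

lemma integrable_lborel_bounded_support:
  fixes f :: "'a::euclidean_space \<Rightarrow> real"
  assumes "f \<in> borel_measurable borel" "\<And>x. \<bar>f x\<bar> \<le> c" "\<And>x. x \<notin> S \<Longrightarrow> f x = 0" "bounded S"
  shows "integrable lborel f"
proof -
  obtain r where "\<forall>x\<in>S. norm x \<le> r" using assms(4) by (auto simp: bounded_iff)
  then have r: "S \<subseteq> cball 0 r" by auto
  show ?thesis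
  proof (rule integrableI_bounded_set[where A = "cball 0 r" and B = c])
    show "emeasure lborel (cball (0::'a) r) < \<infinity>" by (rule emeasure_lborel_cball_finite)
    have "f x = 0" if "x \<notin> cball 0 r" for x using assms(3)[of x] r that by blast
    then show "AE x in lborel. x \<notin> cball 0 r \<longrightarrow> f x = 0" by simp
  qed (use assms in auto)
qed

text \<open>With \<phi>(s) the integral of \<psi> over (s, \<infinity>), the gradient of \<phi>
  composed with \<open>G\<close> is the gradient of \<open>G\<close> times - \<psi>(G), while the
  last clause lets the layer-cake formula express integrals of \<phi> composed with \<open>h\<close>
  through the volumes of the sublevel sets of \<open>h\<close>.\<close>

lemma antiderivative_tail:
  fixes \<psi> :: "real \<Rightarrow> real"
  assumes cont: "continuous_on UNIV \<psi>" and nonneg: "\<And>t. \<psi> t \<ge> 0" and zero: "\<And>t. t \<ge> R \<Longrightarrow> \<psi> t = 0"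
  obtains \<phi> where "\<And>t. (\<phi> has_real_derivative - \<psi> t) (at t)" "\<And>t. t \<ge> R \<Longrightarrow> \<phi> t = 0" "antimono \<phi>" "\<And>t. \<phi> t \<ge> 0"
    "\<And>s. ennreal (\<phi> s) = (\<integral>\<^sup>+t. ennreal (\<psi> t) * indicator {s<..} t \<partial>lborel)"
proof -
  define \<phi> where "\<phi> s = (if s \<le> R then integral {s..R} \<psi> else - integral {R..s} \<psi>)" for s
  have 0: "\<phi> t = 0" if "t \<ge> R" for t
  proof (cases "t = R")
    case False
    have "integral {R..t} \<psi> = integral {R..t} (\<lambda>_. 0)" by (intro integral_cong) (auto simp: zero)
    then show ?thesis using that False by (simp add: \<phi>_def)
  qed (simp add: \<phi>_def)
  have int: "\<psi> integrable_on {a..b}" for a b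
    by (intro integrable_continuous_real continuous_on_subset[OF cont]) auto
  have eq: "\<phi> s = integral {a..b} \<psi> - integral {a..s} \<psi>" if "a \<le> s" "s \<le> b" "R \<le> b" for a b s
  proof (cases "s \<le> R")
    case True
    have "integral {a..s} \<psi> + integral {s..R} \<psi> = integral {a..R} \<psi>"
      using that True int by (intro Henstock_Kurzweil_Integration.integral_combine) auto
    moreover have "integral {a..R} \<psi> + integral {R..b} \<psi> = integral {a..b} \<psi>"
      using that True int by (intro Henstock_Kurzweil_Integration.integral_combine) auto
    moreover have "integral {R..b} \<psi> = 0" using 0[of b] that by (cases "b = R") (auto simp: \<phi>_def)
    ultimately show ?thesis using True by (simp add: \<phi>_def)
  next
    case False
    have "integral {a..s} \<psi> + integral {s..b} \<psi> = integral {a..b} \<psi>"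
      using that False int by (intro Henstock_Kurzweil_Integration.integral_combine) auto
    moreover have "integral {s..b} \<psi> = integral {s..b} (\<lambda>_. 0)"
      using False by (intro integral_cong) (auto simp: zero)
    ultimately show ?thesis using 0[of s] False by simp
  qed
  have der: "(\<phi> has_real_derivative - \<psi> t) (at t)" for t
  proof -
    define a b where "a = t - 1" and "b = max R (t + 1)"
    have ab: "a < t" "t < b" "R \<le> b" by (auto simp: a_def b_def)
    have "((\<lambda>x. integral {a..x} \<psi>) has_real_derivative \<psi> t) (at t within {a..b})"
      using ab by (intro integral_has_real_derivative continuous_on_subset[OF cont]) auto
    then have "((\<lambda>x. integral {a..b} \<psi> - integral {a..x} \<psi>) has_real_derivative - \<psi> t) (at t)"
      using ab by (auto simp: at_within_Icc_at intro!: derivative_eq_intros)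
    then show ?thesis
    proof (rule DERIV_cong_ev[THEN iffD1, rotated 3])
      have "\<forall>\<^sub>F x in nhds t. x \<in> {a<..<b}" using ab by (intro eventually_nhds_in_open) auto
      then show "\<forall>\<^sub>F x in nhds t. integral {a..b} \<psi> - integral {a..x} \<psi> = \<phi> x"
        by eventually_elim (use eq[of a _ b] ab in auto)
    qed auto
  qed
  have anti: "antimono \<phi>"
    by (rule antimonoI) (metis DERIV_nonpos_imp_nonincreasing der neg_le_0_iff_le nonneg)
  have pos: "\<phi> t \<ge> 0" for t
    using antimonoD[OF anti, of t "max t R"] 0[of "max t R"] by simp
  have nn: "ennreal (\<phi> s) = (\<integral>\<^sup>+t. ennreal (\<psi> t) * indicator {s<..} t \<partial>lborel)" for s
  proof (cases "s \<le> R")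
    case True
    have "(\<integral>\<^sup>+t. ennreal (\<psi> t) * indicator {s<..} t \<partial>lborel) = (\<integral>\<^sup>+t. ennreal (\<psi> t) * indicator {s..R} t \<partial>lborel)"
      using AE_lborel_singleton[of s] by (intro nn_integral_cong_AE) (auto elim!: eventually_mono simp: indicator_def zero)
    also have "\<dots> = ennreal (- \<phi> R - - \<phi> s)"
      using True cont nonneg by (intro nn_integral_FTC_Icc)
        (auto simp: has_real_derivative_iff_has_vector_derivative[symmetric] intro!: borel_measurable_continuous_onI
           DERIV_subset[OF DERIV_minus[OF der], simplified])
    finally show ?thesis using 0[of R] by simp
  next
    case False
    then have "(\<integral>\<^sup>+t. ennreal (\<psi> t) * indicator {s<..} t \<partial>lborel) = (\<integral>\<^sup>+t. 0 \<partial>(lborel::real measure))"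
      by (intro nn_integral_cong) (auto simp: indicator_def zero)
    then show ?thesis using False 0 by simp
  qed
  show thesis using that[OF der 0 anti pos nn] .
qed

text \<open>The first two terms of the binomial expansion. They extract from Brunn-Minkowski the
  part that is linear in the size of the second set, which is all that a derivative at
  \<open>s = 0\<close> sees.\<close>

lemma power_add_ge:
  fixes a b :: real
  assumes "a \<ge> 0" "b \<ge> 0" "n > 0"
  shows "a ^ n + real n * b * a ^ (n - 1) \<le> (a + b) ^ n"
  using assms(3)
proof (induction n rule: nat_induct_non_zero)
  case (Suc n)
  have "a ^ Suc n + real (Suc n) * b * a ^ (Suc n - 1) \<le> (a + b) * (a ^ n + real n * b * a ^ (n - 1))"
  proof -
    have "(a + b) * (a ^ n + real n * b * a ^ (n - 1)) = a ^ Suc n + real n * b * (a * a ^ (n - 1)) + b * a ^ n + real n * b\<^sup>2 * a ^ (n - 1)"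
      by (simp add: algebra_simps power2_eq_square)
    also have "a * a ^ (n - 1) = a ^ n" using Suc by (metis power_eq_if not_gr_zero)
    finally show ?thesis using assms by (simp add: algebra_simps)
  qed
  also have "\<dots> \<le> (a + b) ^ Suc n" using Suc.IH assms by (auto intro!: mult_left_mono)
  finally show ?case .
qed simp

text \<open>With a tail antiderivative of \<open>\<psi>\<close> composed with \<open>G\<close>, this is the derivative at \<open>s = 0\<close> of the
  integral of the sup-convolution over \<open>s B\<close>; Brunn--Minkowski bounds its level sets from below.\<close>

lemma anisotropic_coarea_inequality:
  fixes G :: "'a::euclidean_space \<Rightarrow> real" and DG :: "'a \<Rightarrow> 'a"
  defines "n \<equiv> DIM('a)"
  assumes n2: "n \<ge> 2"
    and der: "\<And>x. (G has_derivative (\<lambda>h. h \<bullet> DG x)) (at x)"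
    and contD: "continuous_on UNIV DG"
    and psi: "continuous_on UNIV \<psi>" "\<And>t. \<psi> t \<ge> 0" "\<And>t. t \<ge> R \<Longrightarrow> \<psi> t = 0"
    and bd: "bounded {x. G x < R}" and pos: "\<And>x. G x > 0"
    and B: "compact B" "B \<noteq> {}"
    and H: "integrable lborel (\<lambda>x. \<psi> (G x) * H x)" "AE x in lborel. \<forall>y\<in>B. DG x \<bullet> y \<le> H x"
  shows "real n * root n (measure lborel B) * (\<integral>t. \<psi> t * root n (measure lborel {x. G x < t}) ^ (n - 1) \<partial>lborel)
    \<le> (\<integral>x. \<psi> (G x) * H x \<partial>lborel)"
proof -
  have n0: "n > 0" by (simp add: n_def)
  obtain \<phi> where phi: "\<And>t. (\<phi> has_real_derivative - \<psi> t) (at t)" "\<And>t. t \<ge> R \<Longrightarrow> \<phi> t = 0" "antimono \<phi>" "\<And>t. \<phi> t \<ge> 0"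
    "\<And>s. ennreal (\<phi> s) = (\<integral>\<^sup>+t. ennreal (\<psi> t) * indicator {s<..} t \<partial>lborel)"
    using antiderivative_tail[OF psi] by blast
  have contG: "continuous_on UNIV G"
    using der by (meson continuous_at_imp_continuous_on has_derivative_continuous)
  have contphi: "continuous_on UNIV \<phi>" using phi(1) by (meson DERIV_isCont continuous_at_imp_continuous_on)
  have [measurable]: "G \<in> borel_measurable borel" "\<psi> \<in> borel_measurable borel" "\<phi> \<in> borel_measurable borel"
    using contG psi(1) contphi by (auto intro: borel_measurable_continuous_onI)
  define A where "A t = {x. G x < t}" for t
  define u where "u t = measure lborel (A t)" for t
  define \<beta> where "\<beta> = root n (measure lborel B)"
  have beta0: "\<beta> \<ge> 0" using n0 by (simp add: \<beta>_def)
  have openA: "open (A t)" for t unfolding A_def by (intro open_Collect_less contG continuous_intros)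
  have bdA: "bounded (A t)" if "t \<le> R" for t
    by (rule bounded_subset[OF bd]) (use that in \<open>auto simp: A_def\<close>)
  have fmA: "A t \<in> fmeasurable lborel" if "t \<le> R" for t
    by (intro bounded_lborel_fmeasurable bdA that) (use openA in auto)
  have emA: "emeasure lborel (A t) = ennreal (u t)" if "t \<le> R" for t
    using fmA[OF that] by (simp add: u_def emeasure_eq_measure2)
  obtain r where r: "r > 0" "\<forall>x\<in>A R. norm x \<le> r"
    using bd by (auto simp: A_def bounded_pos)
  then have r: "r > 0" "A R \<subseteq> cball 0 r" by auto
  obtain D where D: "D > 0" "\<And>y. y \<in> B \<Longrightarrow> norm y \<le> D"
    using compact_imp_bounded[OF B(1)] by (auto simp: bounded_pos)
  \<comment> \<open>\<open>- F\<close> is the gradient of \<open>f\<close>. Unlike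
    \<open>DG\<close>, it vanishes outside a bounded set and is therefore uniformly
    continuous.\<close>
  define F where "F x = \<psi> (G x) *\<^sub>R DG x" for x
  define f where "f x = \<phi> (G x)" for x
  have contF: "continuous_on UNIV F" unfolding F_def
    by (intro continuous_intros contD continuous_on_compose2[OF psi(1) contG]) auto
  have supp: "x \<notin> A R \<Longrightarrow> \<psi> (G x) = 0" "x \<notin> A R \<Longrightarrow> f x = 0" for x
    using psi(3) phi(2) by (auto simp: A_def f_def)
  have supp': "\<psi> (G x) = 0" "f x = 0" if "r < norm x" for x
  proof -
    have "x \<notin> A R" using r(2) that by auto
    then show "\<psi> (G x) = 0" "f x = 0" using supp by auto
  qed
  have derf: "(f has_derivative (\<lambda>h. - (h \<bullet> F x))) (at x)" for x
  proof -
    have "((\<lambda>x. \<phi> (G x)) has_derivative (\<lambda>h. (h \<bullet> DG x) * - \<psi> (G x))) (at x)"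
      using der phi(1)[of "G x"] by (rule DERIV_compose_FDERIV[rotated])
    then show ?thesis by (simp add: f_def[abs_def] F_def mult.commute)
  qed
  have contf: "continuous_on UNIV f"
    unfolding f_def by (rule continuous_on_compose2[OF contphi contG]) auto
  have f0: "f x \<ge> 0" for x by (simp add: f_def phi(4))
  have [measurable]: "f \<in> borel_measurable borel" using contf by (rule borel_measurable_continuous_onI)
  have intf: "integrable lborel f"
  proof (rule integrable_lborel_bounded_support)
    show "bounded (A R)" using bdA by simp
    show "\<bar>f x\<bar> \<le> \<phi> 0" for x
      using f0[of x] pos[of x] antimonoD[OF phi(3), of 0 "G x"] by (simp add: f_def)
  qed (use supp in auto)
  let ?I = "\<integral>t. \<psi> t * root n (u t) ^ (n - 1) \<partial>lborel"
  have u_mono: "u s \<le> u t" if "s \<le> t" "t \<le> R" for s t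
    unfolding u_def using that fmA[of t] openA[of s]
    by (intro measure_mono_fmeasurable) (auto simp: A_def)
  have u0: "u t = 0" if "t \<le> 0" for t
  proof -
    have "\<not> G x < t" for x using pos[of x] that by linarith
    then have "A t = {}" by (simp add: A_def)
    then show ?thesis by (simp add: u_def)
  qed
  have meas_u[measurable]: "(\<lambda>t. \<psi> t * root n (u t) ^ (n - 1)) \<in> borel_measurable borel"
  proof -
    have "mono (\<lambda>t. u (min t R))" using u_mono by (auto intro!: monoI)
    then have [measurable]: "(\<lambda>t. u (min t R)) \<in> borel_measurable borel" by (rule borel_measurable_mono)
    have "(\<lambda>t. \<psi> t * root n (u t) ^ (n - 1)) = (\<lambda>t. \<psi> t * root n (u (min t R)) ^ (n - 1))"
      using psi(3) by (fastforce simp: min_def)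
    then show ?thesis by simp
  qed
  have intI: "integrable lborel (\<lambda>t. \<psi> t * root n (u t) ^ (n - 1))"
  proof -
    have "bounded (\<psi> ` {0..R})"
      by (intro compact_imp_bounded compact_continuous_image continuous_on_subset[OF psi(1)]) auto
    then obtain c where "\<forall>t\<in>{0..R}. \<bar>\<psi> t\<bar> \<le> c" by (auto simp: bounded_iff)
    then have c: "\<And>t. t \<in> {0..R} \<Longrightarrow> \<bar>\<psi> t\<bar> \<le> c" by blast
    show ?thesis
    proof (rule integrable_lborel_bounded_support)
      show "bounded {0..R}" by simp
      show z: "\<psi> t * root n (u t) ^ (n - 1) = 0" if "t \<notin> {0..R}" for t
        using that psi(3) u0[of t] n2 by (cases "t < 0") auto
      show "\<bar>\<psi> t * root n (u t) ^ (n - 1)\<bar> \<le> \<bar>c\<bar> * root n (u R) ^ (n - 1)" for t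
      proof (cases "t \<in> {0..R}")
        case True
        then have "root n (u t) ^ (n - 1) \<le> root n (u R) ^ (n - 1)"
          using n0 u_mono[of t R] by (intro power_mono) (auto simp: u_def)
        then show ?thesis using c[OF True] n0 by (auto simp: abs_mult u_def intro!: mult_mono)
      next
        case False
        have "0 \<le> \<bar>c\<bar> * root n (u R) ^ (n - 1)" using n0 by (simp add: u_def)
        then show ?thesis unfolding z[OF False] by simp
      qed
    qed (rule meas_u)
  qed
  have fnn: "ennreal (\<integral>x. f x \<partial>lborel) = (\<integral>\<^sup>+t. ennreal (\<psi> t) * emeasure lborel (A t) \<partial>lborel)"
  proof -
    have "ennreal (\<integral>x. f x \<partial>lborel) = (\<integral>\<^sup>+x. ennreal (f x) \<partial>lborel)"
      using intf f0 by (simp add: nn_integral_eq_integral)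
    also have "\<dots> = (\<integral>\<^sup>+x. (\<integral>\<^sup>+t. ennreal (\<psi> t) * indicator {G x<..} t \<partial>lborel) \<partial>lborel)"
      by (simp add: f_def phi(5))
    also have "\<dots> = (\<integral>\<^sup>+t. ennreal (\<psi> t) * emeasure lborel (A t) \<partial>lborel)"
      by (subst layer_cake) (auto simp: A_def lborel.sigma_finite_measure_axioms)
    finally show ?thesis .
  qed
  define K where "K = measure lborel (cball (0::'a) (r + D))"
  have main: "real n * \<beta> * ?I \<le> (\<integral>x. \<psi> (G x) * H x \<partial>lborel) + e * D * K" if e: "e > 0" for e
  proof -
    obtain d where d: "d > 0" "\<And>x y. dist x y < d \<Longrightarrow> norm (F x - F y) < e"
      using uniformly_continuous_bounded_support[OF contF _ e, of r] supp' by (auto simp: F_def)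
    \<comment> \<open>Displacements by \<open>s\<close> times an element of \<open>B\<close> are
      shorter than \<open>d\<close>, which keeps the variation of \<open>F\<close> below
      \<open>e\<close>, and at most \<open>D\<close>, which confines all supports to the ball of
      radius \<open>r + D\<close>.\<close>
    define s where "s = min 1 (d / (2 * D))"
    have s: "0 < s" "s \<le> 1" "s * D < d"
      using d(1) D(1) by (auto simp: s_def min_def field_simps)
    have "\<exists>y\<in>B. \<forall>y'\<in>B. G (x - s *\<^sub>R y) \<le> G (x - s *\<^sub>R y')" for x
      by (rule continuous_attains_inf[OF B])
        (intro continuous_on_compose2[OF contG] continuous_intros; simp)
    then obtain Y where Y: "\<And>x. Y x \<in> B" "\<And>x y. y \<in> B \<Longrightarrow> G (x - s *\<^sub>R Y x) \<le> G (x - s *\<^sub>R y)" by metis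
    \<comment> \<open>The infimal convolution of \<open>G\<close> over \<open>s B\<close>. The
      minimum is attained, so its strict sublevel sets are exactly Minkowski sums. As \<phi> is
      nonincreasing, \<phi> composed with \<open>h\<close> is the sup-convolution of
      \<open>f\<close>.\<close>
    define h where "h x = G (x - s *\<^sub>R Y x)" for x
    have lev: "{x. h x < t} = A t + (\<lambda>y. s *\<^sub>R y) ` B" for t
    proof (intro set_eqI iffI)
      fix x assume "x \<in> {x. h x < t}"
      then have "(x - s *\<^sub>R Y x) + s *\<^sub>R Y x \<in> A t + (\<lambda>y. s *\<^sub>R y) ` B"
        using Y(1) by (intro set_plus_intro) (auto simp: h_def A_def)
      then show "x \<in> A t + (\<lambda>y. s *\<^sub>R y) ` B" by simp
    next
      fix x assume "x \<in> A t + (\<lambda>y. s *\<^sub>R y) ` B"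
      then obtain a y where "a \<in> A t" "y \<in> B" "x = a + s *\<^sub>R y" by (auto simp: set_plus_def)
      then show "x \<in> {x. h x < t}" using Y(2)[of y x] by (auto simp: h_def A_def)
    qed
    have openl: "open {x. h x < t}" for t
      unfolding lev by (rule open_set_plus[OF openA])
    \<comment> \<open>\<open>Y\<close> is an arbitrary selection of minimizers; measurability of
      \<open>h\<close> comes from its open sublevel sets instead.\<close>
    have [measurable]: "h \<in> borel_measurable borel"
      by (intro borel_measurableI_less) (simp add: openl borel_open)
    have csB: "compact ((\<lambda>y. s *\<^sub>R y) ` B)" by (intro compact_scaling B)
    have msB: "root n (measure lborel ((\<lambda>y. s *\<^sub>R y) ` B)) = s * \<beta>"
      using s(1) B(1) n0 by (subst measure_lborel_scaleR)
        (auto simp: \<beta>_def n_def real_root_mult real_root_power_cancel compact_imp_closed borel_closed)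
    have BM: "ennreal (u t + real n * (s * \<beta>) * root n (u t) ^ (n - 1)) \<le> emeasure lborel {x. h x < t}" if t: "t < R" for t
    proof (cases "A t = {}")
      case True
      then have u: "u t = 0" by (simp add: u_def)
      \<comment> \<open>The exponent \<open>n - 1\<close> is positive, so the power of zero is zero
        and not 1.\<close>
      then have z: "root n (u t) ^ (n - 1) = 0" using n2 by (simp add: power_0_left)
      show ?thesis unfolding z using u by simp
    next
      case False
      have "u t + real n * (s * \<beta>) * root n (u t) ^ (n - 1) = root n (u t) ^ n + real n * (s * \<beta>) * root n (u t) ^ (n - 1)"
        using n0 by (simp add: u_def)
      also have "\<dots> \<le> (root n (u t) + s * \<beta>) ^ n"
        using beta0 s by (intro power_add_ge n0) (auto simp: u_def n0)
      also have "\<dots> \<le> measure lborel (A t + (\<lambda>y. s *\<^sub>R y) ` B)"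
        unfolding msB[symmetric] u_def n_def
        using t B(2) by (intro Brunn_Minkowski_open_compact openA bdA False csB) auto
      finally have "u t + real n * (s * \<beta>) * root n (u t) ^ (n - 1) \<le> measure lborel {x. h x < t}"
        by (simp add: lev)
      moreover have "ennreal (measure lborel {x. h x < t}) \<le> emeasure lborel {x. h x < t}"
        by (simp add: measure_def ennreal_enn2real_if)
      ultimately show ?thesis by (meson ennreal_leI order.trans)
    qed
    have lower: "ennreal (\<integral>x. f x \<partial>lborel) + ennreal (real n * (s * \<beta>) * ?I) \<le> (\<integral>\<^sup>+x. ennreal (\<phi> (h x)) \<partial>lborel)"
    proof -
      let ?z = "\<lambda>t. real n * (s * \<beta>) * (\<psi> t * root n (u t) ^ (n - 1))"
      have "ennreal (real n * (s * \<beta>) * ?I) = (\<integral>\<^sup>+t. ennreal (?z t) \<partial>lborel)"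
        using intI psi(2) s beta0 by (subst nn_integral_eq_integral) (auto simp: u_def n0)
      then have "ennreal (\<integral>x. f x \<partial>lborel) + ennreal (real n * (s * \<beta>) * ?I)
         = (\<integral>\<^sup>+t. ennreal (\<psi> t) * emeasure lborel (A t) + ennreal (?z t) \<partial>lborel)"
      proof -
        have m: "(\<lambda>t. emeasure lborel (A t)) \<in> borel_measurable borel"
          using borel_measurable_emeasure_less[of lborel G]
          by (simp add: A_def lborel.sigma_finite_measure_axioms)
        then have m1: "(\<lambda>t. ennreal (\<psi> t) * emeasure lborel (A t)) \<in> borel_measurable lborel"
          by measurable
        have m2: "(\<lambda>t. ennreal (?z t)) \<in> borel_measurable lborel"
          by measurable
        show ?thesis unfolding fnn \<open>ennreal (real n * (s * \<beta>) * ?I) = _\<close>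
          by (rule nn_integral_add[OF m1 m2, symmetric])
      qed
      also have "\<dots> \<le> (\<integral>\<^sup>+t. ennreal (\<psi> t) * emeasure lborel {x. h x < t} \<partial>lborel)"
      proof (rule nn_integral_mono)
        fix t
        show "ennreal (\<psi> t) * emeasure lborel (A t) + ennreal (?z t)
          \<le> ennreal (\<psi> t) * emeasure lborel {x. h x < t}"
        proof (cases "t < R")
          case True
          have "ennreal (\<psi> t) * emeasure lborel (A t) + ennreal (?z t)
            = ennreal (\<psi> t) * ennreal (u t + real n * (s * \<beta>) * root n (u t) ^ (n - 1))"
            using psi(2)[of t] s beta0 True emA[of t]
            by (simp add: ennreal_mult[symmetric] ennreal_plus[symmetric] n0 u_def algebra_simps del: ennreal_plus)
          also have "\<dots> \<le> ennreal (\<psi> t) * emeasure lborel {x. h x < t}"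
            by (intro mult_left_mono BM True) auto
          finally show ?thesis .
        qed (use psi(3) in auto)
      qed
      also have "\<dots> = (\<integral>\<^sup>+x. (\<integral>\<^sup>+t. ennreal (\<psi> t) * indicator {h x<..} t \<partial>lborel) \<partial>lborel)"
        by (subst layer_cake) (auto simp: lborel.sigma_finite_measure_axioms)
      finally show ?thesis by (simp add: phi(5))
    qed
    let ?K = "cball (0::'a) (r + D)"
    \<comment> \<open>A first-order upper bound for the sup-convolution from the mean value theorem.
      The last summand is the error from the uniform continuity of \<open>F\<close>, confined to a
      ball so that it is integrable and proportional to \<open>s\<close>.\<close>
    define U where "U x = f x + s * (\<psi> (G x) * H x) + s * e * D * indicator ?K x" for x
    have up: "AE x in lborel. \<phi> (h x) \<le> U x"
      using H(2)
    proof eventually_elim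
      case (elim x)
      have Yx: "norm (Y x) \<le> D" using D(2) Y(1) by blast
      have eq: "\<phi> (h x) = f (x - s *\<^sub>R Y x)" by (simp add: h_def f_def)
      show ?case
      proof (cases "x \<in> ?K")
        case True
        define p where "p \<tau> = f (x - \<tau> *\<^sub>R Y x)" for \<tau>
        have dp: "(p has_real_derivative (Y x \<bullet> F (x - \<tau> *\<^sub>R Y x))) (at \<tau>)" for \<tau>
        proof -
          have "(p has_derivative (\<lambda>k. - ((- k *\<^sub>R Y x) \<bullet> F (x - \<tau> *\<^sub>R Y x)))) (at \<tau>)"
            unfolding p_def
            by (rule has_derivative_compose[of "\<lambda>\<tau>. x - \<tau> *\<^sub>R Y x" "\<lambda>k. - k *\<^sub>R Y x", OF _ derf])
              (auto intro!: derivative_eq_intros)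
          moreover have "(\<lambda>k. - ((- k *\<^sub>R Y x) \<bullet> F (x - \<tau> *\<^sub>R Y x))) = (*) (Y x \<bullet> F (x - \<tau> *\<^sub>R Y x))"
            by (simp add: fun_eq_iff mult.commute)
          ultimately show ?thesis by (simp only: has_field_derivative_def)
        qed
        then obtain z where z: "0 < z" "z < s" "p s - p 0 = (s - 0) * (Y x \<bullet> F (x - z *\<^sub>R Y x))"
          using MVT2[OF s(1) dp] by auto
        have "dist (x - z *\<^sub>R Y x) x < d"
        proof -
          have "dist (x - z *\<^sub>R Y x) x = z * norm (Y x)" using z by (simp add: dist_norm)
          also have "\<dots> \<le> s * D" using z Yx by (intro mult_mono) auto
          finally show ?thesis using s by simp
        qed
        then have dF: "norm (F (x - z *\<^sub>R Y x) - F x) \<le> e" using d(2) by (simp add: less_imp_le)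
        have "Y x \<bullet> F (x - z *\<^sub>R Y x) = Y x \<bullet> F x + Y x \<bullet> (F (x - z *\<^sub>R Y x) - F x)"
          by (simp add: inner_simps)
        also have "\<dots> \<le> Y x \<bullet> F x + D * e"
          using norm_cauchy_schwarz[of "Y x" "F (x - z *\<^sub>R Y x) - F x"] mult_mono[OF Yx dF] D(1) by auto
        also have "Y x \<bullet> F x \<le> \<psi> (G x) * H x"
          using elim Y(1)[of x] psi(2) by (auto simp: F_def inner_commute intro!: mult_left_mono)
        finally have "p s - p 0 \<le> s * (\<psi> (G x) * H x + D * e)"
          using z s by (auto intro!: mult_left_mono)
        then show ?thesis using True unfolding eq by (simp add: p_def U_def algebra_simps)
      next
        case False
        have "r < norm x" using False D(1) by auto
        moreover have "r < norm (x - s *\<^sub>R Y x)"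
        proof -
          have "s * norm (Y x) \<le> 1 * D" using s Yx by (intro mult_mono) auto
          then have "norm (s *\<^sub>R Y x) \<le> 1 * D" using s by simp
          then show ?thesis using False norm_triangle_ineq2[of x "s *\<^sub>R Y x"] by auto
        qed
        ultimately show ?thesis unfolding eq U_def using supp' False by simp
      qed
    qed
    have intU: "integrable lborel U"
      unfolding U_def using intf H(1) emeasure_lborel_cball_finite
      by (intro Bochner_Integration.integrable_add integrable_mult_right integrable_mult_left integrable_real_indicator) auto
    have IU: "(\<integral>x. U x \<partial>lborel) = (\<integral>x. f x \<partial>lborel) + s * (\<integral>x. \<psi> (G x) * H x \<partial>lborel) + s * e * D * K"
      unfolding U_def using intf H(1) emeasure_lborel_cball_finite[of "0::'a" "r + D"]
      by (simp add: K_def)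
    have "(\<integral>\<^sup>+x. ennreal (\<phi> (h x)) \<partial>lborel) \<le> (\<integral>\<^sup>+x. ennreal (U x) \<partial>lborel)"
      using up by (intro nn_integral_mono_AE) (auto elim!: eventually_mono intro: ennreal_leI)
    also have "\<dots> = ennreal (\<integral>x. U x \<partial>lborel)"
      using up by (intro nn_integral_eq_integral intU) (auto elim!: eventually_mono intro: order.trans[OF phi(4)])
    finally have "ennreal ((\<integral>x. f x \<partial>lborel) + real n * (s * \<beta>) * ?I) \<le> ennreal (\<integral>x. U x \<partial>lborel)"
      using lower f0 psi(2) s beta0 by (subst ennreal_plus) (auto intro!: integral_nonneg mult_nonneg_nonneg simp: u_def n0)
    moreover have "(\<integral>x. U x \<partial>lborel) \<ge> 0"
      using up by (intro integral_nonneg_AE) (auto elim!: eventually_mono intro: order.trans[OF phi(4)])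
    ultimately have "(\<integral>x. f x \<partial>lborel) + real n * (s * \<beta>) * ?I \<le> (\<integral>x. U x \<partial>lborel)"
      by (simp add: ennreal_le_iff)
    then have "s * (real n * \<beta> * ?I) \<le> s * ((\<integral>x. \<psi> (G x) * H x \<partial>lborel) + e * D * K)"
      unfolding IU by (simp add: algebra_simps)
    then show ?thesis using s by simp
  qed
  have "real n * \<beta> * ?I \<le> (\<integral>x. \<psi> (G x) * H x \<partial>lborel) + e" if "e > 0" for e
  proof -
    have DK: "D * K \<ge> 0" using D by (simp add: K_def)
    have "real n * \<beta> * ?I \<le> (\<integral>x. \<psi> (G x) * H x \<partial>lborel) + (e / (D * K + 1)) * D * K"
      using that DK by (intro main) (auto intro!: divide_pos_pos)
    also have "(e / (D * K + 1)) * D * K = e * ((D * K) / (D * K + 1))" by simp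
    also have "\<dots> \<le> e * 1" using that DK by (intro mult_left_mono) (auto simp: divide_simps)
    finally show ?thesis by simp
  qed
  then have "real n * \<beta> * ?I \<le> (\<integral>x. \<psi> (G x) * H x \<partial>lborel)" by (rule field_le_epsilon)
  then show ?thesis by (simp add: \<beta>_def u_def A_def)
qed

text \<open>Only the positive part of \<open>w\<close> has an integrable majorant, so it is treated
  by dominated convergence. The lower bounds \<open>c k\<close> then bound the integrals of the
  negative part from above, and Fatou's lemma yields both its integrability and the limit
  inequality.\<close>

lemma integral_ge_limit:
  fixes w q p :: "'a \<Rightarrow> real" and P :: "nat \<Rightarrow> 'a \<Rightarrow> real"
  assumes [measurable]: "w \<in> borel_measurable M" "\<And>k. P k \<in> borel_measurable M" "p \<in> borel_measurable M"
    and P: "\<And>k x. 0 \<le> P k x" "\<And>k x. P k x \<le> q x" "\<And>x. (\<lambda>k. P k x) \<longlonglongrightarrow> p x"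
    and q: "integrable M (\<lambda>x. q x * max 0 (w x))"
    and Pw: "\<And>k. integrable M (\<lambda>x. P k x * w x)" "\<And>k. c k \<le> (\<integral>x. P k x * w x \<partial>M)"
    and c: "c \<longlonglongrightarrow> c'"
  shows "integrable M (\<lambda>x. p x * w x)" "c' \<le> (\<integral>x. p x * w x \<partial>M)"
proof -
  let ?p = "\<lambda>x. max 0 (w x)" and ?n = "\<lambda>x. max 0 (- w x)"
  have p0: "0 \<le> p x" for x by (rule LIMSEQ_le_const[OF P(3)]) (use P(1) in auto)
  have bnd: "AE x in M. norm (P k x * ?p x) \<le> q x * ?p x" for k
    using P(1,2) by (auto simp: abs_mult intro!: mult_right_mono)
  have lim: "AE x in M. (\<lambda>k. P k x * ?p x) \<longlonglongrightarrow> p x * ?p x" using P(3) by (auto intro!: tendsto_intros)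
  have ip: "integrable M (\<lambda>x. p x * ?p x)"
    by (rule integrable_dominated_convergence[OF _ _ q lim bnd]) auto
  have iPp: "integrable M (\<lambda>x. P k x * ?p x)" for k
    by (rule integrable_dominated_convergence2[OF _ _ q lim bnd]) auto
  have Ip: "(\<lambda>k. \<integral>x. P k x * ?p x \<partial>M) \<longlonglongrightarrow> (\<integral>x. p x * ?p x \<partial>M)"
    by (rule integral_dominated_convergence[OF _ _ q lim bnd]) auto
  have n_eq: "P k x * ?n x = P k x * ?p x - P k x * w x" for k x by (auto simp: max_def algebra_simps)
  have iPn: "integrable M (\<lambda>x. P k x * ?n x)" for k
    unfolding n_eq using iPp Pw(1) by (rule Bochner_Integration.integrable_diff)
  have In: "(\<integral>x. P k x * ?n x \<partial>M) \<le> (\<integral>x. P k x * ?p x \<partial>M) - c k" for k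
    unfolding n_eq using iPp[of k] Pw(1)[of k] Pw(2)[of k] by simp
  have r: "(\<lambda>k. (\<integral>x. P k x * ?p x \<partial>M) - c k) \<longlonglongrightarrow> (\<integral>x. p x * ?p x \<partial>M) - c'"
    by (intro tendsto_diff Ip c)
  have r0: "0 \<le> (\<integral>x. p x * ?p x \<partial>M) - c'"
  proof (rule LIMSEQ_le_const[OF r])
    have "0 \<le> (\<integral>x. P k x * ?p x \<partial>M) - c k" for k
      using In[of k] P(1) by (intro order.trans[OF _ In]) (auto intro!: integral_nonneg)
    then show "\<exists>N. \<forall>k\<ge>N. 0 \<le> (\<integral>x. P k x * ?p x \<partial>M) - c k" by blast
  qed
  have "(\<integral>\<^sup>+x. ennreal (p x * ?n x) \<partial>M) = (\<integral>\<^sup>+x. liminf (\<lambda>k. ennreal (P k x * ?n x)) \<partial>M)"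
    using P(3) by (intro nn_integral_cong sym[OF lim_imp_Liminf]) (auto intro!: tendsto_intros)
  also have "\<dots> \<le> liminf (\<lambda>k. \<integral>\<^sup>+x. ennreal (P k x * ?n x) \<partial>M)"
    by (rule nn_integral_liminf) auto
  also have "\<dots> \<le> liminf (\<lambda>k. ennreal ((\<integral>x. P k x * ?p x \<partial>M) - c k))"
    using iPn In P(1) by (intro Liminf_mono always_eventually allI) (auto simp: nn_integral_eq_integral intro!: ennreal_leI)
  also have "\<dots> = ennreal ((\<integral>x. p x * ?p x \<partial>M) - c')"
    by (intro lim_imp_Liminf tendsto_ennrealI r) auto
  finally have nn: "(\<integral>\<^sup>+x. ennreal (p x * ?n x) \<partial>M) \<le> ennreal ((\<integral>x. p x * ?p x \<partial>M) - c')" .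
  have i_n: "integrable M (\<lambda>x. p x * ?n x)"
    using nn p0 by (intro integrableI_nonneg) (auto simp: less_top[symmetric] top_unique intro: le_less_trans)
  have "ennreal (\<integral>x. p x * ?n x \<partial>M) \<le> ennreal ((\<integral>x. p x * ?p x \<partial>M) - c')"
    using nn p0 by (subst nn_integral_eq_integral[OF i_n, symmetric]) auto
  then have "(\<integral>x. p x * ?n x \<partial>M) \<le> (\<integral>x. p x * ?p x \<partial>M) - c'"
    using r0 by (simp add: ennreal_le_iff)
  moreover have w_eq: "p x * w x = p x * ?p x - p x * ?n x" for x by (auto simp: max_def)
  ultimately show "integrable M (\<lambda>x. p x * w x)" "c' \<le> (\<integral>x. p x * w x \<partial>M)"
    unfolding w_eq using ip i_n by auto
qed

text \<open>Markov's inequality for \<open>1 / h x ^ n\<close>.\<close>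

lemma sublevel_fmeasurable:
  fixes h :: "'a \<Rightarrow> real"
  assumes [measurable]: "h \<in> borel_measurable M" and "\<And>x. h x > 0" "integrable M (\<lambda>x. 1 / h x ^ n)"
  shows "{x \<in> space M. h x < t} \<in> fmeasurable M"
proof (rule fmeasurableI)
  have "(\<integral>\<^sup>+x. indicator {x \<in> space M. h x < t} x \<partial>M) \<le> (\<integral>\<^sup>+x. ennreal (t ^ n * (1 / h x ^ n)) \<partial>M)"
  proof (rule nn_integral_mono)
    fix x
    show "indicator {x \<in> space M. h x < t} x \<le> ennreal (t ^ n * (1 / h x ^ n))"
    proof (cases "h x < t")
      case True
      then have "h x ^ n \<le> t ^ n" using assms(2)[of x] by (intro power_mono) auto
      then have "1 \<le> t ^ n * (1 / h x ^ n)" using assms(2)[of x] by (simp add: divide_simps)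
      then show ?thesis by (auto simp: indicator_def)
    qed (auto simp: indicator_def)
  qed
  also have "\<dots> < \<infinity>"
    using integrable_mult_right[OF assms(3), of "t ^ n"] by (simp add: real_integrable_def less_top)
  finally show "emeasure M {x \<in> space M. h x < t} < \<infinity>" by simp
qed simp

section \<open>Level inequalities for a dual pair\<close>

text \<open>\<open>V\<close> is the function \<open>W\<close> of the theorem and \<open>w\<close> a finite version of \<open>W\<^sup>*(\<nabla>g)\<close>; the Legendre
  transform enters only through Young's inequality.\<close>

locale legendre_duality =
  fixes g w V :: "'a::euclidean_space \<Rightarrow> real" and Dg :: "'a \<Rightarrow> 'a" and n :: nat
  assumes n_def: "n = DIM('a)"
    and dim: "n \<ge> 2"
    and derg: "\<And>x. (g has_derivative (\<lambda>h. h \<bullet> Dg x)) (at x)"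
    and contDg: "continuous_on UNIV Dg"
    and gpos: "\<And>x. g x > 0"
    and intg: "integrable lborel (\<lambda>x. 1 / g x ^ n)"
    and measw[measurable]: "w \<in> borel_measurable borel"
    and intw: "integrable lborel (\<lambda>x. 1 / g x ^ n * max 0 (w x))"
    and young: "AE x in lborel. \<forall>y. Dg x \<bullet> y \<le> w x + V y"
    and measV[measurable]: "V \<in> borel_measurable lebesgue"
    and Vpos: "\<And>y. V y > 0"
    and intV: "integrable lebesgue (\<lambda>y. 1 / V y ^ n)"
begin

text \<open>\<open>V\<close> is only Lebesgue measurable, whereas \<open>g\<close> is continuous;
  hence the two different measures. The roots \<open>ru\<close> and \<open>rv\<close> below are
  volume radii, the quantities in which Brunn-Minkowski is additive.\<close>

definition u :: "real \<Rightarrow> real" where "u t = measure lborel {x. g x < t}"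
definition v :: "real \<Rightarrow> real" where "v t = measure lebesgue {y. V y < t}"
definition ru :: "real \<Rightarrow> real" where "ru t = root n (u t)"
definition rv :: "real \<Rightarrow> real" where "rv t = root n (v t)"

lemma contg: "continuous_on UNIV g"
  using derg by (meson continuous_at_imp_continuous_on has_derivative_continuous)

lemma measg[measurable]: "g \<in> borel_measurable borel"
  using contg by (rule borel_measurable_continuous_onI)

lemma fm_g: "{x. g x < t} \<in> fmeasurable lborel"
  using sublevel_fmeasurable[of g lborel n t] gpos intg by simp

lemma fm_V: "{y. V y < t} \<in> lmeasurable"
  using sublevel_fmeasurable[of V lebesgue n t] Vpos intV by simp

lemma u_mono: "s \<le> t \<Longrightarrow> u s \<le> u t"
  unfolding u_def using fm_g by (intro measure_mono_fmeasurable) (auto dest: fmeasurableD)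

lemma v_mono: "s \<le> t \<Longrightarrow> v s \<le> v t"
  unfolding v_def using fm_V by (intro measure_mono_fmeasurable) (auto dest: fmeasurableD)

lemma u_nonneg: "0 \<le> u t" and v_nonneg: "0 \<le> v t"
  by (simp_all add: u_def v_def)

lemma n0[simp]: "0 < n"
  using dim by simp

lemma ru_nonneg: "0 \<le> ru t" and rv_nonneg: "0 \<le> rv t"
  by (simp_all add: ru_def rv_def u_nonneg v_nonneg)

lemma ru_mono: "s \<le> t \<Longrightarrow> ru s \<le> ru t" and rv_mono: "s \<le> t \<Longrightarrow> rv s \<le> rv t"
  by (simp_all add: ru_def rv_def u_mono v_mono)

lemma u_meas[measurable]: "u \<in> borel_measurable borel"
  using u_mono by (intro borel_measurable_mono monoI)

lemma v_meas[measurable]: "v \<in> borel_measurable borel"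
  using v_mono by (intro borel_measurable_mono monoI)

lemma ru_meas[measurable]: "ru \<in> borel_measurable borel"
  using ru_mono by (intro borel_measurable_mono monoI)

lemma rv_meas[measurable]: "rv \<in> borel_measurable borel"
  using rv_mono by (intro borel_measurable_mono monoI)

lemma u_nonpos: "t \<le> 0 \<Longrightarrow> u t = 0"
proof -
  assume "t \<le> 0"
  then have "\<not> g x < t" for x using gpos[of x] by linarith
  then show "u t = 0" by (simp add: u_def)
qed

lemma v_nonpos: "t \<le> 0 \<Longrightarrow> v t = 0"
proof -
  assume "t \<le> 0"
  then have "\<not> V x < t" for x using Vpos[of x] by linarith
  then show "v t = 0" by (simp add: v_def)
qed

lemma ru_pow_nonpos: "t \<le> 0 \<Longrightarrow> ru t ^ (n - 1) = 0"
  using dim by (simp add: ru_def u_nonpos power_0_left)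

lemma ru_pow: "ru t ^ n = u t" and rv_pow: "rv t ^ n = v t"
  by (simp_all add: ru_def rv_def u_nonneg v_nonneg)

text \<open>The last bound allows any \<open>t\<close> above \<open>g x\<close>: one integrable
  multiple of \<open>1 / g x ^ n\<close> then dominates \<psi> composed with \<open>G\<close> for
  every \<open>G\<close> above \<open>g\<close>, uniformly over the perturbations of
  \<open>g\<close>.\<close>

lemma cutoff_bound:
  assumes psi: "continuous_on UNIV \<psi>" "\<And>t. \<psi> t \<ge> 0" "\<And>t::real. t \<ge> R \<Longrightarrow> \<psi> t = (0::real)" and R: "R > 0"
  obtains C where "C \<ge> 0" "\<And>t. t \<ge> 0 \<Longrightarrow> \<psi> t \<le> C" "\<And>x t. g x \<le> t \<Longrightarrow> \<psi> t \<le> C * R ^ n * (1 / g x ^ n)"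
proof -
  have "bounded (\<psi> ` {0..R})"
    by (intro compact_imp_bounded compact_continuous_image continuous_on_subset[OF psi(1)]) auto
  then obtain c where "\<forall>t\<in>{0..R}. \<bar>\<psi> t\<bar> \<le> c" by (auto simp: bounded_iff)
  note c' = bspec[OF this]
  have c: "\<psi> t \<le> c" if "t \<ge> 0" "t \<le> R" for t using c'[of t] that by auto
  have C: "\<psi> t \<le> \<bar>c\<bar>" if "t \<ge> 0" for t
    using c[OF that] psi(3)[of t] by (cases "t \<le> R") auto
  have "\<psi> t \<le> \<bar>c\<bar> * R ^ n * (1 / g x ^ n)" if "g x \<le> t" for x t
  proof (cases "t < R")
    case True
    then have "g x ^ n \<le> R ^ n" using that gpos[of x] by (intro power_mono) auto
    then have "1 \<le> R ^ n * (1 / g x ^ n)" using gpos[of x] by (simp add: divide_simps)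
    then have "\<bar>c\<bar> * 1 \<le> \<bar>c\<bar> * (R ^ n * (1 / g x ^ n))" by (intro mult_left_mono) auto
    moreover have "\<psi> t \<le> \<bar>c\<bar>" using that gpos[of x] by (intro C) auto
    ultimately show ?thesis by (simp add: mult.assoc)
  next
    case False
    have "0 \<le> \<bar>c\<bar> * R ^ n * (1 / g x ^ n)" using gpos[of x] R by simp
    then show ?thesis using False psi(3)[of t] by simp
  qed
  then show thesis using that[of "\<bar>c\<bar>"] C by auto
qed

text \<open>A differentiable substitute for the norm. Adding \<epsilon> \<open>J\<close> to the
  positive function \<open>g\<close> makes all sublevel sets bounded, and changes the inner product
  of the gradient with \<open>y\<close> by at most \<epsilon> times the norm of
  \<open>y\<close>.\<close>

lemma sqrt_norm_deriv:
  defines "J \<equiv> \<lambda>x::'a. sqrt (1 + x \<bullet> x)"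
  shows "(J has_derivative (\<lambda>h. h \<bullet> (x /\<^sub>R J x))) (at x)" "norm (x /\<^sub>R J x) \<le> 1" "norm x \<le> J x"
    "continuous_on UNIV (\<lambda>x. x /\<^sub>R J x)" "J x > 0" "continuous_on UNIV J"
proof -
  have pos: "1 + x \<bullet> x > 0" for x :: 'a using inner_ge_zero[of x] by linarith
  then show J: "J x > 0" for x by (simp add: J_def)
  show nJ: "norm x \<le> J x"
    unfolding J_def by (rule real_le_rsqrt) (simp add: power2_norm_eq_inner)
  then show "norm (x /\<^sub>R J x) \<le> 1" using J[of x] by (simp add: divide_simps)
  have "(J has_derivative (\<lambda>h. (h \<bullet> x + x \<bullet> h) * (inverse (sqrt (1 + x \<bullet> x)) / 2))) (at x)"
    unfolding J_def using pos[of x] by (auto intro!: derivative_eq_intros simp: inner_commute)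
  moreover have "(\<lambda>h. (h \<bullet> x + x \<bullet> h) * (inverse (sqrt (1 + x \<bullet> x)) / 2)) = (\<lambda>h. h \<bullet> (x /\<^sub>R J x))"
    by (auto simp: J_def fun_eq_iff inner_commute)
  ultimately show "(J has_derivative (\<lambda>h. h \<bullet> (x /\<^sub>R J x))) (at x)" by simp
  show cJ: "continuous_on UNIV J" unfolding J_def by (intro continuous_intros)
  show "continuous_on UNIV (\<lambda>x. x /\<^sub>R J x)"
    using J by (intro continuous_intros cJ) (auto simp: less_imp_neq[symmetric])
qed

text \<open>Young's inequality at \<open>y = 0\<close> gives w \<ge> - V 0, which controls the
  negative part on the bounded set where the cutoff is nonzero; the positive part is dominated
  through \<open>intw\<close>.\<close>

lemma weight_integrable:
  assumes psi: "continuous_on UNIV \<psi>" "\<And>t. \<psi> t \<ge> 0" "\<And>t::real. t \<ge> R \<Longrightarrow> \<psi> t = (0::real)" and R: "R > 0"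
    and G: "continuous_on UNIV G" "\<And>x. g x \<le> G x" "bounded {x. G x < R}"
  shows "integrable lborel (\<lambda>x. \<psi> (G x) * w x)"
proof -
  obtain C where C: "C \<ge> 0" "\<And>t. t \<ge> 0 \<Longrightarrow> \<psi> t \<le> C" "\<And>x t. g x \<le> t \<Longrightarrow> \<psi> t \<le> C * R ^ n * (1 / g x ^ n)"
    using cutoff_bound[OF psi R] by metis
  obtain r where "\<forall>x\<in>{x. G x < R}. norm x \<le> r" using G(3) by (auto simp: bounded_iff)
  then have r: "norm x \<le> r" if "G x < R" for x using that by auto
  have "bounded (Dg ` cball 0 r)"
    by (intro compact_imp_bounded compact_continuous_image continuous_on_subset[OF contDg]) auto
  then obtain K where "\<forall>x\<in>cball 0 r. norm (Dg x) \<le> K" by (auto simp: bounded_iff)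
  then have K: "norm (Dg x) \<le> K" if "norm x \<le> r" for x using that by auto
  have [measurable]: "G \<in> borel_measurable borel" "\<psi> \<in> borel_measurable borel"
    using G(1) psi(1) by (auto intro: borel_measurable_continuous_onI)
  show ?thesis
  proof (rule Bochner_Integration.integrable_bound)
    show "integrable lborel (\<lambda>x. C * R ^ n * (1 / g x ^ n * max 0 (w x)) + C * \<bar>V 0\<bar> * indicator (cball 0 r) x)"
      using intw emeasure_lborel_cball_finite[of "0::'a" r]
      by (intro Bochner_Integration.integrable_add integrable_mult_right integrable_real_indicator) auto
    show "AE x in lborel. norm (\<psi> (G x) * w x) \<le> norm (C * R ^ n * (1 / g x ^ n * max 0 (w x)) + C * \<bar>V 0\<bar> * indicator (cball 0 r) x)"
      using young
    proof eventually_elim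
      case (elim x)
      have w: "- V 0 \<le> w x" using spec[OF elim, of 0] by simp
      have "\<bar>\<psi> (G x) * w x\<bar> \<le> \<psi> (G x) * max 0 (w x) + \<psi> (G x) * \<bar>V 0\<bar>"
      proof -
        have "\<bar>w x\<bar> \<le> max 0 (w x) + \<bar>V 0\<bar>" using w by (auto simp: max_def)
        then show ?thesis using psi(2)[of "G x"] by (simp add: abs_mult distrib_left[symmetric] mult_left_mono)
      qed
      also have "\<psi> (G x) * max 0 (w x) \<le> C * R ^ n * (1 / g x ^ n) * max 0 (w x)"
        using C(3)[OF G(2), of x] by (intro mult_right_mono) auto
      also have "\<psi> (G x) * \<bar>V 0\<bar> \<le> C * \<bar>V 0\<bar> * indicator (cball 0 r) x"
      proof (cases "G x < R")
        case True
        have "0 \<le> G x" using gpos[of x] G(2)[of x] by linarith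
        then show ?thesis using C(2)[of "G x"] r[OF True] by (auto intro!: mult_right_mono)
      qed (use psi(3) C(1) in \<open>auto simp: indicator_def\<close>)
      finally show ?case by (simp add: mult.assoc)
    qed
  qed simp
qed

lemma cutoff_times_integrable:
  assumes psi: "continuous_on UNIV \<psi>" "\<And>t. \<psi> t \<ge> 0" "\<And>t::real. t \<ge> R \<Longrightarrow> \<psi> t = (0::real)" and R: "R > 0"
    and k: "k \<in> borel_measurable borel" "\<And>t. t \<le> 0 \<Longrightarrow> k t = 0" "\<And>t. 0 \<le> k t" "\<And>t. t \<le> R \<Longrightarrow> k t \<le> c"
  shows "integrable lborel (\<lambda>t. \<psi> t * k t)"
proof -
  obtain C where C: "C \<ge> 0" "\<And>t. t \<ge> 0 \<Longrightarrow> \<psi> t \<le> C" "\<And>x t. g x \<le> t \<Longrightarrow> \<psi> t \<le> C * R ^ n * (1 / g x ^ n)"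
    using cutoff_bound[OF psi R] by metis
  have [measurable]: "k \<in> borel_measurable borel" "\<psi> \<in> borel_measurable borel"
    using k psi(1) by (auto intro: borel_measurable_continuous_onI)
  show ?thesis
  proof (rule integrable_lborel_bounded_support)
    show "bounded {0..R}" by simp
    show z: "\<psi> t * k t = 0" if "t \<notin> {0..R}" for t
      using that psi(3)[of t] k(2)[of t] by (cases "t < 0") auto
    have c0: "0 \<le> c" using k(3)[of 0] k(4)[of 0] R by linarith
    show "\<bar>\<psi> t * k t\<bar> \<le> C * c" for t
    proof (cases "t \<in> {0..R}")
      case True
      then show ?thesis using C(1) C(2)[of t] k(3,4)[of t] psi(2)[of t] by (auto simp: abs_mult intro!: mult_mono)
    next
      case False
      have "0 \<le> C * c" using C(1) c0 by simp
      then show ?thesis unfolding z[OF False] by simp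
    qed
  qed measurable
qed

text \<open>On \<open>B\<close>, Young's inequality bounds the directional derivatives of
  \<open>g\<close> by \<open>w x + b\<close>, which is the hypothesis of the coarea inequality.
  Since {g < R} may be unbounded, that inequality is applied to \<open>G k = g + e k * J\<close>, at
  the additional cost \<open>e k * D\<close>; the functions \<open>G k\<close> decrease to
  \<open>g\<close>, so their sublevel sets increase to those of \<open>g\<close>.\<close>

lemma level_inequality_compact:
  assumes psi: "continuous_on UNIV \<psi>" "\<And>t. \<psi> t \<ge> 0" "\<And>t::real. t \<ge> R \<Longrightarrow> \<psi> t = (0::real)" and R: "R > 0"
    and B: "compact B" "B \<noteq> {}" "B \<subseteq> {y. V y \<le> b}"
  shows "integrable lborel (\<lambda>x. \<psi> (g x) * w x)"
    "n * root n (measure lborel B) * (\<integral>t. \<psi> t * ru t ^ (n - 1) \<partial>lborel) \<le> (\<integral>x. \<psi> (g x) * w x \<partial>lborel) + b * (\<integral>x. \<psi> (g x) \<partial>lborel)"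
proof -
  obtain C where C: "C \<ge> 0" "\<And>t. t \<ge> 0 \<Longrightarrow> \<psi> t \<le> C" "\<And>x t. g x \<le> t \<Longrightarrow> \<psi> t \<le> C * R ^ n * (1 / g x ^ n)"
    using cutoff_bound[OF psi R] by metis
  obtain D where D: "D > 0" "\<And>y. y \<in> B \<Longrightarrow> norm y \<le> D"
    using compact_imp_bounded[OF B(1)] by (auto simp: bounded_pos)
  define J where "J = (\<lambda>x::'a. sqrt (1 + x \<bullet> x))"
  have J_eq: "sqrt (1 + x \<bullet> x) = J x" for x by (simp add: J_def)
  note J = sqrt_norm_deriv[unfolded J_eq]
  define e where "e k = 1 / real (Suc k)" for k
  have e: "e k > 0" for k by (simp add: e_def)
  have elim0: "e \<longlonglongrightarrow> 0" unfolding e_def by (intro LIMSEQ_Suc lim_1_over_n)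
  define G where "G k x = g x + e k * J x" for k x
  define DG where "DG k x = Dg x + e k *\<^sub>R (x /\<^sub>R J x)" for k x
  have gG: "g x \<le> G k x" for k x using less_imp_le[OF mult_pos_pos[OF e[of k] J(5)[of x]]] by (simp add: G_def)
  have contG: "continuous_on UNIV (G k)" for k unfolding G_def by (intro continuous_intros contg J)
  have [measurable]: "G k \<in> borel_measurable borel" for k using contG by (rule borel_measurable_continuous_onI)
  have [measurable]: "\<psi> \<in> borel_measurable borel" using psi(1) by (rule borel_measurable_continuous_onI)
  have Glim: "(\<lambda>k. G k x) \<longlonglongrightarrow> g x" for x
    unfolding G_def using tendsto_add[OF tendsto_const tendsto_mult[OF elim0 tendsto_const], of "g x" "J x"] by simp
  have psilim: "(\<lambda>k. \<psi> (G k x)) \<longlonglongrightarrow> \<psi> (g x)" for x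
    using psi(1) Glim by (intro isCont_tendsto_compose[of _ \<psi>]) (auto simp: continuous_on_eq_continuous_at)
  have bdG: "bounded {x. G k x < R}" for k
  proof (rule boundedI)
    fix x assume "x \<in> {x. G k x < R}"
    then have "e k * J x < R" using gpos[of x] by (auto simp: G_def)
    then have "e k * norm x < R" using J(3)[of x] e[of k] by (meson mult_left_mono less_imp_le le_less_trans)
    then show "norm x \<le> R / e k" using e[of k] by (simp add: field_simps)
  qed
  let ?q = "\<lambda>x. C * R ^ n * (1 / g x ^ n)"
  have intq: "integrable lborel ?q" using intg by (rule integrable_mult_right)
  have psiq: "norm (\<psi> (G k x)) \<le> ?q x" for k x
    using C(3)[OF gG[where x=x and k=k]] psi(2)[of "G k x"] by simp
  have intpsiG: "integrable lborel (\<lambda>x. \<psi> (G k x))" for k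
    by (rule integrable_dominated_convergence2[OF _ _ intq]) (use psilim psiq in auto)
  have Ipsi: "(\<lambda>k. \<integral>x. \<psi> (G k x) \<partial>lborel) \<longlonglongrightarrow> (\<integral>x. \<psi> (g x) \<partial>lborel)"
    by (rule integral_dominated_convergence[OF _ _ intq]) (use psilim psiq in auto)
  have intw': "integrable lborel (\<lambda>x. \<psi> (G k x) * w x)" for k
    by (rule weight_integrable[OF psi R contG gG bdG])
  define uk where "uk k t = measure lborel {x. G k x < t}" for k t
  have uk_le: "uk k t \<le> u t" for k t
    unfolding uk_def u_def using fm_g gG by (intro measure_mono_fmeasurable) (auto intro: le_less_trans)
  have uk_mono: "mono (uk k)" for k
  proof (rule monoI)
    fix s t :: real assume "s \<le> t"
    moreover have "{x. G k x < t} \<in> fmeasurable lborel"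
      using gG by (intro fmeasurableI2[OF fm_g[of t]]) (auto intro: le_less_trans)
    ultimately show "uk k s \<le> uk k t"
      unfolding uk_def by (intro measure_mono_fmeasurable) auto
  qed
  have [measurable]: "uk k \<in> borel_measurable borel" for k using uk_mono by (rule borel_measurable_mono)
  have uk_lim: "(\<lambda>k. uk k t) \<longlonglongrightarrow> u t" for t
  proof -
    have "(\<lambda>k. measure lborel {x. G k x < t}) \<longlonglongrightarrow> measure lborel (\<Union>k. {x. G k x < t})"
    proof (rule Lim_measure_incseq)
      show "incseq (\<lambda>k. {x. G k x < t})"
      proof (rule incseq_SucI)
        fix k
        have "G (Suc k) x \<le> G k x" for x
          unfolding G_def e_def using J(5)[of x] by (intro add_left_mono mult_right_mono) (auto simp: field_simps)
        then show "{x. G k x < t} \<subseteq> {x. G (Suc k) x < t}" by (auto intro: le_less_trans)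
      qed
      have "emeasure lborel (\<Union>k. {x. G k x < t}) \<le> emeasure lborel {x. g x < t}"
        using gG by (intro emeasure_mono) (auto intro: le_less_trans)
      also have "\<dots> < \<infinity>" using fm_g by (auto simp: fmeasurable_def)
      finally show "emeasure lborel (\<Union>k. {x. G k x < t}) \<noteq> \<infinity>" by simp
    qed auto
    also have "(\<Union>k. {x. G k x < t}) = {x. g x < t}"
    proof (intro set_eqI iffI)
      fix x assume "x \<in> {x. g x < t}"
      then have "\<forall>\<^sub>F k in sequentially. G k x < t" using Glim[of x] by (auto dest: order_tendstoD)
      then show "x \<in> (\<Union>k. {x. G k x < t})" by (auto simp: eventually_sequentially)
    qed (use gG in \<open>auto intro: le_less_trans\<close>)
    finally show ?thesis by (simp add: uk_def u_def)
  qed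
  let ?k = "\<lambda>k t. \<psi> t * root n (uk k t) ^ (n - 1)"
  have intru: "integrable lborel (\<lambda>t. \<psi> t * ru t ^ (n - 1))"
    by (rule cutoff_times_integrable[OF psi R, where c = "ru R ^ (n - 1)"])
      (auto simp: ru_nonneg ru_mono intro!: power_mono ru_pow_nonpos[simplified])
  have Iru: "(\<lambda>k. \<integral>t. ?k k t \<partial>lborel) \<longlonglongrightarrow> (\<integral>t. \<psi> t * ru t ^ (n - 1) \<partial>lborel)"
  proof (rule integral_dominated_convergence[OF _ _ intru])
    show "AE t in lborel. norm (?k k t) \<le> \<psi> t * ru t ^ (n - 1)" for k
      using psi(2) uk_le by (auto simp: abs_mult ru_def uk_def intro!: mult_left_mono power_mono)
    show "AE t in lborel. (\<lambda>k. ?k k t) \<longlonglongrightarrow> \<psi> t * ru t ^ (n - 1)"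
      unfolding ru_def by (intro AE_I2 tendsto_intros uk_lim)
  qed measurable
  let ?\<beta> = "root n (measure lborel B)"
  define c where "c k = real n * ?\<beta> * (\<integral>t. ?k k t \<partial>lborel) - (b + e k * D) * (\<integral>x. \<psi> (G k x) \<partial>lborel)" for k
  have ck: "c k \<le> (\<integral>x. \<psi> (G k x) * w x \<partial>lborel)" for k
  proof -
    have eq: "\<psi> (G k x) * (w x + (b + e k * D)) = \<psi> (G k x) * w x + (b + e k * D) * \<psi> (G k x)" for x
      by (simp add: algebra_simps)
    have "real n * ?\<beta> * (\<integral>t. \<psi> t * root n (measure lborel {x. G k x < t}) ^ (n - 1) \<partial>lborel)
      \<le> (\<integral>x. \<psi> (G k x) * (w x + (b + e k * D)) \<partial>lborel)"
    proof (rule anisotropic_coarea_inequality[where ?'a = 'a, folded n_def, OF dim _ _ psi bdG _ B(1,2)])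
      show "(G k has_derivative (\<lambda>h. h \<bullet> DG k x)) (at x)" for x
      proof -
        have "(G k has_derivative (\<lambda>h. h \<bullet> Dg x + e k * (h \<bullet> (x /\<^sub>R J x)))) (at x)"
          unfolding G_def[abs_def] by (intro has_derivative_add derg has_derivative_mult_right J)
        then show ?thesis by (simp add: DG_def inner_add_right mult.assoc)
      qed
      show "continuous_on UNIV (DG k)" unfolding DG_def by (intro continuous_intros contDg J)
      show "G k x > 0" for x using gpos[of x] gG[where x=x and k=k] by linarith
      show "integrable lborel (\<lambda>x. \<psi> (G k x) * (w x + (b + e k * D)))"
        unfolding eq by (intro Bochner_Integration.integrable_add integrable_mult_right intw' intpsiG)
      show "AE x in lborel. \<forall>y\<in>B. DG k x \<bullet> y \<le> w x + (b + e k * D)"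
        using young
      proof eventually_elim
        case (elim x)
        show ?case
        proof
          fix y assume y: "y \<in> B"
          have "(x /\<^sub>R J x) \<bullet> y \<le> norm (x /\<^sub>R J x) * norm y" by (rule norm_cauchy_schwarz)
          also have "\<dots> \<le> 1 * D" using J(2)[of x] D y by (intro mult_mono) auto
          finally have "e k * ((x /\<^sub>R J x) \<bullet> y) \<le> e k * D" using e[of k] by (intro mult_left_mono) auto
          moreover have "Dg x \<bullet> y \<le> w x + b" using spec[OF elim, of y] B(3) y by fastforce
          ultimately show "DG k x \<bullet> y \<le> w x + (b + e k * D)" by (simp add: DG_def inner_add_left)
        qed
      qed
    qed
    also have "\<dots> = (\<integral>x. \<psi> (G k x) * w x \<partial>lborel) + (b + e k * D) * (\<integral>x. \<psi> (G k x) \<partial>lborel)"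
      unfolding eq using intw' intpsiG by simp
    finally show ?thesis by (simp add: c_def uk_def)
  qed
  have clim: "c \<longlonglongrightarrow> real n * ?\<beta> * (\<integral>t. \<psi> t * ru t ^ (n - 1) \<partial>lborel) - (b + 0 * D) * (\<integral>x. \<psi> (g x) \<partial>lborel)"
    unfolding c_def by (intro tendsto_intros Iru Ipsi elim0)
  have intq': "integrable lborel (\<lambda>x. ?q x * max 0 (w x))"
    using integrable_mult_right[OF intw, of "C * R ^ n"] by (simp add: mult.assoc)
  have *: "integrable lborel (\<lambda>x. \<psi> (g x) * w x)"
    "real n * ?\<beta> * (\<integral>t. \<psi> t * ru t ^ (n - 1) \<partial>lborel) - (b + 0 * D) * (\<integral>x. \<psi> (g x) \<partial>lborel) \<le> (\<integral>x. \<psi> (g x) * w x \<partial>lborel)"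
    using integral_ge_limit[of w lborel "\<lambda>k x. \<psi> (G k x)" "\<lambda>x. \<psi> (g x)" ?q c, OF _ _ _ _ _ psilim intq' intw' ck clim]
      psi(2) psiq by auto
  show "integrable lborel (\<lambda>x. \<psi> (g x) * w x)" by (rule *(1))
  show "n * ?\<beta> * (\<integral>t. \<psi> t * ru t ^ (n - 1) \<partial>lborel) \<le> (\<integral>x. \<psi> (g x) * w x \<partial>lborel) + b * (\<integral>x. \<psi> (g x) \<partial>lborel)"
    using *(2) by simp
qed

lemma cutoff_integrable:
  assumes psi: "continuous_on UNIV \<psi>" "\<And>t. \<psi> t \<ge> 0" "\<And>t::real. t \<ge> R \<Longrightarrow> \<psi> t = (0::real)" and R: "R > 0"
  shows "integrable lborel (\<lambda>x. \<psi> (g x) * w x)" "integrable lborel (\<lambda>x. \<psi> (g x))"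
proof -
  \<comment> \<open>The integrability half of the level inequality, for the compact set
    \<open>{0}\<close>, which lies in the sublevel set of height \<open>V 0\<close>.\<close>
  show "integrable lborel (\<lambda>x. \<psi> (g x) * w x)"
    using level_inequality_compact(1)[OF psi R, of "{0}" "V 0"] by simp
  obtain C where C: "C \<ge> 0" "\<And>t. t \<ge> 0 \<Longrightarrow> \<psi> t \<le> C" "\<And>x t. g x \<le> t \<Longrightarrow> \<psi> t \<le> C * R ^ n * (1 / g x ^ n)"
    using cutoff_bound[OF psi R] by metis
  have [measurable]: "\<psi> \<in> borel_measurable borel" using psi(1) by (rule borel_measurable_continuous_onI)
  show "integrable lborel (\<lambda>x. \<psi> (g x))"
  proof (rule Bochner_Integration.integrable_bound)
    show "integrable lborel (\<lambda>x. C * R ^ n * (1 / g x ^ n))" using intg by (rule integrable_mult_right)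
    show "AE x in lborel. norm (\<psi> (g x)) \<le> norm (C * R ^ n * (1 / g x ^ n))"
    proof (rule AE_I2)
      fix x
      show "norm (\<psi> (g x)) \<le> norm (C * R ^ n * (1 / g x ^ n))"
        using C(3)[OF order.refl, of x] psi(2)[of "g x"] unfolding real_norm_def by linarith
    qed
  qed simp
qed

text \<open>Inner regularity: compact subsets exhaust the volume of the sublevel set of
  \<open>V\<close>. The point \<open>y0\<close> is added to each of them so that none is empty, even
  if the sublevel set is null.\<close>

lemma level_inequality:
  assumes psi: "continuous_on UNIV \<psi>" "\<And>t. \<psi> t \<ge> 0" "\<And>t::real. t \<ge> R \<Longrightarrow> \<psi> t = (0::real)" and R: "R > 0"
    and b: "V y0 < b"
  shows "n * rv b * (\<integral>t. \<psi> t * ru t ^ (n - 1) \<partial>lborel) \<le> (\<integral>x. \<psi> (g x) * w x \<partial>lborel) + b * (\<integral>x. \<psi> (g x) \<partial>lborel)"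
    (is "n * rv b * ?I \<le> ?c")
proof -
  have I0: "?I \<ge> 0" using psi(2) ru_nonneg by (auto intro!: integral_nonneg)
  have main: "n * root n (measure lborel B) * ?I \<le> ?c" if "compact B" "B \<noteq> {}" "B \<subseteq> {y. V y < b}" for B
    by (rule level_inequality_compact(2)[OF psi R that(1,2)]) (use that(3) in auto)
  have "\<exists>B. compact B \<and> B \<noteq> {} \<and> B \<subseteq> {y. V y < b} \<and> v b - e \<le> measure lborel B" if e: "e > 0" for e
  proof -
    have "{y. V y < b} \<in> sets lebesgue" using fm_V by (rule fmeasurableD)
    then obtain T where T: "closed T" "T \<subseteq> {y. V y < b}" "{y. V y < b} - T \<in> lmeasurable"
        "emeasure lebesgue ({y. V y < b} - T) < ennreal (e/2)"
      using sets_lebesgue_inner_closed[of "{y. V y < b}" "e/2"] e by auto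
    have Tf: "T \<in> lmeasurable"
      using T by (intro fmeasurableI2[OF fm_V[of b]]) auto
    have "v b - measure lebesgue T = measure lebesgue ({y. V y < b} - T)"
      unfolding v_def using T(2) Tf fm_V by (subst measurable_measure_Diff) auto
    also have "\<dots> \<le> e/2"
      using T(3,4) e by (metis emeasure_eq_measure2 ennreal_leI ennreal_less_iff less_imp_le measure_nonneg)
    finally have vT: "v b \<le> measure lebesgue T + e/2" by simp
    have "(\<lambda>k. measure lebesgue (T \<inter> cball 0 (real k))) \<longlonglongrightarrow> measure lebesgue (\<Union>k. T \<inter> cball 0 (real k))"
    proof (rule Lim_measure_incseq)
      show "incseq (\<lambda>k. T \<inter> cball 0 (real k))" by (auto intro!: incseq_SucI)
      have "emeasure lebesgue (\<Union>k. T \<inter> cball 0 (real k)) \<le> emeasure lebesgue T"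
        using Tf by (intro emeasure_mono) (auto dest: fmeasurableD)
      also have "\<dots> < \<infinity>" using Tf by (auto simp: fmeasurable_def)
      finally show "emeasure lebesgue (\<Union>k. T \<inter> cball 0 (real k)) \<noteq> \<infinity>" by simp
    qed (use T(1) in auto)
    also have "(\<Union>k. T \<inter> cball 0 (real k)) = T"
      by (auto simp: real_arch_simple)
    finally have "\<forall>\<^sub>F k in sequentially. measure lebesgue T - e/2 < measure lebesgue (T \<inter> cball 0 (real k))"
      using e by (intro order_tendstoD) auto
    then obtain k where k: "measure lebesgue T - e/2 < measure lebesgue (T \<inter> cball 0 (real k))"
      by (auto simp: eventually_sequentially)
    let ?B = "insert y0 (T \<inter> cball 0 (real k))"
    have cB: "compact (T \<inter> cball 0 (real k))" using T(1) by (intro closed_Int_compact) auto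
    note cB = cB compact_insert[OF cB, of y0]
    have "measure lebesgue (T \<inter> cball 0 (real k)) \<le> measure lebesgue ?B"
      using lmeasurable_compact[OF cB(1)] lmeasurable_compact[OF cB(2)]
      by (intro measure_mono_fmeasurable) (auto dest: fmeasurableD)
    also have "measure lebesgue ?B = measure lborel ?B"
      using cB(2) by (simp add: measure_completion compact_imp_closed borel_closed)
    finally show ?thesis using cB(2) T(2) b vT k by (intro exI[of _ ?B]) auto
  qed
  then have "\<exists>B. compact B \<and> B \<noteq> {} \<and> B \<subseteq> {y. V y < b} \<and> v b - 1 / real (Suc k) \<le> measure lborel B" for k :: nat
    by simp
  then obtain B where B: "\<And>k::nat. compact (B k)" "\<And>k. B k \<noteq> {}" "\<And>k. B k \<subseteq> {y. V y < b}" "\<And>k. v b - 1 / real (Suc k) \<le> measure lborel (B k)"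
    by metis
  have lim: "(\<lambda>k. n * root n (v b - 1 / real (Suc k)) * ?I) \<longlonglongrightarrow> n * root n (v b - 0) * ?I"
    by (intro tendsto_intros LIMSEQ_Suc[OF lim_1_over_n])
  have "n * root n (v b - 1 / real (Suc k)) * ?I \<le> ?c" for k
  proof -
    have "n * root n (v b - 1 / real (Suc k)) * ?I \<le> n * root n (measure lborel (B k)) * ?I"
      using B(4)[of k] I0 by (intro mult_right_mono mult_left_mono) auto
    also have "\<dots> \<le> ?c" by (rule main[OF B(1-3)])
    finally show ?thesis .
  qed
  then have "n * root n (v b - 0) * ?I \<le> ?c" by (intro LIMSEQ_le_const2[OF lim]) auto
  then show ?thesis by (simp add: rv_def)
qed

text \<open>\<psi> is split by a partition of unity into pieces on which \<open>b\<close> varies by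
  at most 2 \<delta>, and the level inequality is applied to each piece with a constant level just
  above \<open>b\<close>. Monotonicity of \<open>rv\<close> handles the left side, and the excess of
  the levels costs 2 \<delta> times the integral of \<psi>(g). The last hypothesis on
  \<open>b\<close> makes the sublevel sets of \<open>V\<close> above each value of \<open>b\<close>
  nonempty.\<close>

lemma layered_inequality:
  assumes psi: "continuous_on UNIV \<psi>" "\<And>t. \<psi> t \<ge> 0" "\<And>t::real. t \<ge> R \<Longrightarrow> \<psi> t = (0::real)" and R: "R > 0"
    and b: "continuous_on UNIV b" "\<And>t. b t \<ge> 0" "\<And>t c. b t < c \<Longrightarrow> \<exists>y. V y < c"
  shows "n * (\<integral>t. \<psi> t * (rv (b t) * ru t ^ (n - 1)) \<partial>lborel)
    \<le> (\<integral>x. \<psi> (g x) * w x \<partial>lborel) + (\<integral>x. \<psi> (g x) * b (g x) \<partial>lborel)"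
    (is "_ * ?L \<le> ?W + ?B")
proof -
  let ?P = "\<integral>x. \<psi> (g x) \<partial>lborel"
  have [measurable]: "b \<in> borel_measurable borel" "\<psi> \<in> borel_measurable borel"
    using b(1) psi(1) by (auto intro: borel_measurable_continuous_onI)
  have "bounded (b ` {0..R})"
    by (intro compact_imp_bounded compact_continuous_image continuous_on_subset[OF b(1)]) auto
  then obtain K where "\<forall>t\<in>{0..R}. \<bar>b t\<bar> \<le> K" by (auto simp: bounded_iff)
  note K' = bspec[OF this]
  have K: "b t \<le> K" if "t \<ge> 0" "t \<le> R" for t using K'[of t] that by auto
  have psib: "continuous_on UNIV (\<lambda>t. \<psi> t * b t)" "\<And>t. 0 \<le> \<psi> t * b t" "\<And>t. t \<ge> R \<Longrightarrow> \<psi> t * b t = 0"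
    using psi b by (auto intro!: continuous_intros)
  note intpsi = cutoff_integrable[OF psi R] and intpsib = cutoff_integrable(2)[OF psib R]
  have main: "n * ?L \<le> ?W + ?B + 2 * \<delta> * ?P" if \<delta>: "\<delta> > 0" for \<delta>
  proof -
    \<comment> \<open>A ramp from 0 to 1. The differences \<theta> of its translates are tents in
      the variable b/\<delta>, supported in (i - 1, i + 1), and their sum telescopes to 1 up to
      \<open>N\<close>; the level \<open>c i\<close> is the right end of the support.\<close>
    define cl where "cl x = max 0 (min 1 x)" for x :: real
    define \<theta> where "\<theta> i t = cl (b t / \<delta> - real i + 1) - cl (b t / \<delta> - real (Suc i) + 1)" for i t
    define c where "c i = (real i + 1) * \<delta>" for i
    define \<psi>' where "\<psi>' i t = \<psi> t * \<theta> i t" for i t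
    obtain N :: nat where N: "K / \<delta> \<le> N" using real_arch_simple by blast
    have th0: "\<theta> i t \<ge> 0" for i t by (auto simp: \<theta>_def cl_def)
    have th_le: "b t < c i" "c i < b t + 2 * \<delta>" if "\<theta> i t \<noteq> 0" for i t
    proof -
      have "b t / \<delta> < real i + 1" using that by (auto simp: \<theta>_def cl_def min_def max_def split: if_splits)
      then show "b t < c i" using \<delta> by (simp add: c_def field_simps)
      have "real i - 1 < b t / \<delta>" using that by (auto simp: \<theta>_def cl_def min_def max_def split: if_splits)
      then show "c i < b t + 2 * \<delta>" using \<delta> by (simp add: c_def field_simps)
    qed
    have th_sum: "(\<Sum>i<Suc N. \<theta> i t) = 1" if "t \<ge> 0" "t \<le> R" for t
    proof -
      have "(\<Sum>i<Suc N. \<theta> i t) = cl (b t / \<delta> - real 0 + 1) - cl (b t / \<delta> - real (Suc N) + 1)"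
        unfolding \<theta>_def by (rule sum_lessThan_telescope')
      moreover have "b t / \<delta> \<le> N" using K[OF that] N \<delta> by (meson divide_right_mono less_imp_le order.trans)
      moreover have "0 \<le> b t / \<delta>" using b(2)[of t] \<delta> by simp
      ultimately show ?thesis by (simp add: cl_def)
    qed
    have psi_sum: "(\<Sum>i<Suc N. \<psi>' i t) = \<psi> t" if "t \<ge> 0" for t
    proof (cases "t \<le> R")
      case True
      then show ?thesis using th_sum[OF that True] by (simp only: \<psi>'_def sum_distrib_left[symmetric] mult_1_right)
    qed (simp add: \<psi>'_def psi(3))
    have psi': "continuous_on UNIV (\<psi>' i)" "\<And>t. \<psi>' i t \<ge> 0" "\<And>t. t \<ge> R \<Longrightarrow> \<psi>' i t = 0" for i
      using psi th0 \<delta> unfolding \<psi>'_def \<theta>_def cl_def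
      by (auto intro!: continuous_intros b(1) mult_nonneg_nonneg)
    note int' = cutoff_integrable[OF psi' R]
    have int_ru': "integrable lborel (\<lambda>t. \<psi>' i t * ru t ^ (n - 1))" for i
      by (rule cutoff_times_integrable[OF psi' R, where c = "ru R ^ (n - 1)"])
        (auto simp: ru_nonneg ru_mono intro!: power_mono ru_pow_nonpos[simplified])
    have lev: "n * rv (c i) * (\<integral>t. \<psi>' i t * ru t ^ (n - 1) \<partial>lborel)
        \<le> (\<integral>x. \<psi>' i (g x) * w x \<partial>lborel) + c i * (\<integral>x. \<psi>' i (g x) \<partial>lborel)" for i
    \<comment> \<open>A piece that vanishes identically contributes zero to both sides; its level
      may lie below all values of \<open>V\<close>.\<close>
    proof (cases "\<exists>t. \<psi>' i t \<noteq> 0")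
      case True
      then obtain t where "\<theta> i t \<noteq> 0" by (auto simp: \<psi>'_def)
      then obtain y where "V y < c i" using th_le b(3) by blast
      then show ?thesis by (intro level_inequality[OF psi' R])
    qed simp
    have "n * ?L \<le> n * (\<integral>t. (\<Sum>i<Suc N. rv (c i) * (\<psi>' i t * ru t ^ (n - 1))) \<partial>lborel)"
    proof (intro mult_left_mono integral_mono)
      show "integrable lborel (\<lambda>t. \<Sum>i<Suc N. rv (c i) * (\<psi>' i t * ru t ^ (n - 1)))"
        by (intro Bochner_Integration.integrable_sum integrable_mult_right int_ru')
      show "integrable lborel (\<lambda>t. \<psi> t * (rv (b t) * ru t ^ (n - 1)))"
      proof (rule cutoff_times_integrable[OF psi R, where c = "rv (max 0 K) * ru R ^ (n - 1)"])
        show "rv (b t) * ru t ^ (n - 1) \<le> rv (max 0 K) * ru R ^ (n - 1)" if "t \<le> R" for t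
        proof (cases "t \<ge> 0")
          case True
          then have "b t \<le> max 0 K" using K[of t] that by auto
          then show ?thesis using that by (intro mult_mono power_mono rv_mono ru_mono) (auto simp: ru_nonneg rv_nonneg)
        next
          case False
          then have z: "ru t ^ (n - 1) = 0" by (intro ru_pow_nonpos) simp
          show ?thesis unfolding z by (simp add: ru_nonneg rv_nonneg)
        qed
        show "rv (b t) * ru t ^ (n - 1) = 0" if "t \<le> 0" for t
          unfolding ru_pow_nonpos[OF that] by simp
      qed (auto simp: ru_nonneg rv_nonneg)
      fix t
      show "\<psi> t * (rv (b t) * ru t ^ (n - 1)) \<le> (\<Sum>i<Suc N. rv (c i) * (\<psi>' i t * ru t ^ (n - 1)))"
      proof (cases "t \<ge> 0")
        case True
        have "\<psi> t * (rv (b t) * ru t ^ (n - 1)) = (\<Sum>i<Suc N. rv (b t) * (\<psi>' i t * ru t ^ (n - 1)))"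
          unfolding psi_sum[OF True, symmetric] sum_distrib_right by (intro sum.cong) (auto simp: algebra_simps)
        also have "\<dots> \<le> (\<Sum>i<Suc N. rv (c i) * (\<psi>' i t * ru t ^ (n - 1)))"
        proof (rule sum_mono)
          fix i
          show "rv (b t) * (\<psi>' i t * ru t ^ (n - 1)) \<le> rv (c i) * (\<psi>' i t * ru t ^ (n - 1))"
          proof (cases "\<theta> i t = 0")
            case False
            then show ?thesis using th_le(1)[OF False] psi'(2)[of i t]
              by (intro mult_right_mono rv_mono) (auto simp: ru_nonneg)
          qed (simp add: \<psi>'_def)
        qed
        finally show ?thesis .
      next
        case False
        then have z: "ru t ^ (n - 1) = 0" by (intro ru_pow_nonpos) simp
        show ?thesis unfolding z by simp
      qed
    qed simp
    also have "\<dots> = (\<Sum>i<Suc N. n * rv (c i) * (\<integral>t. \<psi>' i t * ru t ^ (n - 1) \<partial>lborel))"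
      using int_ru' by (subst Bochner_Integration.integral_sum) (auto simp: sum_distrib_left mult.assoc simp del: sum.lessThan_Suc)
    also have "\<dots> \<le> (\<Sum>i<Suc N. (\<integral>x. \<psi>' i (g x) * w x \<partial>lborel) + c i * (\<integral>x. \<psi>' i (g x) \<partial>lborel))"
      by (intro sum_mono lev)
    also have "\<dots> = (\<integral>x. (\<Sum>i<Suc N. \<psi>' i (g x) * w x) \<partial>lborel) + (\<integral>x. (\<Sum>i<Suc N. c i * \<psi>' i (g x)) \<partial>lborel)"
      using int' by (simp add: sum.distrib del: sum.lessThan_Suc)
    also have "(\<integral>x. (\<Sum>i<Suc N. \<psi>' i (g x) * w x) \<partial>lborel) = ?W"
      using psi_sum[OF less_imp_le[OF gpos]] by (simp only: sum_distrib_right[symmetric])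
    also have "(\<integral>x. (\<Sum>i<Suc N. c i * \<psi>' i (g x)) \<partial>lborel) \<le> (\<integral>x. \<psi> (g x) * b (g x) + 2 * \<delta> * \<psi> (g x) \<partial>lborel)"
    proof (rule integral_mono)
      fix x
      have "(\<Sum>i<Suc N. c i * \<psi>' i (g x)) \<le> (\<Sum>i<Suc N. (b (g x) + 2 * \<delta>) * \<psi>' i (g x))"
      proof (rule sum_mono)
        fix i
        show "c i * \<psi>' i (g x) \<le> (b (g x) + 2 * \<delta>) * \<psi>' i (g x)"
        proof (cases "\<theta> i (g x) = 0")
          case False
          then show ?thesis using th_le(2)[OF False] psi'(2)[of i "g x"] by (intro mult_right_mono) auto
        qed (simp add: \<psi>'_def)
      qed
      also have "\<dots> = \<psi> (g x) * b (g x) + 2 * \<delta> * \<psi> (g x)"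
        unfolding sum_distrib_left[symmetric] psi_sum[OF less_imp_le[OF gpos]] by (simp add: algebra_simps)
      finally show "(\<Sum>i<Suc N. c i * \<psi>' i (g x)) \<le> \<psi> (g x) * b (g x) + 2 * \<delta> * \<psi> (g x)" .
    qed (use int' intpsi intpsib in \<open>auto simp del: sum.lessThan_Suc\<close>)
    also have "\<dots> = ?B + 2 * \<delta> * ?P" using intpsi intpsib by simp
    finally show ?thesis by simp
  qed
  have P0: "?P \<ge> 0" using psi(2) by (auto intro!: integral_nonneg)
  have "n * ?L \<le> ?W + ?B + e" if "e > 0" for e
  proof -
    have "n * ?L \<le> ?W + ?B + 2 * (e / (2 * (?P + 1))) * ?P"
      using that P0 by (intro main) simp
    also have "2 * (e / (2 * (?P + 1))) * ?P = e * (?P / (?P + 1))" using P0 by (simp add: field_simps)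
    also have "\<dots> \<le> e * 1" using that P0 by (intro mult_left_mono) (auto simp: divide_simps)
    finally show ?thesis by simp
  qed
  then show ?thesis by (rule field_le_epsilon)
qed

end

section \<open>Monotone transport of volume profiles\<close>

text \<open>\<open>U\<close> stands for the sublevel volumes of a positive function h. Writing
  h^(-n) as the integral of n t^(-n-1) over t > h turns the integral of h^(-n) into the mass in
  \<open>total\<close>, so the normalization of the theorem produces a probability measure on the
  line.\<close>

locale profile =
  fixes U :: "real \<Rightarrow> real" and n :: nat
  assumes mono_U: "mono U" and U_nonneg: "\<And>t. 0 \<le> U t" and U_nonpos: "\<And>t. t \<le> 0 \<Longrightarrow> U t = 0"
    and n_pos: "0 < n"
    and total: "(\<integral>\<^sup>+t. ennreal (if 0 < t then real n * U t / t ^ (n + 1) else 0) \<partial>lborel) = 1"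
begin

definition dens :: "real \<Rightarrow> real" where "dens t = (if 0 < t then real n * U t / t ^ (n + 1) else 0)"
definition M :: "real measure" where "M = density lborel (\<lambda>t. ennreal (dens t))"
definition F :: "real \<Rightarrow> real" where "F = cdf M"
text \<open>The left end of the support. Since \<open>U\<close> is monotone, the density is positive
  everywhere to the right of \<open>m\<close>, so the distribution function is injective
  there.\<close>

definition m :: real where "m = Inf {t. 0 < U t}"

lemma meas_U[measurable]: "U \<in> borel_measurable borel"
  using mono_U by (rule borel_measurable_mono)

lemma meas_dens[measurable]: "dens \<in> borel_measurable borel"
  unfolding dens_def by measurable

lemma dens_nonneg: "0 \<le> dens t"
  by (auto simp: dens_def U_nonneg)

lemma sets_M[measurable_cong]: "sets M = sets borel"
  by (simp add: M_def)

sublocale M: real_distribution M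
proof (intro real_distribution.intro real_distribution_axioms.intro prob_spaceI)
  show "emeasure M (space M) = 1"
    using total by (simp add: M_def emeasure_density dens_def)
  show "sets M = sets borel" by (simp add: M_def)
qed

lemma U_set: "{t. 0 < U t} \<noteq> {}" "bdd_below {t. 0 < U t}"
proof -
  show "{t. 0 < U t} \<noteq> {}"
  proof
    assume "{t. 0 < U t} = {}"
    then have "U t = 0" for t using U_nonneg[of t] by (metis empty_iff linorder_not_le mem_Collect_eq order_antisym)
    then have "(\<lambda>t. ennreal (if 0 < t then real n * U t / t ^ (n + 1) else 0)) = (\<lambda>_. 0)"
      by (simp add: fun_eq_iff)
    with total show False by simp
  qed
  show "bdd_below {t. 0 < U t}"
    by (rule bdd_belowI[of _ 0]) (metis U_nonpos linorder_le_cases mem_Collect_eq less_irrefl)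
qed

lemma m_nonneg: "0 \<le> m"
  unfolding m_def by (rule cInf_greatest[OF U_set(1)]) (metis U_nonpos linorder_le_cases mem_Collect_eq less_irrefl)

lemma U_pos: "m < t \<Longrightarrow> 0 < U t"
  unfolding m_def using cInf_less_iff[OF U_set] monoD[OF mono_U] by (metis less_imp_le less_le_trans mem_Collect_eq)

lemma U_zero: "t < m \<Longrightarrow> U t = 0"
  unfolding m_def using cInf_lower[OF _ U_set(2)] U_nonneg
  by (metis linorder_not_le mem_Collect_eq order_antisym)

lemma dens_pos: "m < t \<Longrightarrow> 0 < dens t"
  using U_pos m_nonneg n_pos by (auto simp: dens_def)

lemma dens_zero: "t < m \<Longrightarrow> dens t = 0"
  using U_zero by (auto simp: dens_def)

lemma emeasure_M: "A \<in> sets borel \<Longrightarrow> emeasure M A = (\<integral>\<^sup>+t. ennreal (dens t) * indicator A t \<partial>lborel)"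
  by (simp add: M_def emeasure_density)

lemma measure_M_pos:
  assumes "m \<le> a" "a < b"
  shows "0 < measure M {a<..<b}"
proof -
  have "emeasure M {a<..<b} \<noteq> 0"
  proof
    assume "emeasure M {a<..<b} = 0"
    then have "AE t in lborel. ennreal (dens t) * indicator {a<..<b} t = 0"
      by (subst (asm) emeasure_M) (auto simp: nn_integral_0_iff_AE)
    then have "AE t in lborel. t \<notin> {a<..<b}"
    proof eventually_elim
      case (elim t)
      then show ?case using dens_pos[of t] assms by (auto simp: indicator_def split: if_splits)
    qed
    then have "emeasure lborel {a<..<b} = 0"
      by (subst (asm) AE_iff_measurable[where N = "{a<..<b}"]) auto
    then show False using assms by simp
  qed
  then show ?thesis by (simp add: M.emeasure_eq_measure zero_less_measure_iff)
qed

lemma F_mono: "s \<le> t \<Longrightarrow> F s \<le> F t"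
  unfolding F_def by (rule M.cdf_nondecreasing)

lemma F_strict: "m \<le> s \<Longrightarrow> s < t \<Longrightarrow> F s < F t"
proof -
  assume st: "m \<le> s" "s < t"
  have "0 < measure M {s<..<t}" by (rule measure_M_pos[OF st])
  also have "\<dots> \<le> measure M {s<..t}" by (intro M.finite_measure_mono) auto
  also have "\<dots> = F t - F s" unfolding F_def using st by (subst M.cdf_diff_eq) auto
  finally show ?thesis by simp
qed

lemma F_cont: "isCont F t"
proof -
  have "emeasure M {t} = 0"
  proof -
    have "emeasure M {t} = (\<integral>\<^sup>+s. ennreal (dens t) * indicator {t} s \<partial>lborel)"
      by (subst emeasure_M) (auto intro!: nn_integral_cong simp: indicator_def)
    then show ?thesis by (simp add: nn_integral_cmult_indicator)
  qed
  then show ?thesis unfolding F_def by (simp add: M.isCont_cdf measure_def)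
qed

lemma F_m: "F m = 0"
proof -
  have "emeasure M {..m} = (\<integral>\<^sup>+t. ennreal (dens t) * indicator {..m} t \<partial>lborel)"
    by (rule emeasure_M) simp
  also have "\<dots> = (\<integral>\<^sup>+t. 0 \<partial>(lborel::real measure))"
    using AE_lborel_singleton[of m]
    by (intro nn_integral_cong_AE, eventually_elim) (auto simp: indicator_def dens_zero)
  finally show ?thesis by (simp add: F_def cdf_def measure_def)
qed

lemma F_nonneg: "0 \<le> F t"
  by (simp add: F_def M.cdf_nonneg)

lemma F_zero: "t \<le> m \<Longrightarrow> F t = 0"
  using F_mono[of t m] F_nonneg[of t] F_m by simp

text \<open>The density never vanishes again beyond \<open>m\<close>, so the mass is not exhausted
  at any finite point. This keeps the transport map real-valued on the whole line.\<close>

lemma F_less_1: "F t < 1"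
proof -
  have "F t \<le> F (max t m)" by (intro F_mono) simp
  also have "\<dots> < F (max t m + 1)" by (intro F_strict) auto
  also have "\<dots> \<le> 1" unfolding F_def by (rule M.cdf_bounded_prob)
  finally show ?thesis .
qed

lemma F_surj:
  assumes "0 \<le> c" "c < 1"
  shows "\<exists>t\<ge>m. F t = c"
proof -
  have "\<forall>\<^sub>F t in at_top. c < F t"
    unfolding F_def using M.cdf_lim_at_top_prob assms by (auto dest: order_tendstoD)
  then obtain T where T: "\<And>t. t \<ge> T \<Longrightarrow> c < F t" by (auto simp: eventually_at_top_linorder)
  have "\<exists>x\<ge>m. x \<le> max m T \<and> F x = c"
    using F_m assms T[of "max m T"] F_cont by (intro IVT) auto
  then show ?thesis by blast
qed

lemma F_inj: "m \<le> s \<Longrightarrow> m \<le> t \<Longrightarrow> F s = F t \<Longrightarrow> s = t"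
  using F_strict[of s t] F_strict[of t s] by (cases s t rule: linorder_cases) auto

lemma F_le_iff: "m \<le> t \<Longrightarrow> F s \<le> F t \<longleftrightarrow> s \<le> t"
  using F_strict[of t s] F_mono[of s t] by (auto simp: not_less[symmetric])

end

locale profile_pair = P: profile Up n + Q: profile Uq n for Up Uq n
begin

text \<open>The monotone rearrangement of one measure onto the other. The constraint
  \<open>Q.m \<le> s\<close> makes the value unique also where the distribution functions
  vanish.\<close>

definition b :: "real \<Rightarrow> real" where "b t = (SOME s. Q.m \<le> s \<and> Q.F s = P.F t)"

lemma b_spec: "Q.m \<le> b t" "Q.F (b t) = P.F t"
proof -
  have "\<exists>s. Q.m \<le> s \<and> Q.F s = P.F t"
    using Q.F_surj[OF P.F_nonneg P.F_less_1, of t] by auto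
  from someI_ex[OF this] show "Q.m \<le> b t" "Q.F (b t) = P.F t" by (simp_all add: b_def)
qed

lemma b_nonneg: "0 \<le> b t"
  using b_spec(1)[of t] Q.m_nonneg by linarith

lemma b_le_iff: "Q.m \<le> x \<Longrightarrow> b t \<le> x \<longleftrightarrow> P.F t \<le> Q.F x"
  using Q.F_le_iff[of x "b t"] b_spec by simp

lemma mono_b: "mono b"
  by (rule monoI) (use b_le_iff b_spec P.F_mono in metis)

lemma b_meas[measurable]: "b \<in> borel_measurable borel"
  using mono_b by (rule borel_measurable_mono)

lemma b_low: "t \<le> P.m \<Longrightarrow> b t = Q.m"
  using b_spec[of t] P.F_zero[of t] Q.F_m Q.F_inj[of "b t" Q.m] by auto

lemma b_le_b_iff: "P.m \<le> t \<Longrightarrow> b s \<le> b t \<longleftrightarrow> s \<le> t"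
  using b_le_iff[OF b_spec(1), of s t] b_spec(2) P.F_le_iff by simp

lemma b_strict: "P.m < t \<Longrightarrow> Q.m < b t"
  using b_le_b_iff[of P.m t] b_low[of P.m] by (auto simp: not_le[symmetric])

lemma distr_b: "distr P.M borel b = Q.M"
proof (rule cdf_unique)
  show "real_distribution (distr P.M borel b)" by (rule P.M.real_distribution_distr) measurable
  show "real_distribution Q.M" by (rule Q.M.real_distribution_axioms)
  show "cdf (distr P.M borel b) = cdf Q.M"
  proof
    fix x
    have eq: "cdf (distr P.M borel b) x = measure P.M {t. b t \<le> x}"
      unfolding cdf_def by (subst measure_distr) (auto simp: vimage_def)
    show "cdf (distr P.M borel b) x = cdf Q.M x"
    proof (cases "Q.m \<le> x")
      case True
      obtain T where T: "P.m \<le> T" "P.F T = Q.F x"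
        using P.F_surj[OF Q.F_nonneg Q.F_less_1, of x] by auto
      have "{t. b t \<le> x} = {..T}"
        using b_le_iff[OF True] P.F_le_iff[OF T(1)] by (auto simp: T(2)[symmetric])
      then show ?thesis unfolding eq using T(2) by (simp add: P.F_def Q.F_def cdf_def)
    next
      case False
      then have "{t. b t \<le> x} = {}" using b_spec(1) by (auto simp: not_le intro: less_le_trans)
      moreover have "Q.F x = 0" using False by (intro Q.F_zero) simp
      ultimately show ?thesis unfolding eq by (simp add: Q.F_def)
    qed
  qed
qed

lemma transport:
  assumes [measurable]: "h \<in> borel_measurable borel"
  shows "(\<integral>\<^sup>+t. ennreal (P.dens t) * h (b t) \<partial>lborel) = (\<integral>\<^sup>+s. ennreal (Q.dens s) * h s \<partial>lborel)"
proof -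
  have "(\<integral>\<^sup>+s. ennreal (Q.dens s) * h s \<partial>lborel) = (\<integral>\<^sup>+s. h s \<partial>Q.M)"
    unfolding Q.M_def by (subst nn_integral_density) auto
  also have "\<dots> = (\<integral>\<^sup>+t. h (b t) \<partial>P.M)"
    unfolding distr_b[symmetric] by (subst nn_integral_distr) auto
  also have "\<dots> = (\<integral>\<^sup>+t. ennreal (P.dens t) * h (b t) \<partial>lborel)"
    unfolding P.M_def by (subst nn_integral_density) auto
  finally show ?thesis by simp
qed

lemma b_cont: "continuous_on UNIV b"
proof -
  \<comment> \<open>To the left of \<open>P.m\<close> the map \<open>b\<close> is constant.
    Replacing that piece by a line of slope one gives a monotone surjection of the real line, hence
    a continuous map, from which \<open>b\<close> is recovered by truncation at
    \<open>Q.m\<close>.\<close>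
  define b' where "b' t = (if P.m \<le> t then b t else t - P.m + Q.m)" for t
  have "continuous_on UNIV b'"
  proof (rule continuous_onI_mono)
    have "range b' = UNIV"
    proof (intro set_eqI iffI)
      fix s show "s \<in> range b'"
      proof (cases "Q.m \<le> s")
        case True
        obtain T where T: "P.m \<le> T" "P.F T = Q.F s"
          using P.F_surj[OF Q.F_nonneg Q.F_less_1, of s] by auto
        have "b T = s" by (rule Q.F_inj[OF b_spec(1) True]) (metis b_spec(2) T(2))
        then have "b' T = s" using T by (simp add: b'_def)
        then show ?thesis by blast
      next
        case False
        then have "b' (s - Q.m + P.m) = s" by (simp add: b'_def)
        then show ?thesis by (metis rangeI)
      qed
    qed simp
    then show "open (range b')" by simp
    fix x y :: real assume "x \<le> y"
    then show "b' x \<le> b' y" using monoD[OF mono_b, of x y] b_spec(1)[of y] by (auto simp: b'_def)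
  qed
  then have "continuous_on UNIV (\<lambda>t. max Q.m (b' t))" by (intro continuous_intros)
  also have "(\<lambda>t. max Q.m (b' t)) = b"
  proof
    fix t show "max Q.m (b' t) = b t"
      using b_spec(1)[of t] b_low[of t] by (auto simp: b'_def)
  qed
  finally show ?thesis .
qed

text \<open>The derivative of \<open>b\<close>, used only through the integral identity below, so that \<open>b\<close> need not be
  shown to be differentiable.\<close>

definition db :: "real \<Rightarrow> real" where "db t = P.dens t / Q.dens (b t)"

lemma db_nonneg: "0 \<le> db t"
  by (simp add: db_def P.dens_nonneg Q.dens_nonneg)

lemma db_meas[measurable]: "db \<in> borel_measurable borel"
  unfolding db_def by measurable

text \<open>\<open>db\<close> is the source density times \<open>1 / Q.dens\<close> evaluated at
  \<open>b t\<close>. Transporting it to the target cancels the target density and leaves the length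
  of the interval from \<open>Q.m\<close> to \<open>b T\<close>; the end points, where densities may
  vanish, are null.\<close>

lemma b_eq_integral: "ennreal (b T) = ennreal Q.m + (\<integral>\<^sup>+t. ennreal (db t) * indicator {..T} t \<partial>lborel)"
proof -
  have "(\<integral>\<^sup>+t. ennreal (db t) * indicator {..T} t \<partial>lborel)
    = (\<integral>\<^sup>+t. ennreal (P.dens t) * (ennreal (1 / Q.dens (b t)) * indicator {..b T} (b t)) \<partial>lborel)"
    using AE_lborel_singleton[of P.m]
  proof (intro nn_integral_cong_AE, eventually_elim)
    case (elim t)
    show ?case
    proof (cases "t < P.m")
      case True
      then show ?thesis by (simp add: db_def P.dens_zero)
    next
      case False
      with elim have t: "P.m < t" by simp
      have "b t \<le> b T \<longleftrightarrow> t \<le> T"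
      proof (cases "P.m \<le> T")
        case True
        then show ?thesis by (rule b_le_b_iff)
      next
        case False
        then show ?thesis using b_low[of T] b_strict[OF t] t by auto
      qed
      moreover have "ennreal (db t) = ennreal (P.dens t) * ennreal (1 / Q.dens (b t))"
        by (simp add: db_def ennreal_mult[symmetric] P.dens_nonneg Q.dens_nonneg)
      ultimately show ?thesis by (simp add: indicator_def mult.assoc)
    qed
  qed
  also have "\<dots> = (\<integral>\<^sup>+s. ennreal (Q.dens s) * (ennreal (1 / Q.dens s) * indicator {..b T} s) \<partial>lborel)"
    by (rule transport) measurable
  also have "\<dots> = (\<integral>\<^sup>+s. indicator {Q.m..b T} s \<partial>lborel)"
    using AE_lborel_singleton[of Q.m]
  proof (intro nn_integral_cong_AE, eventually_elim)
    case (elim s)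
    show ?case
    proof (cases "s < Q.m")
      case True
      then show ?thesis by (simp add: Q.dens_zero)
    next
      case False
      with elim have "Q.m < s" by simp
      then show ?thesis using Q.dens_pos[of s]
        by (auto simp: indicator_def mult.assoc[symmetric] ennreal_mult[symmetric] less_imp_le)
    qed
  qed
  also have "\<dots> = ennreal (b T - Q.m)" using b_spec(1)[of T] by simp
  finally show ?thesis using b_spec(1)[of T] Q.m_nonneg by (simp add: ennreal_plus[symmetric] del: ennreal_plus)
qed

end

section \<open>The duality inequality\<close>

lemma sigma_finite_lebesgue: "sigma_finite_measure (lebesgue :: 'a::euclidean_space measure)"
proof
  let ?A = "range (\<lambda>k::nat. cball (0::'a) (real k))"
  have "\<Union>?A = UNIV" by (auto simp: real_arch_simple)
  moreover have "emeasure lebesgue a \<noteq> \<infinity>" if a: "a \<in> ?A" for a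
  proof -
    obtain k where "a = cball 0 (real k)" using a by auto
    then show ?thesis using emeasure_lborel_cball_finite[of "0::'a" "real k"] by simp
  qed
  ultimately show "\<exists>A::'a set set. countable A \<and> A \<subseteq> sets lebesgue \<and> \<Union>A = space lebesgue \<and> (\<forall>a\<in>A. emeasure lebesgue a \<noteq> \<infinity>)"
    by (intro exI[of _ ?A]) auto
qed

lemma nn_integral_inverse_power_tail:
  fixes s :: real
  assumes s: "s > 0" and k: "k > 0"
  shows "(\<integral>\<^sup>+t. ennreal (if 0 < t then real k / t ^ (k + 1) else 0) * indicator {s<..} t \<partial>lborel) = ennreal (1 / s ^ k)"
proof -
  have "(\<integral>\<^sup>+t. ennreal (if 0 < t then real k / t ^ (k + 1) else 0) * indicator {s<..} t \<partial>lborel)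
    = (\<integral>\<^sup>+t. ennreal (if 0 < t then real k / t ^ (k + 1) else 0) * indicator {s..} t \<partial>lborel)"
    using AE_lborel_singleton[of s] by (intro nn_integral_cong_AE) (auto elim!: eventually_mono simp: indicator_def)
  also have "\<dots> = ennreal (0 - (- 1 / s ^ k))"
  proof (rule nn_integral_FTC_atLeast[where F = "\<lambda>x. - 1 / x ^ k"])
    fix x assume x: "s \<le> x"
    have "((\<lambda>x. - 1 / x ^ k) has_real_derivative real k * x ^ (k - 1) / (x ^ k * x ^ k)) (at x)"
      using s x by (auto intro!: derivative_eq_intros)
    also have "real k * x ^ (k - 1) / (x ^ k * x ^ k) = real k / x ^ (k + 1)"
    proof -
      have "x ^ k = x * x ^ (k - 1)" using k by (metis power_eq_if not_gr_zero)
      then show ?thesis using s x by (simp add: divide_simps)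
    qed
    finally show "((\<lambda>x. - 1 / x ^ k) has_real_derivative (if 0 < x then real k / x ^ (k + 1) else 0)) (at x)"
      using s x by simp
  next
    show "((\<lambda>x::real. - 1 / x ^ k) \<longlongrightarrow> 0) at_top"
      using k by (intro real_tendsto_divide_at_top[OF tendsto_const] filterlim_pow_at_top filterlim_ident)
  qed (use s in auto)
  finally show ?thesis by simp
qed

text \<open>Layer-cake formula for the tail integral of k t^(-k-1). It is used with exponent
  \<open>n\<close> for the two normalizations and with exponent \<open>n - 1\<close> for the
  right-hand side of the theorem.\<close>

lemma nn_integral_sublevel_profile:
  fixes h :: "'a \<Rightarrow> real"
  assumes M: "sigma_finite_measure M" and h[measurable]: "h \<in> borel_measurable M" and pos: "\<And>x. h x > 0"
    and k: "k > 0" "integrable M (\<lambda>x. 1 / h x ^ k)"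
  shows "(\<integral>\<^sup>+t. ennreal (if 0 < t then real k * measure M {x \<in> space M. h x < t} / t ^ (k + 1) else 0) \<partial>lborel)
    = ennreal (\<integral>x. 1 / h x ^ k \<partial>M)"
proof -
  let ?d = "\<lambda>t. ennreal (if 0 < t then real k / t ^ (k + 1) else 0)"
  have "ennreal (\<integral>x. 1 / h x ^ k \<partial>M) = (\<integral>\<^sup>+x. ennreal (1 / h x ^ k) \<partial>M)"
    using pos by (subst nn_integral_eq_integral[OF k(2)]) (auto simp: less_imp_le)
  also have "\<dots> = (\<integral>\<^sup>+x. (\<integral>\<^sup>+t. ?d t * indicator {h x<..} t \<partial>lborel) \<partial>M)"
    by (simp only: nn_integral_inverse_power_tail[OF pos k(1)])
  also have "\<dots> = (\<integral>\<^sup>+t. ?d t * emeasure M {x \<in> space M. h x < t} \<partial>lborel)"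
    by (rule layer_cake[OF M h]) measurable
  also have "\<dots> = (\<integral>\<^sup>+t. ennreal (if 0 < t then real k * measure M {x \<in> space M. h x < t} / t ^ (k + 1) else 0) \<partial>lborel)"
    using sublevel_fmeasurable[OF h pos k(2)]
    by (intro nn_integral_cong) (auto simp: emeasure_eq_measure2 ennreal_mult[symmetric])
  finally show ?thesis by simp
qed

text \<open>With \<lambda> = b/t and z = r/s this is the scalar inequality multiplied by
  \<open>s ^ n\<close>; it is Bernoulli's inequality for x = \<lambda>/z, with equality at x = 1.
  The last term is written so that it becomes \<open>db t * u t\<close> for the volume
  radii.\<close>

lemma weighted_Bernoulli:
  fixes r s t b :: real
  assumes "r > 0" "s > 0" "t > 0" "b > 0" "n > 0"
  shows "(real n + 1) * (b * s ^ n / t) \<le> real n * (r * s ^ (n - 1)) + s ^ n / t ^ (n + 1) * (b ^ (n + 1) / r ^ n) * s ^ n"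
proof -
  define x where "x = b * s / (t * r)"
  have x: "x > 0" using assms by (simp add: x_def)
  have sn: "s ^ n = s * s ^ (n - 1)" using assms(5) by (metis power_eq_if not_gr_zero)
  have "1 + real (n + 1) * (x - 1) \<le> (1 + (x - 1)) ^ (n + 1)"
    using x by (intro Bernoulli_inequality) auto
  then have "(real n + 1) * x \<le> real n + x ^ (n + 1)" by (simp add: algebra_simps)
  then have "(r * s ^ (n - 1)) * ((real n + 1) * x) \<le> (r * s ^ (n - 1)) * (real n + x ^ (n + 1))"
    using assms by (intro mult_left_mono) auto
  also have "(r * s ^ (n - 1)) * ((real n + 1) * x) = (real n + 1) * (b * s ^ n / t)"
    using assms by (simp add: x_def sn field_simps)
  also have "(r * s ^ (n - 1)) * (real n + x ^ (n + 1)) = real n * (r * s ^ (n - 1)) + (r * s ^ (n - 1)) * x ^ (n + 1)"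
    by (simp add: algebra_simps)
  also have "(r * s ^ (n - 1)) * x ^ (n + 1) = s ^ n / t ^ (n + 1) * (b ^ (n + 1) / r ^ n) * s ^ n"
  proof -
    have "x ^ (n + 1) = (b ^ (n + 1) * (s * s ^ n)) / (t ^ (n + 1) * (r * r ^ n))"
      by (simp add: x_def power_divide power_mult_distrib mult_ac)
    then have "(r * s ^ (n - 1)) * x ^ (n + 1) = s ^ (n - 1) * (b ^ (n + 1) * (s * s ^ n)) / (t ^ (n + 1) * r ^ n)"
      using assms(1) by simp
    also have "\<dots> = (s * s ^ (n - 1)) / t ^ (n + 1) * (b ^ (n + 1) / r ^ n) * s ^ n"
      by simp
    finally show ?thesis by (simp only: sn[symmetric])
  qed
  finally show ?thesis .
qed

locale normalized_duality = legendre_duality +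
  assumes int1: "(\<integral>x. 1 / g x ^ n \<partial>lborel) = 1" "(\<integral>y. 1 / V y ^ n \<partial>lebesgue) = 1"
    and intV': "integrable lebesgue (\<lambda>y. 1 / V y ^ (n - 1))"
begin

lemma emeasure_u: "emeasure lborel {x. g x < t} = ennreal (u t)"
  using fm_g by (simp add: u_def emeasure_eq_measure2)

sublocale profile_pair u v n
proof -
  have U: "(\<integral>\<^sup>+t. ennreal (if 0 < t then real n * u t / t ^ (n + 1) else 0) \<partial>lborel) = 1"
    using nn_integral_sublevel_profile[of lborel g n] gpos intg
    by (simp add: u_def int1 lborel.sigma_finite_measure_axioms cong: if_cong)
  have V: "(\<integral>\<^sup>+t. ennreal (if 0 < t then real n * v t / t ^ (n + 1) else 0) \<partial>lborel) = 1"
    using nn_integral_sublevel_profile[of lebesgue V n] Vpos intV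
    by (simp add: v_def int1 sigma_finite_lebesgue cong: if_cong)
  show "profile_pair u v n"
    by (intro profile_pair.intro profile.intro monoI u_mono v_mono u_nonneg v_nonneg u_nonpos v_nonpos n0 U V)
qed

text \<open>The integrand that survives in the limit: the scalar inequality contributes n + 1 copies
  of it, and the derivative of t^(-n) in the integration by parts removes \<open>n\<close> of
  them.\<close>

definition \<Phi> :: "real \<Rightarrow> real" where "\<Phi> t = (if 0 < t then b t * u t / t ^ (n + 1) else 0)"

lemma Phi_nonneg: "0 \<le> \<Phi> t"
  by (simp add: \<Phi>_def b_nonneg u_nonneg)

lemma Phi_meas[measurable]: "\<Phi> \<in> borel_measurable borel"
  unfolding \<Phi>_def by measurable

lemma Phi_damped_le:
  assumes "0 \<le> r" "r \<le> 1"
  shows "\<bar>\<Phi> t * (1 - (real n + 1) * r ^ n)\<bar> \<le> (real n + 2) * \<Phi> t"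
proof -
  have "0 \<le> r ^ n" "r ^ n \<le> 1" using assms by (auto intro!: power_le_one)
  then have "0 \<le> (real n + 1) * r ^ n" "(real n + 1) * r ^ n \<le> (real n + 1) * 1"
    by (auto intro!: mult_left_mono)
  then have "\<bar>1 - (real n + 1) * r ^ n\<bar> \<le> real n + 2"
    unfolding abs_le_iff mult_1_right by (intro conjI; linarith)
  then have "\<Phi> t * \<bar>1 - (real n + 1) * r ^ n\<bar> \<le> \<Phi> t * (real n + 2)"
    using Phi_nonneg by (intro mult_left_mono)
  then show ?thesis using Phi_nonneg[of t] by (simp add: abs_mult mult.commute)
qed

text \<open>n \<Phi>(t) is the source density times \<open>b t\<close>, so transport turns its
  integral into the first moment of the target measure. That moment has one power of the level fewer
  in the denominator, which is the layer-cake form of the integral of 1 / V^(n-1).\<close>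

lemma Phi_integral: "integrable lborel \<Phi>" "(\<integral>t. \<Phi> t \<partial>lborel) = 1 / (real n - 1) * (\<integral>y. 1 / V y ^ (n - 1) \<partial>lebesgue)"
proof -
  let ?A = "\<integral>y. 1 / V y ^ (n - 1) \<partial>lebesgue"
  have n1: "n - 1 > 0" "real (n - 1) = real n - 1" using dim by auto
  have A0: "0 \<le> ?A" using Vpos by (intro Bochner_Integration.integral_nonneg) (simp add: less_imp_le)
  have nn: "n - 1 + 1 = n" using dim by simp
  have "ennreal ?A = (\<integral>\<^sup>+t. ennreal (if 0 < t then (real n - 1) * v t / t ^ n else 0) \<partial>lborel)"
    using nn_integral_sublevel_profile[of lebesgue V "n - 1"] Vpos intV' n1
    by (simp only: v_def nn n1(2)) (simp add: sigma_finite_lebesgue cong: if_cong)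
  also have "\<dots> = (\<integral>\<^sup>+t. ennreal ((real n - 1) / n) * (ennreal (Q.dens t) * ennreal t) \<partial>lborel)"
  proof (rule nn_integral_cong)
    fix t :: real
    show "ennreal (if 0 < t then (real n - 1) * v t / t ^ n else 0)
      = ennreal ((real n - 1) / n) * (ennreal (Q.dens t) * ennreal t)"
    proof (cases "0 < t")
      case True
      have "(real n - 1) * v t / t ^ n = (real n - 1) / n * (real n * v t / t ^ (n + 1) * t)"
        using True dim by (simp add: field_simps)
      moreover have "real n - 1 \<ge> 0" using dim by simp
      ultimately show ?thesis
        using True v_nonneg[of t] by (simp add: Q.dens_def ennreal_mult[symmetric])
    qed (simp add: Q.dens_def)
  qed
  also have "\<dots> = ennreal ((real n - 1) / n) * (\<integral>\<^sup>+t. ennreal (Q.dens t) * ennreal t \<partial>lborel)"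
    by (rule nn_integral_cmult) measurable
  also have "(\<integral>\<^sup>+t. ennreal (Q.dens t) * ennreal t \<partial>lborel) = (\<integral>\<^sup>+t. ennreal (P.dens t) * ennreal (b t) \<partial>lborel)"
    by (rule transport[symmetric]) measurable
  also have "\<dots> = (\<integral>\<^sup>+t. ennreal (real n) * ennreal (\<Phi> t) \<partial>lborel)"
    using u_nonneg b_nonneg
    by (intro nn_integral_cong) (auto simp: P.dens_def \<Phi>_def ennreal_mult[symmetric] field_simps)
  also have "\<dots> = ennreal (real n) * (\<integral>\<^sup>+t. ennreal (\<Phi> t) \<partial>lborel)"
    by (rule nn_integral_cmult) measurable
  finally have "ennreal ?A = ennreal ((real n - 1) / n) * (ennreal (real n) * (\<integral>\<^sup>+t. ennreal (\<Phi> t) \<partial>lborel))" .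
  also have "\<dots> = ennreal (real n - 1) * (\<integral>\<^sup>+t. ennreal (\<Phi> t) \<partial>lborel)"
    using dim by (simp add: mult.assoc[symmetric] ennreal_mult[symmetric])
  finally have eq: "ennreal ?A = ennreal (real n - 1) * (\<integral>\<^sup>+t. ennreal (\<Phi> t) \<partial>lborel)" .
  have "ennreal (1 / (real n - 1)) * ennreal ?A = (\<integral>\<^sup>+t. ennreal (\<Phi> t) \<partial>lborel)"
    unfolding eq using dim by (simp add: mult.assoc[symmetric] ennreal_mult[symmetric])
  then have "(\<integral>\<^sup>+t. ennreal (\<Phi> t) \<partial>lborel) = ennreal (1 / (real n - 1) * ?A)"
    using A0 dim by (subst ennreal_mult) auto
  then have "has_bochner_integral lborel \<Phi> (1 / (real n - 1) * ?A)"
    using A0 dim Phi_nonneg by (intro has_bochner_integral_nn_integral) auto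
  then show "integrable lborel \<Phi>" "(\<integral>t. \<Phi> t \<partial>lborel) = 1 / (real n - 1) * ?A"
    by (auto simp: has_bochner_integral_iff)
qed

section \<open>The estimate for a truncated power weight\<close>

context
  fixes \<alpha> R :: real
  assumes ar: "0 < \<alpha>" "\<alpha> < R"
begin

text \<open>\<theta> is minus the derivative of the cutoff \<psi> defined next, apart from the
  corner points. Freezing \<psi> below \<alpha> keeps it bounded near zero, as the infimum of
  \<open>g\<close> may be zero; subtracting 1 / R^n makes it reach zero continuously at
  \<open>R\<close>.\<close>

definition \<theta> :: "real \<Rightarrow> real" where "\<theta> t = (if \<alpha> < t \<and> t < R then real n / t ^ (n + 1) else 0)"
definition \<psi> :: "real \<Rightarrow> real" where "\<psi> s = max 0 (1 / max s \<alpha> ^ n - 1 / R ^ n)"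

lemma theta_meas[measurable]: "\<theta> \<in> borel_measurable borel"
  unfolding \<theta>_def by measurable

lemma theta_nonneg: "0 \<le> \<theta> t" using ar by (simp add: \<theta>_def)

lemma psi_cutoff: "continuous_on UNIV \<psi>" "\<And>t. \<psi> t \<ge> 0" "\<And>t. t \<ge> R \<Longrightarrow> \<psi> t = 0" "R > 0"
proof -
  show "continuous_on UNIV \<psi>" unfolding \<psi>_def using ar
    by (intro continuous_intros) (auto simp: max_def)
  show "\<psi> t \<ge> 0" for t by (simp add: \<psi>_def)
  show "R > 0" using ar by simp
  fix t assume t: "t \<ge> R"
  then have "R ^ n \<le> t ^ n" using ar by (intro power_mono) auto
  then have "1 / t ^ n \<le> 1 / R ^ n" using ar t by (intro divide_left_mono) auto
  moreover have "max t \<alpha> = t" using t ar by simp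
  ultimately show "\<psi> t = 0" by (simp add: \<psi>_def)
qed

lemma psi_meas[measurable]: "\<psi> \<in> borel_measurable borel"
  using psi_cutoff(1) by (rule borel_measurable_continuous_onI)

lemma psi_eq: "\<alpha> < t \<Longrightarrow> t < R \<Longrightarrow> \<psi> t = 1 / t ^ n - 1 / R ^ n"
proof -
  assume t: "\<alpha> < t" "t < R"
  then have "t ^ n \<le> R ^ n" using ar by (intro power_mono) auto
  then have "1 / R ^ n \<le> 1 / t ^ n" using ar t by (intro divide_left_mono) auto
  then show ?thesis using t by (simp add: \<psi>_def)
qed

lemma psi_integral: "ennreal (\<psi> s) = (\<integral>\<^sup>+t. ennreal (\<theta> t) * indicator {s<..} t \<partial>lborel)"
proof (cases "s < R")
  case True
  let ?s = "max s \<alpha>"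
  have s: "0 < ?s" "?s < R" using True ar by auto
  have "(\<integral>\<^sup>+t. ennreal (\<theta> t) * indicator {s<..} t \<partial>lborel)
    = (\<integral>\<^sup>+t. ennreal (real n / t ^ (n + 1)) * indicator {?s..R} t \<partial>lborel)"
    using AE_lborel_singleton[of ?s] AE_lborel_singleton[of R]
    by (intro nn_integral_cong_AE, eventually_elim) (auto simp: \<theta>_def indicator_def split: if_splits)
  also have "\<dots> = ennreal (- 1 / R ^ n - - 1 / ?s ^ n)"
  proof (rule nn_integral_FTC_Icc[where F = "\<lambda>x. - 1 / x ^ n"])
    fix x assume "x \<in> {?s..R}"
    then have x: "?s \<le> x" "x \<le> R" by auto
    have "x ^ n = x * x ^ (n - 1)" using n0 by (metis power_eq_if not_gr_zero)
    then have "real n * x ^ (n - 1) / (x ^ n * x ^ n) = real n / x ^ (n + 1)"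
      using s x by (simp add: divide_simps)
    moreover have "((\<lambda>x. - 1 / x ^ n) has_real_derivative real n * x ^ (n - 1) / (x ^ n * x ^ n)) (at x)"
      using s x by (auto intro!: derivative_eq_intros)
    ultimately show "((\<lambda>x. - 1 / x ^ n) has_real_derivative real n / x ^ (n + 1)) (at x)"
      by simp
    have "0 < x" using s x by linarith
    then show "0 \<le> real n / x ^ (n + 1)" by simp
  qed (use s in auto)
  also have "- 1 / R ^ n - - 1 / ?s ^ n = \<psi> s"
  proof -
    have "?s ^ n \<le> R ^ n" using s by (intro power_mono) auto
    then have "1 / R ^ n \<le> 1 / ?s ^ n" using s by (intro divide_left_mono) auto
    then show ?thesis by (simp add: \<psi>_def)
  qed
  finally show ?thesis by simp
next
  case False
  then have "(\<integral>\<^sup>+t. ennreal (\<theta> t) * indicator {s<..} t \<partial>lborel) = (\<integral>\<^sup>+t. 0 \<partial>(lborel::real measure))"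
    by (intro nn_integral_cong) (auto simp: \<theta>_def indicator_def)
  then show ?thesis using False psi_cutoff(3)[of s] by simp
qed

text \<open>Both \<psi>(s) and b(t) - b(s) are integrals, of \<theta> over (s, \<infinity>) and of
  \<open>db\<close> over (s, t]; Tonelli's theorem on the region s < \<tau> \<le> t exchanges them.
  All terms are nonnegative, so the identity holds before any finiteness is known.\<close>

lemma integration_by_parts:
  "ennreal (\<psi> s * b s) + (\<integral>\<^sup>+t. ennreal (\<psi> t * db t) * indicator {s<..} t \<partial>lborel)
    = (\<integral>\<^sup>+t. ennreal (\<theta> t * b t) * indicator {s<..} t \<partial>lborel)"
proof -
  let ?K = "\<lambda>t \<tau>. ennreal (\<theta> t) * indicator {s<..} t * (ennreal (db \<tau>) * indicator {s<..} \<tau> * indicator {\<tau>..} t)"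
  have bt: "ennreal (b t) = ennreal (b s) + (\<integral>\<^sup>+\<tau>. ennreal (db \<tau>) * indicator {s<..} \<tau> * indicator {\<tau>..} t \<partial>lborel)"
    if "s < t" for t
  proof -
    have "(\<integral>\<^sup>+\<tau>. ennreal (db \<tau>) * indicator {..t} \<tau> \<partial>lborel)
      = (\<integral>\<^sup>+\<tau>. ennreal (db \<tau>) * indicator {..s} \<tau> + ennreal (db \<tau>) * indicator {s<..} \<tau> * indicator {\<tau>..} t \<partial>lborel)"
      using that by (intro nn_integral_cong) (auto simp: indicator_def)
    also have "\<dots> = (\<integral>\<^sup>+\<tau>. ennreal (db \<tau>) * indicator {..s} \<tau> \<partial>lborel)
        + (\<integral>\<^sup>+\<tau>. ennreal (db \<tau>) * indicator {s<..} \<tau> * indicator {\<tau>..} t \<partial>lborel)"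
      by (rule nn_integral_add) (simp_all add: indicator_def)
    finally show ?thesis unfolding b_eq_integral[of t] b_eq_integral[of s] by (simp add: add.assoc)
  qed
  have "(\<integral>\<^sup>+t. ennreal (\<theta> t * b t) * indicator {s<..} t \<partial>lborel)
    = (\<integral>\<^sup>+t. ennreal (b s) * (ennreal (\<theta> t) * indicator {s<..} t)
        + (\<integral>\<^sup>+\<tau>. ?K t \<tau> \<partial>lborel) \<partial>lborel)"
  proof (rule nn_integral_cong)
    fix t
    show "ennreal (\<theta> t * b t) * indicator {s<..} t = ennreal (b s) * (ennreal (\<theta> t) * indicator {s<..} t)
        + (\<integral>\<^sup>+\<tau>. ?K t \<tau> \<partial>lborel)"
    proof (cases "s < t")
      case True
      have "(\<integral>\<^sup>+\<tau>. ?K t \<tau> \<partial>lborel)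
        = ennreal (\<theta> t) * indicator {s<..} t * (\<integral>\<^sup>+\<tau>. ennreal (db \<tau>) * indicator {s<..} \<tau> * indicator {\<tau>..} t \<partial>lborel)"
        by (rule nn_integral_cmult) (simp add: indicator_def)
      then show ?thesis using True bt[OF True] theta_nonneg[of t] b_nonneg[of t]
        by (simp add: ennreal_mult distrib_left mult.commute)
    qed simp
  qed
  also have "\<dots> = (\<integral>\<^sup>+t. ennreal (b s) * (ennreal (\<theta> t) * indicator {s<..} t) \<partial>lborel)
      + (\<integral>\<^sup>+t. (\<integral>\<^sup>+\<tau>. ?K t \<tau> \<partial>lborel) \<partial>lborel)"
    by (rule nn_integral_add) (simp_all add: indicator_def)
  also have "(\<integral>\<^sup>+t. ennreal (b s) * (ennreal (\<theta> t) * indicator {s<..} t) \<partial>lborel) = ennreal (\<psi> s * b s)"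
  proof -
    have "(\<integral>\<^sup>+t. ennreal (b s) * (ennreal (\<theta> t) * indicator {s<..} t) \<partial>lborel)
      = ennreal (b s) * (\<integral>\<^sup>+t. ennreal (\<theta> t) * indicator {s<..} t \<partial>lborel)"
      by (rule nn_integral_cmult) simp
    also have "\<dots> = ennreal (b s) * ennreal (\<psi> s)" by (simp only: psi_integral)
    finally show ?thesis using psi_cutoff(2)[of s] b_nonneg[of s] by (simp add: ennreal_mult mult.commute)
  qed
  also have "(\<integral>\<^sup>+t. (\<integral>\<^sup>+\<tau>. ?K t \<tau> \<partial>lborel) \<partial>lborel)
    = (\<integral>\<^sup>+\<tau>. (\<integral>\<^sup>+t. ?K t \<tau> \<partial>lborel) \<partial>lborel)"
    by (rule lborel_pair.Fubini'[symmetric]) (simp add: indicator_def, measurable)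
  also have "\<dots> = (\<integral>\<^sup>+\<tau>. ennreal (\<psi> \<tau> * db \<tau>) * indicator {s<..} \<tau> \<partial>lborel)"
  proof (rule nn_integral_cong)
    fix \<tau>
    have "(\<integral>\<^sup>+t. ?K t \<tau> \<partial>lborel)
      = (\<integral>\<^sup>+t. (ennreal (db \<tau>) * indicator {s<..} \<tau>) * (ennreal (\<theta> t) * indicator {\<tau><..} t) \<partial>lborel)"
      using AE_lborel_singleton[of \<tau>]
      by (intro nn_integral_cong_AE, eventually_elim) (auto simp: indicator_def mult.commute)
    also have "\<dots> = (ennreal (db \<tau>) * indicator {s<..} \<tau>) * ennreal (\<psi> \<tau>)"
      by (subst nn_integral_cmult) (auto simp: psi_integral)
    finally show "(\<integral>\<^sup>+t. ?K t \<tau> \<partial>lborel)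
      = ennreal (\<psi> \<tau> * db \<tau>) * indicator {s<..} \<tau>"
      using psi_cutoff(2)[of \<tau>] db_nonneg[of \<tau>] by (simp add: ennreal_mult mult.commute mult.left_commute)
  qed
  finally show ?thesis by simp
qed

text \<open>The previous identity at \<open>s = g x\<close>, integrated over \<open>x\<close>; the
  layer-cake formula replaces the indicators by the volume \<open>u t\<close>.\<close>

lemma integrated_by_parts:
  "ennreal (\<integral>x. \<psi> (g x) * b (g x) \<partial>lborel) + (\<integral>\<^sup>+t. ennreal (\<psi> t * db t * u t) \<partial>lborel)
    = (\<integral>\<^sup>+t. ennreal (\<theta> t * b t * u t) \<partial>lborel)"
proof -
  have psib: "continuous_on UNIV (\<lambda>t. \<psi> t * b t)" "\<And>t. 0 \<le> \<psi> t * b t" "\<And>t. t \<ge> R \<Longrightarrow> \<psi> t * b t = 0"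
    using psi_cutoff b_nonneg b_cont by (auto intro!: continuous_intros)
  have "ennreal (\<integral>x. \<psi> (g x) * b (g x) \<partial>lborel) = (\<integral>\<^sup>+x. ennreal (\<psi> (g x) * b (g x)) \<partial>lborel)"
    using psib(2) by (intro nn_integral_eq_integral[symmetric] cutoff_integrable(2)[OF psib psi_cutoff(4)]) auto
  moreover have "(\<integral>\<^sup>+t. ennreal (\<psi> t * db t * u t) \<partial>lborel) = (\<integral>\<^sup>+x. (\<integral>\<^sup>+t. ennreal (\<psi> t * db t) * indicator {g x<..} t \<partial>lborel) \<partial>lborel)"
    using psi_cutoff(2) db_nonneg u_nonneg
    by (subst layer_cake) (auto simp: lborel.sigma_finite_measure_axioms emeasure_u ennreal_mult)
  moreover have "(\<integral>\<^sup>+t. ennreal (\<theta> t * b t * u t) \<partial>lborel) = (\<integral>\<^sup>+x. (\<integral>\<^sup>+t. ennreal (\<theta> t * b t) * indicator {g x<..} t \<partial>lborel) \<partial>lborel)"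
    using theta_nonneg b_nonneg u_nonneg
    by (subst layer_cake) (auto simp: lborel.sigma_finite_measure_axioms emeasure_u ennreal_mult)
  ultimately show ?thesis
    by (simp only: integration_by_parts[symmetric])
       (subst nn_integral_add; simp add: indicator_def)
qed

text \<open>\<open>db t\<close> equals (b/t)^(n+1) times u(t) / v(b(t)), so this is the weighted
  Bernoulli inequality for the volume radii. Strictly above \<open>P.m\<close> the value
  \<open>b t\<close> exceeds \<open>Q.m\<close>, hence \<open>v (b t)\<close> is positive and the
  quotient is genuine.\<close>

lemma db_bound:
  assumes t: "0 < t" "t \<noteq> P.m"
  shows "(real n + 1) * (b t * u t / t) \<le> real n * (rv (b t) * ru t ^ (n - 1)) + db t * u t"
proof (cases "u t = 0")
  case True
  then show ?thesis by (simp add: rv_nonneg ru_nonneg)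
next
  case False
  then have "P.m < t" using P.U_zero[of t] t by (cases "t < P.m") auto
  then have bt: "Q.m < b t" by (rule b_strict)
  then have vb: "0 < v (b t)" by (rule Q.U_pos)
  have b0: "0 < b t" using bt Q.m_nonneg by linarith
  have ut: "0 < u t" using False u_nonneg[of t] by simp
  have "(real n + 1) * (b t * ru t ^ n / t)
      \<le> real n * (rv (b t) * ru t ^ (n - 1)) + ru t ^ n / t ^ (n + 1) * (b t ^ (n + 1) / rv (b t) ^ n) * ru t ^ n"
    using ut vb b0 t by (intro weighted_Bernoulli) (auto simp: ru_def rv_def)
  moreover have "db t = u t / t ^ (n + 1) * (b t ^ (n + 1) / v (b t))"
    using t b0 dim by (simp add: db_def P.dens_def Q.dens_def)
  ultimately show ?thesis by (simp only: ru_pow rv_pow)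
qed

text \<open>The layered inequality and the integration by parts combine so that the terms with b(g)
  cancel. After \<open>db_bound\<close> the integrand is at least ((n + 1) \<psi>(t)/t -
  \<theta>(t)) b(t) u(t), and on (\<alpha>, R) the bracket equals t^(-n-1) (1 - (n + 1) (t/R)^n).
  This is the origin of the damping factor in \<open>f\<close>.\<close>

lemma cutoff_lower_bound:
  defines "f \<equiv> \<lambda>t. if \<alpha> < t \<and> t < R then \<Phi> t * (1 - (real n + 1) * (t / R) ^ n) else 0"
  shows "integrable lborel f" "(\<integral>t. f t \<partial>lborel) \<le> (\<integral>x. \<psi> (g x) * w x \<partial>lborel)"
proof -
  have [measurable]: "f \<in> borel_measurable borel" unfolding f_def by measurable
  show intf: "integrable lborel f"
  proof (rule Bochner_Integration.integrable_bound)
    show "integrable lborel (\<lambda>t. (real n + 2) * \<Phi> t)" using Phi_integral by simp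
    show "AE t in lborel. norm (f t) \<le> norm ((real n + 2) * \<Phi> t)"
    proof (rule AE_I2)
      fix t
      show "norm (f t) \<le> norm ((real n + 2) * \<Phi> t)"
      proof (cases "\<alpha> < t \<and> t < R")
        case True
        then have "0 \<le> t / R" "t / R \<le> 1" using ar by auto
        then show ?thesis using True Phi_damped_le[of "t / R" t] Phi_nonneg[of t] by (simp add: f_def)
      qed (auto simp: f_def)
    qed
  qed simp
  let ?X = "\<integral>x. \<psi> (g x) * w x \<partial>lborel" and ?Y = "\<integral>x. \<psi> (g x) * b (g x) \<partial>lborel"
  let ?Z = "\<integral>t. \<psi> t * db t * u t \<partial>lborel" and ?T = "\<integral>t. \<theta> t * b t * u t \<partial>lborel"
  let ?L = "\<lambda>t. \<psi> t * (rv (b t) * ru t ^ (n - 1))"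
  have III: "n * (\<integral>t. ?L t \<partial>lborel) \<le> ?X + ?Y"
  proof (rule layered_inequality[OF psi_cutoff b_cont b_nonneg])
    fix t c assume "b t < c"
    then have "Q.m < c" using b_spec(1)[of t] by linarith
    then have "0 < v c" by (rule Q.U_pos)
    then have "{y. V y < c} \<noteq> {}" unfolding v_def by (metis measure_empty less_irrefl)
    then show "\<exists>y. V y < c" by blast
  qed
  have intL: "integrable lborel ?L"
  proof (rule cutoff_times_integrable[OF psi_cutoff, where c = "rv (b R) * ru R ^ (n - 1)"])
    show "rv (b t) * ru t ^ (n - 1) \<le> rv (b R) * ru R ^ (n - 1)" if "t \<le> R" for t
      using monoD[OF mono_b that] that by (intro mult_mono power_mono rv_mono ru_mono) (auto simp: ru_nonneg rv_nonneg)
    show "rv (b t) * ru t ^ (n - 1) = 0" if "t \<le> 0" for t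
      unfolding ru_pow_nonpos[OF that] by simp
  qed (auto simp: ru_nonneg rv_nonneg)
  have Tnn: "0 \<le> \<theta> t * b t * u t" and Znn: "0 \<le> \<psi> t * db t * u t" for t
    using theta_nonneg b_nonneg u_nonneg psi_cutoff(2) db_nonneg by auto
  have intT: "integrable lborel (\<lambda>t. \<theta> t * b t * u t)"
  proof (rule Bochner_Integration.integrable_bound)
    show "integrable lborel (\<lambda>t. real n * \<Phi> t)" using Phi_integral by simp
    show "AE t in lborel. norm (\<theta> t * b t * u t) \<le> norm (real n * \<Phi> t)"
      using ar b_nonneg u_nonneg by (intro AE_I2) (auto simp: \<theta>_def \<Phi>_def abs_mult)
  qed simp
  have Tint: "(\<integral>\<^sup>+t. ennreal (\<theta> t * b t * u t) \<partial>lborel) = ennreal ?T"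
    using Tnn by (intro nn_integral_eq_integral intT) auto
  have "(\<integral>\<^sup>+t. ennreal (\<psi> t * db t * u t) \<partial>lborel) \<le> ennreal ?T"
    unfolding Tint[symmetric] integrated_by_parts[symmetric] by (rule add_increasing) auto
  \<comment> \<open>Finiteness of the integral involving \<open>db\<close> is read off from the
    identity itself, whose right-hand side is dominated by a multiple of \<Phi>.\<close>
  then have intZ: "integrable lborel (\<lambda>t. \<psi> t * db t * u t)"
    using Znn by (intro integrableI_nonneg) (auto simp: less_top[symmetric] top_unique intro: le_less_trans)
  have "ennreal ?Y + ennreal ?Z = ennreal ?T"
    using integrated_by_parts unfolding Tint using Znn by (simp add: nn_integral_eq_integral[OF intZ])
  moreover have "0 \<le> ?Y" "0 \<le> ?Z" "0 \<le> ?T"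
    using psi_cutoff(2) b_nonneg Znn Tnn by (auto intro!: integral_nonneg)
  ultimately have YZT: "?Y + ?Z = ?T" by (simp add: ennreal_plus[symmetric] del: ennreal_plus)
  have "(\<integral>t. f t \<partial>lborel) \<le> (\<integral>t. n * ?L t + \<psi> t * db t * u t - \<theta> t * b t * u t \<partial>lborel)"
  proof (rule integral_mono_AE)
    show "AE t in lborel. f t \<le> n * ?L t + \<psi> t * db t * u t - \<theta> t * b t * u t"
      using AE_lborel_singleton[of P.m]
    proof eventually_elim
      case (elim t)
      show ?case
      proof (cases "0 < t \<and> t < R")
        case False
        then consider "t \<le> 0" | "R \<le> t" by linarith
        then show ?thesis
        proof cases
          case 1
          show ?thesis unfolding ru_pow_nonpos[OF 1] using 1 ar by (simp add: f_def \<theta>_def u_nonpos)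
        qed (simp add: f_def \<theta>_def psi_cutoff(3))
      next
        case True
        have "\<psi> t * ((real n + 1) * (b t * u t / t)) \<le> \<psi> t * (real n * (rv (b t) * ru t ^ (n - 1)) + db t * u t)"
          using True elim psi_cutoff(2) by (intro mult_left_mono db_bound) auto
        then have le: "(real n + 1) * \<psi> t * (b t * u t / t) \<le> n * ?L t + \<psi> t * db t * u t"
          by (simp add: algebra_simps add_divide_distrib)
        show ?thesis
        proof (cases "\<alpha> < t")
          case False
          have "0 \<le> (real n + 1) * \<psi> t * (b t * u t / t)"
            using True psi_cutoff(2)[of t] b_nonneg[of t] u_nonneg[of t] by simp
          then show ?thesis using le False by (simp add: f_def \<theta>_def)
        next
          case a: True
          have "f t = (real n + 1) * \<psi> t * (b t * u t / t) - \<theta> t * b t * u t"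
            using a True ar by (simp add: f_def psi_eq \<theta>_def \<Phi>_def field_simps)
          then show ?thesis using le by simp
        qed
      qed
    qed
  qed (use intf intL intZ intT in auto)
  also have "\<dots> = n * (\<integral>t. ?L t \<partial>lborel) + ?Z - ?T"
  proof -
    have i1: "integrable lborel (\<lambda>t. n * ?L t)" using intL by (rule integrable_mult_right)
    have "(\<integral>t. n * ?L t + \<psi> t * db t * u t - \<theta> t * b t * u t \<partial>lborel) = (\<integral>t. n * ?L t \<partial>lborel) + ?Z - ?T"
      by (subst Bochner_Integration.integral_diff) (auto intro!: Bochner_Integration.integrable_add i1 intZ intT simp: Bochner_Integration.integral_add[OF i1 intZ] simp del: One_nat_def)
    then show ?thesis by simp
  qed
  also have "\<dots> \<le> ?X" using III YZT by simp
  finally show "(\<integral>t. f t \<partial>lborel) \<le> ?X" .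
qed

end

theorem duality_inequality:
  "integrable lborel (\<lambda>x. 1 / g x ^ n * w x)"
  "1 / (real n - 1) * (\<integral>y. 1 / V y ^ (n - 1) \<partial>lebesgue) \<le> (\<integral>x. 1 / g x ^ n * w x \<partial>lborel)"
proof -
  \<comment> \<open>The truncation levels are \<alpha> = e k and R = 1 / e k; the double successor
    gives e k < 1, hence \<alpha> < R already for \<open>k = 0\<close>.\<close>
  define e where "e k = 1 / real (Suc (Suc k))" for k :: nat
  have e: "0 < e k" "e k < 1 / e k" for k by (auto simp: e_def field_simps intro: add_strict_increasing)
  have elim: "e \<longlonglongrightarrow> 0" unfolding e_def by (intro LIMSEQ_Suc lim_1_over_n)
  define f where "f k t = (if e k < t \<and> t < 1 / e k then \<Phi> t * (1 - (real n + 1) * (t / (1 / e k)) ^ n) else 0)" for k t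
  note low = cutoff_lower_bound[OF e, folded f_def]
  have [measurable]: "f k \<in> borel_measurable borel" for k unfolding f_def by measurable
  define P where "P k x = \<psi> (e k) (1 / e k) (g x)" for k x
  have P_eq: "P k x = max 0 (1 / max (g x) (e k) ^ n - e k ^ n)" for k x
    by (simp add: P_def \<psi>_def[OF e] power_divide)
  have flim: "(\<lambda>k. f k t) \<longlonglongrightarrow> \<Phi> t" for t
  proof (cases "0 < t")
    case True
    have "\<forall>\<^sub>F k in sequentially. e k < t" using elim True by (rule order_tendstoD)
    moreover have "\<forall>\<^sub>F k in sequentially. t < 1 / e k"
    proof -
      obtain N :: nat where N: "t < real N" using reals_Archimedean2 by blast
      show ?thesis
        by (rule eventually_sequentiallyI[of N]) (use N in \<open>simp add: e_def\<close>)
    qed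
    ultimately have ev: "\<forall>\<^sub>F k in sequentially. \<Phi> t * (1 - (real n + 1) * (t * e k) ^ n) = f k t"
      by eventually_elim (simp add: f_def)
    have "(\<lambda>k. \<Phi> t * (1 - (real n + 1) * (t * e k) ^ n)) \<longlonglongrightarrow> \<Phi> t * (1 - (real n + 1) * (t * 0) ^ n)"
      by (intro tendsto_intros elim)
    then have "(\<lambda>k. \<Phi> t * (1 - (real n + 1) * (t * e k) ^ n)) \<longlonglongrightarrow> \<Phi> t"
      using n0 by (simp add: power_0_left)
    then show ?thesis by (rule Lim_transform_eventually[OF _ ev])
  next
    case False
    then have "f k t = 0" for k using e(1)[of k] by (auto simp: f_def)
    then show ?thesis using False by (simp add: \<Phi>_def)
  qed
  have clim: "(\<lambda>k. \<integral>t. f k t \<partial>lborel) \<longlonglongrightarrow> (\<integral>t. \<Phi> t \<partial>lborel)"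
  proof (rule integral_dominated_convergence)
    show "integrable lborel (\<lambda>t. (real n + 2) * \<Phi> t)" using Phi_integral by simp
    show "AE t in lborel. norm (f k t) \<le> (real n + 2) * \<Phi> t" for k
    proof (rule AE_I2)
      fix t
      show "norm (f k t) \<le> (real n + 2) * \<Phi> t"
      proof (cases "e k < t \<and> t < 1 / e k")
        case True
        then have "0 \<le> t * e k" "t * e k \<le> 1" using e(1)[of k] by (auto simp: field_simps)
        then show ?thesis using True Phi_damped_le[of "t * e k" t] by (simp add: f_def)
      qed (auto simp: f_def Phi_nonneg)
    qed
  qed (use flim in auto)
  have Plim: "(\<lambda>k. P k x) \<longlonglongrightarrow> 1 / g x ^ n" for x
  proof -
    have "(\<lambda>k. max 0 (1 / max (g x) (e k) ^ n - e k ^ n)) \<longlonglongrightarrow> max 0 (1 / max (g x) 0 ^ n - 0 ^ n)"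
      using gpos[of x] by (intro tendsto_intros elim) auto
    then show ?thesis using gpos[of x] n0 by (simp add: P_eq power_0_left max_def)
  qed
  have P0: "0 \<le> P k x" for k x by (simp add: P_eq)
  have P1: "P k x \<le> 1 / g x ^ n" for k x
  proof -
    have "g x ^ n \<le> max (g x) (e k) ^ n" using gpos[of x] by (intro power_mono) auto
    then have "1 / max (g x) (e k) ^ n \<le> 1 / g x ^ n" using gpos[of x] e(1)[of k] by (intro divide_left_mono) auto
    moreover have "0 \<le> e k ^ n" "0 \<le> 1 / g x ^ n" using gpos[of x] e(1)[of k] by simp_all
    ultimately show ?thesis unfolding P_eq by linarith
  qed
  have Pm: "P k \<in> borel_measurable lborel" for k unfolding P_eq[abs_def] by measurable
  note cut = psi_cutoff[OF e]
  have intP: "integrable lborel (\<lambda>x. P k x * w x)" for k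
    unfolding P_def by (rule cutoff_integrable(1)[OF cut])
  have c: "(\<integral>t. f k t \<partial>lborel) \<le> (\<integral>x. P k x * w x \<partial>lborel)" for k
    unfolding P_def by (rule low(2))
  \<comment> \<open>Integrability of the full weighted Legendre term is obtained here together with
    the inequality; before this limit only its positive part is known to be integrable.\<close>
  note * = integral_ge_limit[OF _ Pm _ P0 P1 Plim intw intP c clim]
  show "integrable lborel (\<lambda>x. 1 / g x ^ n * w x)" by (rule *(1)) auto
  show "1 / (real n - 1) * (\<integral>y. 1 / V y ^ (n - 1) \<partial>lebesgue) \<le> (\<integral>x. 1 / g x ^ n * w x \<partial>lborel)"
    unfolding Phi_integral(2)[symmetric] by (rule *(2)) auto
qed

end

section \<open>The convex case\<close>

lemma integral_lborel_scaleR: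
  fixes f :: "'a::euclidean_space \<Rightarrow> real"
  assumes f: "integrable lborel f" and f0: "\<And>x. 0 \<le> f x" and c: "c > 0"
  shows "integrable lborel (\<lambda>x. f (c *\<^sub>R x))" "(\<integral>x. f (c *\<^sub>R x) \<partial>lborel) = (\<integral>x. f x \<partial>lborel) / c ^ DIM('a)"
proof -
  have [measurable]: "f \<in> borel_measurable borel" using f by auto
  have "ennreal (\<integral>x. f x \<partial>lborel) = (\<integral>\<^sup>+x. ennreal (f x) \<partial>lborel)"
    using f0 by (simp add: nn_integral_eq_integral[OF f])
  also have "\<dots> = ennreal (c ^ DIM('a)) * (\<integral>\<^sup>+x. ennreal (f (c *\<^sub>R x)) \<partial>lborel)"
    by (rule nn_integral_lborel_scaleR[OF _ c]) simp
  finally have eq: "ennreal (\<integral>x. f x \<partial>lborel) = ennreal (c ^ DIM('a)) * (\<integral>\<^sup>+x. ennreal (f (c *\<^sub>R x)) \<partial>lborel)" .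
  have I0: "0 \<le> (\<integral>x. f x \<partial>lborel)" using f0 by (simp add: Bochner_Integration.integral_nonneg)
  have "ennreal (1 / c ^ DIM('a)) * ennreal (\<integral>x. f x \<partial>lborel) = (\<integral>\<^sup>+x. ennreal (f (c *\<^sub>R x)) \<partial>lborel)"
    unfolding eq using c by (simp add: mult.assoc[symmetric] ennreal_mult[symmetric])
  then have "(\<integral>\<^sup>+x. ennreal (f (c *\<^sub>R x)) \<partial>lborel) = ennreal ((\<integral>x. f x \<partial>lborel) / c ^ DIM('a))"
    using I0 c by (simp add: ennreal_mult[symmetric])
  then have "has_bochner_integral lborel (\<lambda>x. f (c *\<^sub>R x)) ((\<integral>x. f x \<partial>lborel) / c ^ DIM('a))"
    using I0 c f0 by (intro has_bochner_integral_nn_integral) auto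
  then show "integrable lborel (\<lambda>x. f (c *\<^sub>R x))" "(\<integral>x. f (c *\<^sub>R x) \<partial>lborel) = (\<integral>x. f x \<partial>lborel) / c ^ DIM('a)"
    by (auto simp: has_bochner_integral_iff)
qed

text \<open>Convexity of p^(-m): its graph lies above the tangent at \<open>q\<close>. It follows
  from Bernoulli's inequality for \<open>q / p\<close> because 1 - p/q \<le> q/p - 1.\<close>

lemma inverse_power_tangent:
  fixes p q :: real
  assumes "p > 0" "q > 0"
  shows "1 / q ^ m - real m * (p - q) / q ^ (m + 1) \<le> 1 / p ^ m"
proof -
  have "0 < q / p" using assms by simp
  then have "1 + real m * (q / p - 1) \<le> (1 + (q / p - 1)) ^ m"
    by (intro Bernoulli_inequality) auto
  then have B: "1 + real m * (q / p - 1) \<le> (q / p) ^ m" by simp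
  have "0 \<le> (p - q)\<^sup>2 / (p * q)" using assms by simp
  also have "(p - q)\<^sup>2 / (p * q) = (q / p - 1) - (1 - p / q)"
    using assms by (simp add: field_simps power2_eq_square)
  finally have "real m * (1 - p / q) \<le> real m * (q / p - 1)" by (intro mult_left_mono) auto
  then have "1 + real m * (1 - p / q) \<le> (q / p) ^ m" using B by linarith
  then have "1 / q ^ m * (1 + real m * (1 - p / q)) \<le> 1 / q ^ m * (q / p) ^ m"
    using assms by (intro mult_left_mono) auto
  moreover have "1 / q ^ m * (q / p) ^ m = 1 / p ^ m" using assms by (simp add: power_divide)
  moreover have "1 / q ^ m * (1 + real m * (1 - p / q)) = 1 / q ^ m - real m * (p - q) / q ^ (m + 1)"
    using assms by (simp add: field_simps)
  ultimately show ?thesis by simp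
qed

lemma convex_on_above_gradient:
  fixes g :: "'a::real_inner \<Rightarrow> real"
  assumes conv: "convex_on UNIV g" and der: "(g has_derivative (\<lambda>h. h \<bullet> p)) (at x)"
  shows "g x + (y - x) \<bullet> p \<le> g y"
proof -
  define \<phi> where "\<phi> t = g (x + t *\<^sub>R (y - x))" for t
  have "convex_on UNIV \<phi>"
  proof (rule convex_onI)
    fix t a b :: real assume t: "0 < t" "t < 1"
    have "x + ((1 - t) *\<^sub>R a + t *\<^sub>R b) *\<^sub>R (y - x) = (1 - t) *\<^sub>R (x + a *\<^sub>R (y - x)) + t *\<^sub>R (x + b *\<^sub>R (y - x))"
      by (simp add: algebra_simps)
    then show "\<phi> ((1 - t) *\<^sub>R a + t *\<^sub>R b) \<le> (1 - t) * \<phi> a + t * \<phi> b"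
      unfolding \<phi>_def using t by (simp only:) (intro convex_onD[OF conv], auto)
  qed simp
  moreover have "(\<phi> has_real_derivative (y - x) \<bullet> p) (at 0)"
  proof -
    have "((\<lambda>t. x + t *\<^sub>R (y - x)) has_derivative (\<lambda>k. k *\<^sub>R (y - x))) (at 0)"
      by (auto intro!: derivative_eq_intros)
    moreover have "(g has_derivative (\<lambda>h. h \<bullet> p)) (at (x + 0 *\<^sub>R (y - x)))" using der by simp
    ultimately have "((\<lambda>t. g (x + t *\<^sub>R (y - x))) has_derivative (\<lambda>k. (k *\<^sub>R (y - x)) \<bullet> p)) (at 0)"
      by (rule has_derivative_compose)
    moreover have "(\<lambda>k. (k *\<^sub>R (y - x)) \<bullet> p) = (*) ((y - x) \<bullet> p)"
      by (simp add: fun_eq_iff mult.commute)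
    ultimately show ?thesis by (simp only: has_field_derivative_def \<phi>_def[abs_def])
  qed
  ultimately have "\<phi> 1 - \<phi> 0 \<ge> ((y - x) \<bullet> p) * (1 - 0)"
    by (intro convex_on_imp_above_tangent[where A = UNIV]) auto
  then show ?thesis by (simp add: \<phi>_def)
qed

text \<open>Integration by parts for \<open>x \<bullet> \<nabla>(g\<^bsup>1-n\<^esup>)\<close> by differentiating the scaling identity
  \<open>\<integral> g(\<lambda>x)\<^bsup>1-n\<^esup> dx = \<lambda>\<^bsup>-n\<^esup> \<integral> g\<^bsup>1-n\<^esup>\<close> at \<open>\<lambda> = 1\<close>; convexity bounds the difference quotients from
  below, so that Fatou's lemma applies.\<close>

lemma convex_radial_integral:
  fixes g :: "'a::euclidean_space \<Rightarrow> real" and Dg :: "'a \<Rightarrow> 'a"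
  defines "n \<equiv> DIM('a)"
  assumes n2: "n \<ge> 2"
    and der: "\<And>x. (g has_derivative (\<lambda>h. h \<bullet> Dg x)) (at x)"
    and contD: "continuous_on UNIV Dg"
    and pos: "\<And>x. g x > 0" and conv: "convex_on UNIV g"
    and int1: "integrable lborel (\<lambda>x. 1 / g x ^ n)" and int2: "integrable lborel (\<lambda>x. 1 / g x ^ (n - 1))"
  shows "integrable lborel (\<lambda>x. (x \<bullet> Dg x - g x) / g x ^ n)"
    "(\<integral>x. (x \<bullet> Dg x - g x) / g x ^ n \<partial>lborel) \<le> 1 / (real n - 1) * (\<integral>x. 1 / g x ^ (n - 1) \<partial>lborel)"
proof -
  define m where "m = n - 1"
  have m: "n = m + 1" "m > 0" "real m = real n - 1" using n2 by (auto simp: m_def)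
  have contg: "continuous_on UNIV g"
    using der by (meson continuous_at_imp_continuous_on has_derivative_continuous)
  have [measurable]: "g \<in> borel_measurable borel" "Dg \<in> borel_measurable borel"
    using contg contD by (auto intro: borel_measurable_continuous_onI)
  let ?A = "\<integral>x. 1 / g x ^ m \<partial>lborel" and ?N = "\<integral>x. 1 / g x ^ n \<partial>lborel"
  have A: "integrable lborel (\<lambda>x. 1 / g x ^ m)" using int2 by (simp add: m_def)
  define d where "d k = 1 / real (Suc k)" for k
  have d: "d k > 0" for k by (simp add: d_def)
  have dlim: "d \<longlonglongrightarrow> 0" unfolding d_def by (intro LIMSEQ_Suc lim_1_over_n)
  define l where "l k = 1 + d k" for k
  have l: "l k > 0" "l k - 1 = d k" for k using d[of k] by (auto simp: l_def)
  have lim_l: "filterlim l (at 1) sequentially"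
    unfolding filterlim_at
    using tendsto_add[OF tendsto_const dlim, of 1] d by (auto simp: l_def[abs_def] less_imp_neq[symmetric])
  \<comment> \<open>The first summand is the difference quotient of 1 / g^m along the dilation. The
    second one compensates its negative part, so that Fatou's lemma applies; its integral converges
    to the integral of its limit, so it cancels in the end.\<close>
  define h where "h k x = (1 / g x ^ m - 1 / g (l k *\<^sub>R x) ^ m) / d k + m * g 0 * (1 / g (l k *\<^sub>R x) ^ n)" for k x
  define h' where "h' x = m * (x \<bullet> Dg x) / g x ^ n + m * g 0 * (1 / g x ^ n)" for x
  have h0: "0 \<le> h k x" for k x
  proof -
    let ?q = "g (l k *\<^sub>R x)" and ?p = "g x"
    have l1: "0 \<le> 1 / l k" "1 / l k \<le> 1" using d[of k] by (auto simp: l_def)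
    \<comment> \<open>\<open>x\<close> is a convex combination of the origin and \<open>l k\<close>
      times \<open>x\<close>; this bounds the decrease of \<open>g\<close> from \<open>x\<close> to
      the dilated point by \<open>d k * g 0\<close>.\<close>
    have "g ((1 - 1 / l k) *\<^sub>R 0 + (1 / l k) *\<^sub>R (l k *\<^sub>R x)) \<le> (1 - 1 / l k) * g 0 + (1 / l k) * ?q"
      using conv l1 by (intro convex_onD) auto
    then have "?p \<le> (1 - 1 / l k) * g 0 + (1 / l k) * ?q" using l(1)[of k] by simp
    then have "l k * ?p \<le> l k * ((1 - 1 / l k) * g 0 + (1 / l k) * ?q)"
      using l(1)[of k] by (intro mult_left_mono) auto
    also have "\<dots> = (l k * (1 - 1 / l k)) * g 0 + (l k * (1 / l k)) * ?q"
      by (simp only: distrib_left mult.assoc)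
    also have "l k * (1 - 1 / l k) = d k" using l[of k] by (simp add: right_diff_distrib)
    also have "l k * (1 / l k) = 1" using l(1)[of k] by simp
    finally have "l k * ?p \<le> d k * g 0 + ?q" by simp
    then have "?p + d k * ?p - ?q \<le> d k * g 0" by (simp add: l_def algebra_simps)
    moreover have "0 \<le> d k * ?p" using d[of k] pos[of x] by simp
    ultimately have pq: "?p - ?q \<le> d k * g 0" by linarith
    have "- (m * (d k * g 0) / ?q ^ n) \<le> - (m * (?p - ?q) / ?q ^ n)"
      using pq pos[of "l k *\<^sub>R x"] by (intro le_imp_neg_le divide_right_mono mult_left_mono) auto
    also have "\<dots> \<le> 1 / ?p ^ m - 1 / ?q ^ m"
      using inverse_power_tangent[OF pos[of x] pos[of "l k *\<^sub>R x"], of m] by (simp add: m(1))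
    finally have "- (m * (d k * g 0) / ?q ^ n) / d k \<le> (1 / ?p ^ m - 1 / ?q ^ m) / d k"
      using d[of k] by (intro divide_right_mono) auto
    then show ?thesis using d[of k] by (simp add: h_def field_simps)
  qed
  have hlim: "(\<lambda>k. h k x) \<longlonglongrightarrow> h' x" for x
  proof -
    have p: "((\<lambda>t. t *\<^sub>R x) has_derivative (\<lambda>h. h *\<^sub>R x)) (at 1)" by (auto intro!: derivative_eq_intros)
    have "((\<lambda>t. g (t *\<^sub>R x)) has_derivative (\<lambda>h. (h *\<^sub>R x) \<bullet> Dg (1 *\<^sub>R x))) (at 1)"
      by (rule has_derivative_compose[OF p der])
    moreover have "(\<lambda>h. (h *\<^sub>R x) \<bullet> Dg (1 *\<^sub>R x)) = (*) (x \<bullet> Dg x)" by (simp add: fun_eq_iff mult.commute)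
    ultimately have dg: "((\<lambda>t. g (t *\<^sub>R x)) has_real_derivative (x \<bullet> Dg x)) (at 1)"
      by (simp only: has_field_derivative_def)
    have "((\<lambda>t. - 1 / g (t *\<^sub>R x) ^ m) has_real_derivative m * g x ^ (m - 1) * (x \<bullet> Dg x) / (g x ^ m * g x ^ m)) (at 1)"
      using pos[of x] by (auto intro!: derivative_eq_intros dg simp: less_imp_neq[symmetric])
    also have "m * g x ^ (m - 1) * (x \<bullet> Dg x) / (g x ^ m * g x ^ m) = m * (x \<bullet> Dg x) / g x ^ n"
    proof -
      have "g x ^ m = g x * g x ^ (m - 1)" using m(2) by (metis power_eq_if not_gr_zero)
      then show ?thesis using pos[of x] by (simp add: m(1))
    qed
    finally have "((\<lambda>t. (- 1 / g (t *\<^sub>R x) ^ m - - 1 / g (1 *\<^sub>R x) ^ m) / (t - 1)) \<longlongrightarrow> m * (x \<bullet> Dg x) / g x ^ n) (at 1)"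
      by (simp only: has_field_derivative_iff)
    from filterlim_compose[OF this lim_l]
    have lim1: "(\<lambda>k. (1 / g x ^ m - 1 / g (l k *\<^sub>R x) ^ m) / d k) \<longlonglongrightarrow> m * (x \<bullet> Dg x) / g x ^ n"
      by (simp add: l(2))
    have "(\<lambda>k. g (l k *\<^sub>R x)) \<longlonglongrightarrow> g (1 *\<^sub>R x)"
    proof (rule isCont_tendsto_compose[of _ g])
      show "isCont g (1 *\<^sub>R x)" using contg by (simp add: continuous_on_eq_continuous_at)
      show "(\<lambda>k. l k *\<^sub>R x) \<longlonglongrightarrow> 1 *\<^sub>R x"
        using lim_l by (intro tendsto_intros) (simp add: filterlim_at)
    qed
    then have "(\<lambda>k. m * g 0 * (1 / g (l k *\<^sub>R x) ^ n)) \<longlonglongrightarrow> m * g 0 * (1 / g (1 *\<^sub>R x) ^ n)"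
      using pos[of x] by (intro tendsto_intros) auto
    with lim1 show ?thesis unfolding h_def h'_def by (intro tendsto_add) simp_all
  qed
  have h'0: "0 \<le> h' x" for x by (rule LIMSEQ_le_const[OF hlim]) (use h0 in auto)
  have inth: "integrable lborel (h k)"
    "(\<integral>x. h k x \<partial>lborel) = (?A - ?A / l k ^ n) / d k + m * g 0 * (?N / l k ^ n)" for k
  proof -
    have p: "0 \<le> 1 / g x ^ j" for x j using pos[of x] by simp
    note s1 = integral_lborel_scaleR[OF A p l(1)[of k], folded n_def]
    note s2 = integral_lborel_scaleR[OF int1 p l(1)[of k], folded n_def]
    have i1: "integrable lborel (\<lambda>x. (1 / g x ^ m - 1 / g (l k *\<^sub>R x) ^ m) / d k)"
      by (intro integrable_divide_zero Bochner_Integration.integrable_diff A s1(1))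
    have i2: "integrable lborel (\<lambda>x. m * g 0 * (1 / g (l k *\<^sub>R x) ^ n))"
      by (intro integrable_mult_right s2(1))
    show "integrable lborel (h k)" unfolding h_def[abs_def] by (rule Bochner_Integration.integrable_add[OF i1 i2])
    have "(\<integral>x. h k x \<partial>lborel) = (\<integral>x. (1 / g x ^ m - 1 / g (l k *\<^sub>R x) ^ m) / d k \<partial>lborel) + (\<integral>x. m * g 0 * (1 / g (l k *\<^sub>R x) ^ n) \<partial>lborel)"
      unfolding h_def by (rule Bochner_Integration.integral_add[OF i1 i2])
    also have "(\<integral>x. (1 / g x ^ m - 1 / g (l k *\<^sub>R x) ^ m) / d k \<partial>lborel) = (?A - ?A / l k ^ n) / d k"
      by (simp only: integral_divide_zero Bochner_Integration.integral_diff[OF A s1(1)] s1(2))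
    also have "(\<integral>x. m * g 0 * (1 / g (l k *\<^sub>R x) ^ n) \<partial>lborel) = m * g 0 * (?N / l k ^ n)"
      by (simp only: integral_mult_right_zero s2(2))
    finally show "(\<integral>x. h k x \<partial>lborel) = (?A - ?A / l k ^ n) / d k + m * g 0 * (?N / l k ^ n)" .
  qed
  \<comment> \<open>By the scaling identity the difference quotients integrate to those of - ?A /
    t^n, whose derivative at 1 is n ?A.\<close>
  have Hlim: "(\<lambda>k. \<integral>x. h k x \<partial>lborel) \<longlonglongrightarrow> n * ?A + m * g 0 * ?N"
  proof -
    have "((\<lambda>t::real. - ?A / t ^ n) has_real_derivative n * ?A) (at 1)"
      by (auto intro!: derivative_eq_intros)
    then have "((\<lambda>t::real. (- ?A / t ^ n - - ?A / 1 ^ n) / (t - 1)) \<longlongrightarrow> n * ?A) (at 1)"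
      by (simp only: has_field_derivative_iff)
    from filterlim_compose[OF this lim_l]
    have lim1: "(\<lambda>k. (?A - ?A / l k ^ n) / d k) \<longlonglongrightarrow> n * ?A" by (simp add: l(2))
    have "l \<longlonglongrightarrow> 1" using lim_l by (simp add: filterlim_at)
    then have "(\<lambda>k. m * g 0 * (?N / l k ^ n)) \<longlonglongrightarrow> m * g 0 * (?N / 1 ^ n)"
      by (intro tendsto_intros) auto
    with lim1 show ?thesis unfolding inth(2) by (intro tendsto_add) simp_all
  qed
  have meas: "h k \<in> borel_measurable lborel" "h' \<in> borel_measurable lborel" for k
    unfolding h_def[abs_def] h'_def[abs_def] by measurable
  have "(\<integral>\<^sup>+x. ennreal (h' x) \<partial>lborel) = (\<integral>\<^sup>+x. liminf (\<lambda>k. ennreal (h k x)) \<partial>lborel)"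
    using hlim by (intro nn_integral_cong sym[OF lim_imp_Liminf]) auto
  also have "\<dots> \<le> liminf (\<lambda>k. \<integral>\<^sup>+x. ennreal (h k x) \<partial>lborel)"
    using meas by (intro nn_integral_liminf) auto
  also have "\<dots> = liminf (\<lambda>k. ennreal (\<integral>x. h k x \<partial>lborel))"
    using h0 by (simp add: nn_integral_eq_integral[OF inth(1)])
  also have "\<dots> = ennreal (n * ?A + m * g 0 * ?N)"
    by (intro lim_imp_Liminf tendsto_ennrealI Hlim) auto
  finally have nn: "(\<integral>\<^sup>+x. ennreal (h' x) \<partial>lborel) \<le> ennreal (n * ?A + m * g 0 * ?N)" .
  have inth': "integrable lborel h'"
    using nn h'0 meas(2) by (intro integrableI_nonneg) (auto simp: less_top[symmetric] top_unique intro: le_less_trans)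
  have "0 \<le> n * ?A + m * g 0 * ?N"
    using pos by (intro add_nonneg_nonneg mult_nonneg_nonneg Bochner_Integration.integral_nonneg) (auto simp: less_imp_le)
  moreover have "ennreal (\<integral>x. h' x \<partial>lborel) \<le> ennreal (n * ?A + m * g 0 * ?N)"
    using nn h'0 by (simp add: nn_integral_eq_integral[OF inth'])
  ultimately have H': "(\<integral>x. h' x \<partial>lborel) \<le> n * ?A + m * g 0 * ?N"
    by (simp add: ennreal_le_iff)
  \<comment> \<open>The compensating term is removed again. In the final value, n/m - 1 = 1/m
    because n = m + 1.\<close>
  have eq: "(x \<bullet> Dg x - g x) / g x ^ n = (1 / m) * h' x - g 0 * (1 / g x ^ n) - 1 / g x ^ m" for x
  proof -
    have a: "1 / g x ^ m = g x / g x ^ n" using pos[of x] by (simp add: m(1))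
    have b: "(1 / m) * h' x = (x \<bullet> Dg x) / g x ^ n + g 0 * (1 / g x ^ n)"
      using m(2) by (simp add: h'_def distrib_left)
    show ?thesis unfolding a b by (simp add: diff_divide_distrib)
  qed
  have i: "integrable lborel (\<lambda>x. (1 / m) * h' x)" "integrable lborel (\<lambda>x. g 0 * (1 / g x ^ n))"
    by (intro integrable_mult_right inth' int1)+
  show "integrable lborel (\<lambda>x. (x \<bullet> Dg x - g x) / g x ^ n)"
    unfolding eq by (intro Bochner_Integration.integrable_diff i A)
  have "(\<integral>x. (x \<bullet> Dg x - g x) / g x ^ n \<partial>lborel) = (1 / m) * (\<integral>x. h' x \<partial>lborel) - g 0 * ?N - ?A"
    unfolding eq Bochner_Integration.integral_diff[OF Bochner_Integration.integrable_diff[OF i] A]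
      Bochner_Integration.integral_diff[OF i]
    by (simp only: integral_mult_right_zero)
  also have "\<dots> \<le> (1 / m) * (n * ?A + m * g 0 * ?N) - g 0 * ?N - ?A"
    using H' m(2) by (intro diff_right_mono mult_left_mono) auto
  also have "\<dots> = 1 / m * ?A" using m(2) by (simp add: m(1) field_simps)
  finally show "(\<integral>x. (x \<bullet> Dg x - g x) / g x ^ n \<partial>lborel) \<le> 1 / (real n - 1) * (\<integral>x. 1 / g x ^ (n - 1) \<partial>lborel)"
    unfolding m(3)[symmetric] m_def[symmetric] .
qed

section \<open>Regularity of the Legendre term and the extended-real statement\<close>

lemma smooth_gradient:
  fixes g :: "real ^ 'n \<Rightarrow> real"
  assumes "smooth g"
  shows "(g has_derivative (\<lambda>h. h \<bullet> gradient g x)) (at x)" "continuous_on UNIV (gradient g)"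
proof -
  have "Ck (Suc 0) g" using assms by (simp add: smooth_def)
  then have d: "\<And>x. g differentiable (at x)" "\<And>v. continuous_on UNIV (\<lambda>x. frechet_derivative g (at x) v)"
    by simp_all
  show "(g has_derivative (\<lambda>h. h \<bullet> gradient g x)) (at x)"
    using gradient_GDERIV[OF d(1)] by (simp add: gderiv_def)
  show "continuous_on UNIV (gradient g)"
    unfolding gradient_def[abs_def] by (intro continuous_on_vec_lambda d(2))
qed

text \<open>A supremum of affine functions is lower semicontinuous: the superlevel sets are unions,
  possibly uncountable, of open sets. An infinite value of \<open>W\<close> gives a constant
  function.\<close>

lemma legendre_measurable:
  fixes W :: "'a::euclidean_space \<Rightarrow> ereal"
  shows "legendre W \<in> borel_measurable borel"
proof (rule borel_measurableI_greater)
  fix a :: ereal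
  have "{p \<in> space borel. a < legendre W p} = (\<Union>x. {p. a < ereal (x \<bullet> p) - W x})"
    by (auto simp: legendre_def less_SUP_iff)
  moreover have "open {p. a < ereal (x \<bullet> p) - W x}" for x
  proof (cases "W x")
    case (real r)
    have "continuous_on UNIV (\<lambda>p. ereal (x \<bullet> p - r))"
      by (intro continuous_on_ereal continuous_intros)
    then have "open {p. a < ereal (x \<bullet> p - r)}"
      by (intro open_Collect_less continuous_on_const)
    then show ?thesis using real by simp
  qed simp_all
  ultimately show "{p \<in> space borel. a < legendre W p} \<in> sets borel"
    by (auto intro!: borel_open open_UN)
qed

lemma powi_uminus_nat: "x powi (- int n) = 1 / (x::real) ^ n"
  by (simp add: power_int_minus inverse_eq_divide)

lemma powi_one_minus_nat: "n \<ge> 1 \<Longrightarrow> x powi (1 - int n) = 1 / (x::real) ^ (n - 1)"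
  using powi_uminus_nat[of x "n - 1"] by (simp add: of_nat_diff)

theorem theorem1:
  fixes W g :: "real ^ 'n \<Rightarrow> real"
  assumes "CARD('n) \<ge> 2"
    and "\<And>x. W x > 0"
    and "integrable lebesgue (\<lambda>x. W x powi (1 - int CARD('n)))"
    and "smooth g"
    and "\<And>x. g x > 0"
    and "ext_integral lebesgue
           (\<lambda>x. legendre (\<lambda>z. ereal (W z)) (gradient g x) * ereal (g x powi (- int CARD('n)))) < \<infinity>"
    and "integrable lebesgue (\<lambda>x. g x powi (1 - int CARD('n)))"
    and "(\<integral>x. g x powi (- int CARD('n)) \<partial>lebesgue) = 1"
    and "(\<integral>x. W x powi (- int CARD('n)) \<partial>lebesgue) = 1"
  shows "ext_integral lebesgue
           (\<lambda>x. legendre (\<lambda>z. ereal (W z)) (gradient g x) * ereal (g x powi (- int CARD('n))))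
         \<ge> ereal (1 / (real CARD('n) - 1) * (\<integral>x. W x powi (1 - int CARD('n)) \<partial>lebesgue))
       \<and> (g = W \<and> convex_on UNIV g \<longrightarrow>
          ext_integral lebesgue
            (\<lambda>x. legendre (\<lambda>z. ereal (W z)) (gradient g x) * ereal (g x powi (- int CARD('n))))
          = ereal (1 / (real CARD('n) - 1) * (\<integral>x. W x powi (1 - int CARD('n)) \<partial>lebesgue)))"
proof -
  define n where "n = CARD('n)"
  note n_card = n_def
  have n2: "n \<ge> 2" and nDIM: "n = DIM(real ^ 'n)" using assms(1) by (simp_all add: n_def)
  let ?L = "legendre (\<lambda>z. ereal (W z))"
  have pw: "x powi (- int CARD('n)) = 1 / x ^ n" "x powi (1 - int CARD('n)) = 1 / x ^ (n - 1)" for x :: real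
    using powi_uminus_nat[of x n] powi_one_minus_nat[of n x] n2 by (simp_all add: n_def)
  define f where "f x = ?L (gradient g x) * ereal (1 / g x ^ n)" for x
  let ?A = "\<integral>x. 1 / W x ^ (n - 1) \<partial>lebesgue"
  have fin: "ext_integral lebesgue f < \<infinity>" using assms(6) by (simp add: f_def[abs_def] pw)
  note gr = smooth_gradient[OF assms(4)]
  have contg: "continuous_on UNIV g"
    using gr(1) by (meson continuous_at_imp_continuous_on has_derivative_continuous)
  have [measurable]: "g \<in> borel_measurable borel" "gradient g \<in> borel_measurable borel"
    using contg gr(2) by (auto intro: borel_measurable_continuous_onI)
  have [measurable]: "?L \<in> borel_measurable borel" by (rule legendre_measurable)
  have [measurable]: "f \<in> borel_measurable borel" unfolding f_def[abs_def] by measurable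
  have g0: "0 < 1 / g x ^ n" for x using assms(5)[of x] by simp
  \<comment> \<open>Measurability of \<open>W\<close> is recovered from that of its power 1 - n, by
    raising it to the power -1/(n-1).\<close>
  have Wmeas: "W \<in> borel_measurable lebesgue"
  proof -
    have [measurable]: "(\<lambda>x. 1 / W x ^ (n - 1)) \<in> borel_measurable lebesgue"
      using assms(3) by (simp only: pw borel_measurable_integrable)
    have "(\<lambda>x. (1 / W x ^ (n - 1)) powr (- 1 / real (n - 1))) \<in> borel_measurable lebesgue"
      by measurable
    also have "(\<lambda>x. (1 / W x ^ (n - 1)) powr (- 1 / real (n - 1))) = W"
    proof
      fix x
      have "- r * (- 1 / r) = 1" if "r \<noteq> 0" for r :: real using that by simp
      from this[of "real (n - 1)"]
      have nn: "- real (n - 1) * (- 1 / real (n - 1)) = 1" using n2 by simp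
      have eq: "(1 / W x ^ (n - 1)) = W x powr (- real (n - 1))"
        using assms(2)[of x] by (simp add: powr_minus powr_realpow inverse_eq_divide)
      have "(1 / W x ^ (n - 1)) powr (- 1 / real (n - 1)) = W x powr (- real (n - 1) * (- 1 / real (n - 1)))"
        unfolding eq by (rule powr_powr)
      also note nn
      finally show "(1 / W x ^ (n - 1)) powr (- 1 / real (n - 1)) = W x"
        using assms(2)[of x] by simp
    qed
    finally show ?thesis .
  qed
  have L_lower: "ereal (y \<bullet> p - W y) \<le> ?L p" for y p
    unfolding legendre_def by (rule SUP_upper2[of y]) auto
  \<comment> \<open>An infinite positive part would make the extended integral infinite whatever the
    negative part is, since \<infinity> - \<infinity> is \<infinity> there.\<close>
  have AE_fin: "AE x in lborel. ?L (gradient g x) < \<infinity>"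
  proof -
    have "(\<integral>\<^sup>+x. e2ennreal (f x) \<partial>lebesgue) \<noteq> \<infinity>"
    proof
      assume "(\<integral>\<^sup>+x. e2ennreal (f x) \<partial>lebesgue) = \<infinity>"
      then have "ext_integral lebesgue f = \<infinity>" by (simp add: ext_integral_def)
      with fin show False by simp
    qed
    then have "(\<integral>\<^sup>+x. e2ennreal (f x) \<partial>lborel) \<noteq> \<infinity>" by (simp add: nn_integral_completion)
    then have "AE x in lborel. e2ennreal (f x) \<noteq> \<infinity>"
      by (rule nn_integral_PInf_AE[rotated]) measurable
    then show ?thesis
    proof eventually_elim
      case (elim x)
      show ?case
      proof (rule ccontr)
        assume "\<not> ?L (gradient g x) < \<infinity>"
        then have "f x = \<infinity>" using assms(5)[of x] by (simp add: f_def)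
        with elim show False by simp
      qed
    qed
  qed
  \<comment> \<open>A real-valued version of the Legendre term. It takes the default value 0 where
    the transform is infinite, which happens only on a null set; the point \<open>y = 0\<close> in
    the supremum excludes the value - \<infinity>.\<close>
  define w where "w x = real_of_ereal (?L (gradient g x))" for x
  have [measurable]: "w \<in> borel_measurable borel" unfolding w_def[abs_def] by measurable
  have AE_w: "AE x in lborel. ?L (gradient g x) = ereal (w x)"
    using AE_fin
  proof eventually_elim
    case (elim x)
    then show ?case using L_lower[of 0 "gradient g x"] by (cases "?L (gradient g x)") (auto simp: w_def)
  qed
  have AE_f: "AE x in lborel. f x = ereal (1 / g x ^ n * w x)"
    using AE_w by eventually_elim (simp add: f_def mult.commute)
  have nn_f: "(\<integral>\<^sup>+x. e2ennreal (f x) \<partial>lebesgue) = (\<integral>\<^sup>+x. ennreal (1 / g x ^ n * w x) \<partial>lborel)"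
    "(\<integral>\<^sup>+x. e2ennreal (- f x) \<partial>lebesgue) = (\<integral>\<^sup>+x. ennreal (- (1 / g x ^ n * w x)) \<partial>lborel)"
    unfolding nn_integral_completion using AE_f
    by (auto intro!: nn_integral_cong_AE elim!: eventually_mono simp: ennreal.abs_eq)
  have ext: "ext_integral lebesgue f = ext_integral lborel (\<lambda>x. ereal (1 / g x ^ n * w x))"
    unfolding ext_integral_def nn_f by (simp add: ennreal.abs_eq)
  \<comment> \<open>Integrability is implied by the normalization, as a function that is not
    integrable has integral 0 and not 1.\<close>
  have intg: "integrable lborel (\<lambda>x. 1 / g x ^ n)" "(\<integral>x. 1 / g x ^ n \<partial>lborel) = 1"
  proof -
    have "(\<integral>x. 1 / g x ^ n \<partial>lebesgue) = 1" using assms(8) by (simp add: pw)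
    then show "(\<integral>x. 1 / g x ^ n \<partial>lborel) = 1" by (subst (asm) integral_completion) auto
    then show "integrable lborel (\<lambda>x. 1 / g x ^ n)" using not_integrable_integral_eq by fastforce
  qed
  have intW: "(\<integral>x. 1 / W x ^ n \<partial>lebesgue) = 1" "integrable lebesgue (\<lambda>x. 1 / W x ^ n)"
  proof -
    show "(\<integral>x. 1 / W x ^ n \<partial>lebesgue) = 1" using assms(9) by (simp add: pw)
    then show "integrable lebesgue (\<lambda>x. 1 / W x ^ n)" using not_integrable_integral_eq by fastforce
  qed
  have intW': "integrable lebesgue (\<lambda>x. 1 / W x ^ (n - 1))" using assms(3) by (simp add: pw)
  interpret normalized_duality g w W "gradient g" n
  proof
    show "integrable lborel (\<lambda>x. 1 / g x ^ n * max 0 (w x))"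
    proof (rule integrableI_nonneg)
      have "(\<integral>\<^sup>+x. ennreal (1 / g x ^ n * max 0 (w x)) \<partial>lborel) = (\<integral>\<^sup>+x. ennreal (1 / g x ^ n * w x) \<partial>lborel)"
      proof (rule nn_integral_cong)
        fix x
        show "ennreal (1 / g x ^ n * max 0 (w x)) = ennreal (1 / g x ^ n * w x)"
        proof (cases "0 \<le> w x")
          case False
          then have "1 / g x ^ n * w x \<le> 0" using g0[of x] by (intro mult_nonneg_nonpos) auto
          then show ?thesis using False by (simp add: ennreal_neg)
        qed simp
      qed
      also have "\<dots> < \<infinity>"
      proof (rule ccontr)
        assume "\<not> (\<integral>\<^sup>+x. ennreal (1 / g x ^ n * w x) \<partial>lborel) < \<infinity>"
        then have "ext_integral lebesgue f = \<infinity>"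
          by (simp add: ext_integral_def nn_f less_top[symmetric])
        with fin show False by simp
      qed
      finally show "(\<integral>\<^sup>+x. ennreal (1 / g x ^ n * max 0 (w x)) \<partial>lborel) < \<infinity>" .
      show "AE x in lborel. 0 \<le> 1 / g x ^ n * max 0 (w x)" using g0 by (auto simp: less_imp_le)
    qed measurable
    show "AE x in lborel. \<forall>y. gradient g x \<bullet> y \<le> w x + W y"
      using AE_w
    proof eventually_elim
      case (elim x)
      show ?case
      proof
        fix y
        have "y \<bullet> gradient g x - W y \<le> w x" using L_lower[of y "gradient g x"] elim by simp
        then show "gradient g x \<bullet> y \<le> w x + W y" by (simp add: inner_commute)
      qed
    qed
  qed (use n2 nDIM gr assms(2,5) intg intW intW' Wmeas in auto)
  note dual = duality_inequality
  have ext_eq: "ext_integral lebesgue f = ereal (\<integral>x. 1 / g x ^ n * w x \<partial>lborel)"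
    unfolding ext by (rule ext_integral_eq_lebesgue_integral[OF dual(1)])
  have part1: "ereal (1 / (real n - 1) * ?A) \<le> ext_integral lebesgue f"
    unfolding ext_eq using dual(2) by simp
  have part2: "ext_integral lebesgue f = ereal (1 / (real n - 1) * ?A)" if gW: "g = W" and conv: "convex_on UNIV g"
  proof (rule antisym[OF _ part1])
    have int2: "integrable lborel (\<lambda>x. 1 / g x ^ (n - 1))"
    proof -
      have "integrable lebesgue (\<lambda>x. 1 / g x ^ (n - 1))" using assms(7) by (simp add: pw)
      then show ?thesis by (subst (asm) integrable_completion) auto
    qed
    have A: "?A = (\<integral>x. 1 / g x ^ (n - 1) \<partial>lborel)"
      unfolding gW[symmetric] by (rule integral_completion) measurable
    note rad = convex_radial_integral[where ?'a = "real ^ 'n", folded nDIM, OF n2 gr assms(5) conv intg(1) int2]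
    \<comment> \<open>By convexity the tangent hyperplane at \<open>x\<close> lies below
      \<open>g\<close>, so the supremum defining the transform of g = W at the gradient is attained
      at \<open>y = x\<close>.\<close>
    have wle: "w x \<le> x \<bullet> gradient g x - g x" for x
    proof -
      have "?L (gradient g x) \<le> ereal (x \<bullet> gradient g x - g x)"
        unfolding legendre_def
      proof (rule SUP_least)
        fix y
        have "g x + (y - x) \<bullet> gradient g x \<le> g y"
          by (rule convex_on_above_gradient[OF conv gr(1)])
        then show "ereal (y \<bullet> gradient g x) - ereal (W y) \<le> ereal (x \<bullet> gradient g x - g x)"
          by (simp add: gW[symmetric] inner_diff_left)
      qed
      then show ?thesis
        using L_lower[of 0 "gradient g x"] by (cases "?L (gradient g x)") (auto simp: w_def)
    qed
    have "(\<integral>x. 1 / g x ^ n * w x \<partial>lborel) \<le> (\<integral>x. (x \<bullet> gradient g x - g x) / g x ^ n \<partial>lborel)"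
    proof (rule integral_mono[OF dual(1) rad(1)])
      fix x
      have "1 / g x ^ n * w x \<le> 1 / g x ^ n * (x \<bullet> gradient g x - g x)"
        using wle g0[of x] by (intro mult_left_mono) auto
      then show "1 / g x ^ n * w x \<le> (x \<bullet> gradient g x - g x) / g x ^ n" by simp
    qed
    also have "\<dots> \<le> 1 / (real n - 1) * ?A" unfolding A by (rule rad(2))
    finally show "ext_integral lebesgue f \<le> ereal (1 / (real n - 1) * ?A)" by (simp add: ext_eq)
  qed
  have f_eq: "(\<lambda>x. ?L (gradient g x) * ereal (g x powi (- int CARD('n)))) = f"
    by (simp add: f_def pw fun_eq_iff)
  show ?thesis
    unfolding f_eq unfolding pw unfolding n_card[symmetric] using part1 part2 by blast
qed

end
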